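(* Let $p\le q$ be positive integers with $\gcd(p,q)=1$, and for each integer $n$ let $d=\gcd(n-1,p+q)$. Then, for $n\gg1$ (with $p,q$ fixed), $$M_h^{I}(p,q,n)\;\ge\;\frac{3}{2d}\,n^2+O(n).$$ In particular, if $p=1$, then $$M_h^{I}(1,q,n)\;\ge\;\frac{2}{d}\,n^2+O(n).$$
   Context: Consider planar systems $$\dot x=px+P(x,y),\qquad \dot y=-qy+Q(x,y),$$ where $P,Q$ are homogeneous polynomials of degree $n$ over $\mathbb R$ or $\mathbb C$, and $p\le q$ are positive integers with $\gcd(p,q)=1$. There is a formal change of coordinates $X=x+\sum_{i+j\ge2}\varphi_{i,j}x^iy^j$, $Y=y+\sum_{i+j\ge2}\psi_{i,j}x^iy^j$ bringing the system to the formal normal form $$\dot X=pX\Bigl(1+\sum_{k\ge1}\pi_{1,k}(X^qY^p)^k\Bigr),\qquad \dot Y=-qY\Bigl(1+\sum_{k\ge1}\pi_{2,k}(X^qY^p)^k\Bigr).$$ The change is taken in the standard normalization without resonant terms, i.e. $\varphi_{1+kq,kp}=\psi_{kq,1+kp}=0$ for all $k\ge1$, so that it is unique. The $k$-th saddle value is $L_k=\pi_{1,k}-\pi_{2,k}$; it is a polynomial in the coefficients of $P$ and $Q$. Regard the coefficients of $P$ and $Q$ as indeterminates, and work in the ring of polynomials in these coefficients over $\mathbb R$ (or $\mathbb C$). Let $I_k$ be the ideal generated by $L_1,\dots,L_k$, and $I_\infty$ the ideal generated by all $L_k$, $k\ge1$. $M_h^I(p,q,n)$ is the minimal number $M$ such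 that $I_M=I_\infty$ (finite by Hilbert's Basis Theorem); equivalently, it is the maximal $k$ such that $L_k\notin I_{k-1}$. *)

theory Defs
  imports
    "HOL-Library.Poly_Mapping"
    "HOL-Library.Extended_Nat"
    "HOL-Library.Extended_Real"
    "HOL-Library.Landau_Symbols"
    "HOL-Computational_Algebra.Formal_Power_Series"
    "HOL-Algebra.Ideal"
begin

text \<open>
  \<open>Coeff_P i j\<close> and \<open>Coeff_Q i j\<close> are the coefficients of \<open>x\<^sup>i y\<^sup>j\<close> in \<open>P\<close> and \<open>Q\<close>,
  regarded as indeterminates.
\<close>

datatype coeff_var = Coeff_P nat nat | Coeff_Q nat nat

type_synonym 'a coeff_poly = "(coeff_var \<Rightarrow>\<^sub>0 nat) \<Rightarrow>\<^sub>0 'a"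

definition indet :: "coeff_var \<Rightarrow> 'a::comm_ring_1 coeff_poly" where
  "indet c = Poly_Mapping.single (Poly_Mapping.single c 1) 1"

definition coeff_vars :: "nat \<Rightarrow> coeff_var set" where
  "coeff_vars n = {Coeff_P i j |i j. i + j = n} \<union> {Coeff_Q i j |i j. i + j = n}"

text \<open>
  The type has infinitely many indeterminates; for a fixed degree \<open>n\<close> the polynomial ring is the
  subring of polynomials involving only the \<open>2 (n + 1)\<close> coefficients of \<open>P\<close> and \<open>Q\<close>.
\<close>

definition coeff_ring :: "nat \<Rightarrow> 'a::comm_ring_1 coeff_poly ring" where
  "coeff_ring n =
    \<lparr>carrier = {f. \<forall>m \<in> Poly_Mapping.keys f. Poly_Mapping.keys m \<subseteq> coeff_vars n},
     monoid.mult = (*), one = 1, zero = 0, add = (+)\<rparr>"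

text \<open>
  Formal power series in \<open>x, y\<close> are iterated: \<open>F $ i $ j\<close> is the coefficient of \<open>x\<^sup>i y\<^sup>j\<close>.
\<close>

unbundle fps_syntax

type_synonym 'a fps2 = "'a fps fps"

abbreviation x_var :: "'a::comm_ring_1 fps2" where "x_var \<equiv> fps_X"
abbreviation y_var :: "'a::comm_ring_1 fps2" where "y_var \<equiv> fps_const fps_X"

definition deriv_x :: "'a::comm_ring_1 fps2 \<Rightarrow> 'a fps2" where
  "deriv_x F = fps_deriv F"

definition deriv_y :: "'a::comm_ring_1 fps2 \<Rightarrow> 'a fps2" where
  "deriv_y F = Abs_fps (\<lambda>i. fps_deriv (F $ i))"

text \<open>
  \<open>subst_fps u W\<close> is \<open>\<Sum>k. u\<^sub>k W\<^sup>k\<close>, for \<open>W\<close> without constant term: then \<open>W\<^sup>k\<close> has no terms of total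
  degree below \<open>k\<close>, so that only \<open>k \<le> i + j\<close> contributes to the coefficient of \<open>x\<^sup>i y\<^sup>j\<close>.
  (The library's \<open>fps_compose\<close> would need \<open>W\<close> to be divisible by \<open>x\<close>.)
\<close>

definition subst_fps :: "'a::comm_ring_1 fps \<Rightarrow> 'a fps2 \<Rightarrow> 'a fps2" where
  "subst_fps u W = Abs_fps (\<lambda>i. Abs_fps (\<lambda>j. \<Sum>k\<le>i + j. u $ k * (W ^ k) $ i $ j))"

text \<open>
  \<open>(X, Y)\<close> is a formal change of coordinates, without resonant terms, taking \<open>x' = F\<close>, \<open>y' = G\<close> to
  \<open>X' = p X u(X\<^sup>q Y\<^sup>p)\<close>, \<open>Y' = - q Y v(X\<^sup>q Y\<^sup>p)\<close>, where \<open>u = 1 + \<Sum>k\<ge>1. \<pi>\<^sub>1\<^sub>,\<^sub>k t\<^sup>k\<close> and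
  \<open>v = 1 + \<Sum>k\<ge>1. \<pi>\<^sub>2\<^sub>,\<^sub>k t\<^sup>k\<close>.
\<close>

definition is_normalization ::
  "nat \<Rightarrow> nat \<Rightarrow> 'a::comm_ring_1 fps2 \<Rightarrow> 'a fps2 \<Rightarrow>
   'a fps2 \<Rightarrow> 'a fps2 \<Rightarrow> 'a fps \<Rightarrow> 'a fps \<Rightarrow> bool" where
  "is_normalization p q F G X Y u v \<longleftrightarrow>
     X $ 0 $ 0 = 0 \<and> X $ 1 $ 0 = 1 \<and> X $ 0 $ 1 = 0 \<and>
     Y $ 0 $ 0 = 0 \<and> Y $ 1 $ 0 = 0 \<and> Y $ 0 $ 1 = 1 \<and>
     (\<forall>k\<ge>1. X $ (1 + k * q) $ (k * p) = 0 \<and> Y $ (k * q) $ (1 + k * p) = 0) \<and>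
     u $ 0 = 1 \<and> v $ 0 = 1 \<and>
     deriv_x X * F + deriv_y X * G = of_nat p * X * subst_fps u (X ^ q * Y ^ p) \<and>
     deriv_x Y * F + deriv_y Y * G = - of_nat q * Y * subst_fps v (X ^ q * Y ^ p)"

definition generic_P :: "nat \<Rightarrow> 'a::comm_ring_1 coeff_poly fps2" where
  "generic_P n = Abs_fps (\<lambda>i. Abs_fps (\<lambda>j. if i + j = n then indet (Coeff_P i j) else 0))"

definition generic_Q :: "nat \<Rightarrow> 'a::comm_ring_1 coeff_poly fps2" where
  "generic_Q n = Abs_fps (\<lambda>i. Abs_fps (\<lambda>j. if i + j = n then indet (Coeff_Q i j) else 0))"

text \<open>
  The normalization is carried out over the ring of polynomials in the coefficients, so that the
  saddle values are such polynomials; this needs \<open>p\<close>, \<open>q\<close> and the nonzero integers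
  \<open>p (i - 1) - q j\<close>, \<open>p i - q (j - 1)\<close> to be invertible, hence characteristic zero.
\<close>

definition saddle_value ::
  "nat \<Rightarrow> nat \<Rightarrow> nat \<Rightarrow> nat \<Rightarrow> 'a::field_char_0 coeff_poly" where
  "saddle_value p q n k =
     (THE L. \<exists>X Y u v.
        is_normalization p q
          (of_nat p * x_var + generic_P n) (- of_nat q * y_var + generic_Q n) X Y u v \<and>
        L = u $ k - v $ k)"

definition saddle_ideal ::
  "nat \<Rightarrow> nat \<Rightarrow> nat \<Rightarrow> nat \<Rightarrow> 'a::field_char_0 coeff_poly set" where
  "saddle_ideal p q n k = Idl\<^bsub>coeff_ring n\<^esub> (saddle_value p q n ` {1..k})"

definition saddle_ideal_inf ::
  "nat \<Rightarrow> nat \<Rightarrow> nat \<Rightarrow> 'a::field_char_0 coeff_poly set" where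
  "saddle_ideal_inf p q n = Idl\<^bsub>coeff_ring n\<^esub> (saddle_value p q n ` {1..})"

text \<open>
  The minimal \<open>M\<close> for which the first \<open>M\<close> saddle values generate the ideal of all of them. It is taken
  in the extended natural numbers, where it makes sense before one knows by Hilbert's basis theorem
  that such an \<open>M\<close> exists. The first argument selects the ground field.
\<close>

definition M_hI :: "'a::field_char_0 itself \<Rightarrow> nat \<Rightarrow> nat \<Rightarrow> nat \<Rightarrow> enat" where
  "M_hI _ p q n =
     Inf {enat M |M. (saddle_ideal p q n M :: 'a coeff_poly set) = saddle_ideal_inf p q n}"

end

theory Submission
  imports Defs
begin

text \<open>
  Let \<open>C\<close> be homogeneous of degree \<open>n - 1\<close>, put \<open>R = - (p x C\<^sub>x - q y C\<^sub>y) / (n - 1)\<close> and \<open>D = 1 - C\<close>. The radial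
  system \<open>x' = x (p + R)\<close>, \<open>y' = y (- q + R)\<close> is integrable: with \<open>d = gcd (n - 1) (p + q)\<close>,
  \<open>M = (n - 1) / d\<close>, \<open>\<nu> = (p + q) / d\<close> it has the first integral \<open>(x\<^sup>q y\<^sup>p)\<^sup>M D\<^sup>-\<^sup>\<nu>\<close> and the integrating
  factor \<open>1 / (x y D)\<close>. Replace \<open>y (- q + R)\<close> by \<open>y (- q + R + \<epsilon> S)\<close>. All saddle values then vanish modulo
  \<open>\<epsilon>\<close>, those \<open>L\<^sub>k\<close> with \<open>M\<close> not dividing \<open>k\<close> vanish altogether, and the first \<open>L\<^sub>m\<^sub>M\<close> that is nonzero
  modulo \<open>\<epsilon>\<^sup>2\<close> is a residue, which up to a nonzero factor is the coefficient of \<open>(x\<^sup>q y\<^sup>p)\<^sup>m\<^sup>M\<close> in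
  \<open>(p x S\<^sub>x - q y S\<^sub>y) C\<^sup>m\<^sup>\<nu>\<^sup>-\<^sup>1\<close>. If \<open>C\<close> and \<open>S\<close> consist of two monomials whose exponents differ by \<open>K = n - O(1)\<close>,
  the exponents can be arranged so that this coefficient can be nonzero only for \<open>m\<close> in one residue
  class modulo \<open>K\<close>, namely that of \<open>-d\<close>. For \<open>m = K - d\<close> it is killed by the ratio of the two coefficients of \<open>S\<close>,
  and for \<open>m = 2 K - d\<close> it then survives. Polynomials in the coefficients whose specialization
  vanishes modulo \<open>\<epsilon>\<^sup>2\<close> form an ideal, so \<open>L\<^sub>k\<close> with \<open>k = (2 K - d) M = 2 n\<^sup>2 / d - O(n)\<close> is not in the ideal
  of its predecessors. This gives the constant \<open>2\<close> for every \<open>p\<close>.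
\<close>

section \<open>Series in two variables\<close>

lemma fps2_eqI: "(\<And>i j. F $ i $ j = G $ i $ j) \<Longrightarrow> F = (G :: 'a::zero fps fps)"
  by (simp add: fps_eq_iff)

lemma fps2_mult_nth:
  fixes F G :: "'a::comm_ring_1 fps2"
  shows "(F * G) $ i $ j = (\<Sum>a\<le>i. \<Sum>b\<le>j. F $ a $ b * G $ (i - a) $ (j - b))"
  by (simp add: fps_mult_nth fps_sum_nth atLeast0AtMost)

definition fps2_monom :: "'a::comm_ring_1 \<Rightarrow> nat \<Rightarrow> nat \<Rightarrow> 'a fps2" where
  "fps2_monom c a b = Abs_fps (\<lambda>i. Abs_fps (\<lambda>j. if i = a \<and> j = b then c else 0))"

lemma fps2_monom_nth [simp]: "fps2_monom c a b $ i $ j = (if i = a \<and> j = b then c else 0)"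
  by (simp add: fps2_monom_def)

lemma fps2_monom_mult_nth:
  "(fps2_monom c a b * F) $ i $ j = (if a \<le> i \<and> b \<le> j then c * F $ (i - a) $ (j - b) else 0)"
proof -
  have "(\<Sum>b'\<le>j. fps2_monom c a b $ a' $ b' * F $ (i - a') $ (j - b'))
      = (if a' = a then (if b \<le> j then c * F $ (i - a) $ (j - b) else 0) else 0)" for a'
  proof (cases "a' = a")
    case True
    have "(\<Sum>b'\<le>j. fps2_monom c a b $ a' $ b' * F $ (i - a') $ (j - b'))
        = (\<Sum>b'\<le>j. if b' = b then c * F $ (i - a) $ (j - b') else 0)"
      using True by (intro sum.cong) auto
    then show ?thesis using True by simp
  qed simp
  then show ?thesis by (simp add: fps2_mult_nth)
qed

lemma fps2_monom_mult: "fps2_monom c a b * fps2_monom c' a' b' = fps2_monom (c * c') (a + a') (b + b')"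
  by (rule fps2_eqI) (auto simp: fps2_monom_mult_nth)

lemma fps2_monom_1: "fps2_monom 1 0 0 = 1"
  by (rule fps2_eqI) auto

lemma fps2_monom_power: "fps2_monom c a b ^ k = fps2_monom (c ^ k) (k * a) (k * b)"
  by (induction k) (simp_all add: fps2_monom_mult fps2_monom_1)

lemma x_var_eq_monom: "x_var = fps2_monom 1 1 0"
  by (rule fps2_eqI) (auto simp: fps_X_def)

lemma y_var_eq_monom: "y_var = fps2_monom 1 0 1"
  by (rule fps2_eqI) (auto simp: fps_X_def fps_const_def)

lemma of_nat_eq_monom: "of_nat c = fps2_monom (of_nat c) 0 0"
  by (rule fps2_eqI) (auto simp: fps_of_nat[symmetric])

lemma of_nat_mult_nth2: "(of_nat c * F :: 'a::comm_ring_1 fps2) $ i $ j = of_nat c * F $ i $ j"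
  by (simp add: of_nat_eq_monom fps2_monom_mult_nth)

lemma deriv_x_nth: "deriv_x F $ i $ j = of_nat (i + 1) * F $ (i + 1) $ j"
  by (simp add: deriv_x_def fps_of_nat[symmetric] del: of_nat_add of_nat_Suc)

lemma deriv_y_nth: "deriv_y F $ i $ j = of_nat (j + 1) * F $ i $ (j + 1)"
  by (simp add: deriv_y_def del: of_nat_add of_nat_Suc)

section \<open>Order of vanishing and leading monomials\<close>

definition low :: "nat \<Rightarrow> 'a::comm_ring_1 fps2 \<Rightarrow> bool" where
  "low N F \<longleftrightarrow> (\<forall>i j. i + j < N \<longrightarrow> F $ i $ j = 0)"

lemma lowD: "low N F \<Longrightarrow> i + j < N \<Longrightarrow> F $ i $ j = 0"
  by (simp add: low_def)

lemma low_mono: "low N F \<Longrightarrow> N' \<le> N \<Longrightarrow> low N' F"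
  by (simp add: low_def)

lemma low_0 [simp]: "low 0 F" "low N 0"
  by (simp_all add: low_def)

lemma low_add: "low N F \<Longrightarrow> low N G \<Longrightarrow> low N (F + G)"
  by (simp add: low_def)

lemma low_diff: "low N F \<Longrightarrow> low N G \<Longrightarrow> low N (F - G)"
  by (simp add: low_def)

lemma low_mult:
  assumes "low a F" "low b G"
  shows "low (a + b) (F * G)"
  unfolding low_def
proof (intro allI impI)
  fix i j assume ij: "i + j < a + b"
  have "F $ s $ t * G $ (i - s) $ (j - t) = 0" if "s \<le> i" "t \<le> j" for s t
  proof (cases "s + t < a")
    case False
    then have "i - s + (j - t) < b" using ij that by linarith
    then show ?thesis using assms(2) by (simp add: lowD)
  qed (use assms(1) in \<open>simp add: lowD\<close>)
  then show "(F * G) $ i $ j = 0" by (simp add: fps2_mult_nth)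
qed

lemma low_mult_left: "low a F \<Longrightarrow> low a (F * G)"
  using low_mult[of a F 0 G] by simp

lemma low_mult_right: "low a G \<Longrightarrow> low a (F * G)"
  using low_mult[of 0 F a G] by simp

lemma low_power: "low a F \<Longrightarrow> low (k * a) (F ^ k)"
  by (induction k) (simp_all add: low_mult)

text \<open>\<open>low N (F - G)\<close> serves throughout as congruence modulo the
  \<open>N\<close>-th power of the ideal generated by x and y; such congruences pass to powers and
  products.\<close>

lemma low_power_diff:
  assumes "low N (F - G)"
  shows "low N (F ^ k - G ^ k)"
proof (induction k)
  case (Suc k)
  have "F ^ Suc k - G ^ Suc k = (F - G) * F ^ k + G * (F ^ k - G ^ k)"
    by (simp add: algebra_simps)
  then show ?case using assms Suc by (simp add: low_add low_mult_left low_mult_right)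
qed simp

lemma low_mult_diff:
  assumes "low N (F - F')" "low N (G - G')"
  shows "low N (F * G - F' * G')"
proof -
  have "F * G - F' * G' = (F - F') * G + F' * (G - G')"
    by (simp add: algebra_simps)
  then show ?thesis using assms by (simp add: low_add low_mult_left low_mult_right)
qed

lemma low_deriv_x: "low (Suc N) F \<Longrightarrow> low N (deriv_x F)"
  by (simp add: low_def deriv_x_nth)

lemma low_deriv_y: "low (Suc N) F \<Longrightarrow> low N (deriv_y F)"
  by (simp add: low_def deriv_y_nth)

text \<open>The scalar \<open>c\<close> may be 0, so this prescribes all coefficients up to degree
  \<open>a + b\<close> rather than a genuine leading term.\<close>

definition lead :: "'a::comm_ring_1 \<Rightarrow> 'a fps2 \<Rightarrow> nat \<Rightarrow> nat \<Rightarrow> bool" where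
  "lead c F a b \<longleftrightarrow> low (a + b + 1) (F - fps2_monom c a b)"

lemma lead_iff: "lead c F a b \<longleftrightarrow> (\<forall>i j. i + j \<le> a + b \<longrightarrow> F $ i $ j = (if i = a \<and> j = b then c else 0))"
  by (auto simp: lead_def low_def)

lemma lead_nth: "lead c F a b \<Longrightarrow> i + j \<le> a + b \<Longrightarrow> F $ i $ j = (if i = a \<and> j = b then c else 0)"
  by (simp add: lead_iff)

lemma lead_low: "lead c F a b \<Longrightarrow> low (a + b) F"
  by (auto simp: lead_iff low_def)

lemma lead_mult:
  assumes "lead c F a b" "lead c' G a' b'"
  shows "lead (c * c') (F * G) (a + a') (b + b')"
proof -
  have "F * G - fps2_monom (c * c') (a + a') (b + b')
      = (F - fps2_monom c a b) * G + fps2_monom c a b * (G - fps2_monom c' a' b')"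
    by (simp add: algebra_simps fps2_monom_mult)
  moreover have "low (a + b + 1 + (a' + b')) ((F - fps2_monom c a b) * G)"
    using assms(1) lead_low[OF assms(2)] by (intro low_mult) (simp_all only: lead_def)
  moreover have "low (a + b + (a' + b' + 1)) (fps2_monom c a b * (G - fps2_monom c' a' b'))"
    using assms(2) by (intro low_mult) (simp_all add: lead_def low_def)
  ultimately show ?thesis
    unfolding lead_def by (simp add: low_add ac_simps)
qed

lemma lead_1: "lead 1 1 0 0"
  by (simp add: lead_def fps2_monom_1)

lemma lead_power: "lead c F a b \<Longrightarrow> lead (c ^ k) (F ^ k) (k * a) (k * b)"
proof (induction k)
  case (Suc k)
  then show ?case using lead_mult[of c F a b "c ^ k" "F ^ k" "k * a" "k * b"] by (simp add: add_ac)
qed (simp add: lead_1)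

section \<open>Substitution into a series in one variable\<close>

lemma subst_fps_nth:
  assumes "low 1 W" "i + j \<le> L"
  shows "subst_fps f W $ i $ j = (\<Sum>k\<le>L. f $ k * (W ^ k) $ i $ j)"
proof -
  have "(W ^ k) $ i $ j = 0" if "i + j < k" for k
    using low_power[OF assms(1), of k] that by (simp add: lowD)
  then have "(\<Sum>k\<le>L. f $ k * (W ^ k) $ i $ j) = (\<Sum>k\<le>i + j. f $ k * (W ^ k) $ i $ j)"
    using assms(2) by (intro sum.mono_neutral_right) auto
  then show ?thesis by (simp add: subst_fps_def)
qed

lemma subst_fps_diff: "subst_fps (f - g) W = subst_fps f W - subst_fps g W"
  by (rule fps2_eqI) (simp add: subst_fps_def algebra_simps sum_subtractf)

lemma subst_fps_low_diff:
  assumes "low N (W - W')"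
  shows "low N (subst_fps f W - subst_fps f W')"
  unfolding low_def
proof (intro allI impI)
  fix i j assume "i + j < N"
  then have "(W ^ k) $ i $ j = (W' ^ k) $ i $ j" for k
    using lowD[OF low_power_diff[OF assms, of k], of i j] by simp
  then show "(subst_fps f W - subst_fps f W') $ i $ j = 0"
    by (simp add: subst_fps_def)
qed

text \<open>Powers of \<open>W\<close> below \<open>k\<close> meet vanishing coefficients of
  \<open>f\<close>, and \<open>W ^ r\<close> with \<open>r > k\<close> starts in degree
  \<open>r * (q + p)\<close>, which is too high; only \<open>f $ k * W ^ k\<close> remains.\<close>

lemma lead_subst_fps:
  assumes W: "lead 1 W q p" and "0 < p" and f: "\<And>i. i < k \<Longrightarrow> f $ i = 0"
  shows "lead (f $ k) (subst_fps f W) (k * q) (k * p)"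
  unfolding lead_iff
proof (intro allI impI)
  fix i j assume ij: "i + j \<le> k * q + k * p"
  have "low 1 W" using lead_low[OF W] \<open>0 < p\<close> by (rule_tac low_mono) auto
  have *: "f $ r * (W ^ r) $ i $ j = (if r = k then (if i = k * q \<and> j = k * p then f $ k else 0) else 0)"
    for r
  proof -
    consider "r < k" | "r = k" | "r > k" by linarith
    then show ?thesis
    proof cases
      case 2
      then show ?thesis using lead_nth[OF lead_power[OF W, of r]] ij by simp
    next
      case 3
      then have "k * (q + p) < r * (q + p)" using \<open>0 < p\<close> by simp
      then have "(W ^ r) $ i $ j = 0"
        using low_power[OF lead_low[OF W], of r] ij by (intro lowD) (auto simp: algebra_simps)
      then show ?thesis using 3 by simp
    qed (simp add: f)
  qed
  have "subst_fps f W $ i $ j = (\<Sum>r\<le>i + j + k. f $ r * (W ^ r) $ i $ j)"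
    by (rule subst_fps_nth) (use \<open>low 1 W\<close> in auto)
  then show "subst_fps f W $ i $ j = (if i = k * q \<and> j = k * p then f $ k else 0)"
    by (simp add: *)
qed

section \<open>Existence and uniqueness of the normalization\<close>

text \<open>In A u(W) with A of order 1 and W of order \<open>s\<close>, the coefficient
  \<open>u $ k\<close> first enters in degree \<open>k * s + 1\<close>. Index 0 is listed separately
  because for \<open>N \<le> 1\<close> the bound does not cover it.\<close>

definition coeffs_agree :: "nat \<Rightarrow> nat \<Rightarrow> 'a::comm_ring_1 fps \<Rightarrow> 'a fps \<Rightarrow> bool" where
  "coeffs_agree s N u u' \<longleftrightarrow> u $ 0 = u' $ 0 \<and> (\<forall>k. k * s + 1 < N \<longrightarrow> u $ k = u' $ k)"

lemma mult_plus_one_div: "2 \<le> s \<Longrightarrow> (k * s + 1) div s = (k :: nat)"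
  by (intro div_nat_eqI) auto

text \<open>The coefficients form a ring in which nonzero integers are invertible. This covers
  polynomials in the coefficients of the generic system as well as power series in the perturbation
  parameter.\<close>

locale resonant_system =
  fixes p q :: nat and P Q :: "'a::comm_ring_1 fps2"
  assumes p_pos: "0 < p" and q_pos: "0 < q" and coprime_pq: "coprime p q"
    and low_P: "low 2 P" and low_Q: "low 2 Q"
    and int_unit: "z \<noteq> 0 \<Longrightarrow> \<exists>r::'a. of_int z * r = 1"
begin

definition lie :: "'a fps2 \<Rightarrow> 'a fps2" where
  "lie A = deriv_x A * (of_nat p * x_var + P) + deriv_y A * (- of_nat q * y_var + Q)"

text \<open>Handles both coordinate equations at once: \<open>c = p\<close> for \<open>X\<close> and
  \<open>c = - q\<close> for \<open>Y\<close>, with \<alpha> and \<beta> the exponents of the linear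
  part of \<open>A\<close>.\<close>

definition defect :: "int \<Rightarrow> 'a fps2 \<Rightarrow> 'a fps \<Rightarrow> 'a fps2 \<Rightarrow> 'a fps2" where
  "defect c A u W = lie A - of_int c * A * subst_fps u W"

lemma of_int_mult_nth2: "(of_int c * F :: 'a fps2) $ i $ j = of_int c * F $ i $ j"
  by (cases c) (simp_all only: of_int_of_nat_eq of_int_minus of_nat_mult_nth2 mult_minus_left fps_neg_nth)

lemma lie_nth:
  "lie A $ i $ j = of_int (int p * int i - int q * int j) * A $ i $ j + (deriv_x A * P + deriv_y A * Q) $ i $ j"
proof -
  have x: "(deriv_x A * x_var) $ i $ j = of_nat i * A $ i $ j"
    using fps2_monom_mult_nth[of 1 1 0 "deriv_x A" i j]
    by (cases i) (auto simp: x_var_eq_monom mult.commute[of _ "fps2_monom _ _ _"] deriv_x_nth simp del: of_nat_Suc)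
  have y: "(deriv_y A * y_var) $ i $ j = of_nat j * A $ i $ j"
    using fps2_monom_mult_nth[of 1 0 1 "deriv_y A" i j]
    by (cases j) (auto simp: y_var_eq_monom mult.commute[of _ "fps2_monom _ _ _"] deriv_y_nth simp del: of_nat_Suc)
  have "lie A = of_nat p * (deriv_x A * x_var) - of_nat q * (deriv_y A * y_var) + (deriv_x A * P + deriv_y A * Q)"
    by (simp add: lie_def algebra_simps)
  then show ?thesis
    by (simp only: fps_add_nth fps_sub_nth of_nat_mult_nth2 x y) (simp add: algebra_simps)
qed

section \<open>The homological equation, degree by degree\<close>

lemma mult_subst_fps_diff:
  assumes ab: "\<alpha> + \<beta> = 1" and N: "0 < N"
    and A': "lead 1 A' \<alpha> \<beta>" and A: "low N (A - A')"
    and W: "lead 1 W q p" "lead 1 W' q p" "low N (W - W')"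
    and u0: "u $ 0 = 1" and u: "coeffs_agree (p + q) N u u'"
    and ij: "i + j = N"
  shows "(A * subst_fps u W - A' * subst_fps u' W') $ i $ j
    = (A - A') $ i $ j + (if \<exists>k. i = \<alpha> + k * q \<and> j = \<beta> + k * p
        then (u - u') $ (N div (p + q)) else 0)"
proof -
  \<comment> \<open>The second and third summands have order above \<open>N\<close>, as one factor
    has order \<open>N\<close> and the other order 1. The last one carries the newest coefficient of
    \<open>u - u'\<close>.\<close>
  have split: "A * subst_fps u W - A' * subst_fps u' W' = (A - A') + (A - A') * (subst_fps u W - 1)
      + A' * (subst_fps u W - subst_fps u W') + A' * subst_fps (u - u') W'"
    by (simp add: subst_fps_diff algebra_simps)
  have lA: "low 1 A'" using lead_low[OF A'] ab by simp
  have "lead 1 (subst_fps u W) 0 0"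
    using lead_subst_fps[OF W(1) p_pos, of 0 u] u0 by simp
  then have "low 1 (subst_fps u W - 1)" by (simp add: lead_def fps2_monom_1)
  then have 1: "((A - A') * (subst_fps u W - 1)) $ i $ j = 0"
    using ij by (intro lowD[OF low_mult[OF A]]) auto
  have 2: "(A' * (subst_fps u W - subst_fps u W')) $ i $ j = 0"
    using ij by (intro lowD[OF low_mult[OF lA subst_fps_low_diff[OF W(3)]]]) auto
  have 3: "(A' * subst_fps (u - u') W') $ i $ j = (if \<exists>k. i = \<alpha> + k * q \<and> j = \<beta> + k * p
        then (u - u') $ (N div (p + q)) else 0)"
  proof -
    define s where "s = p + q"
    have s: "2 \<le> s" using p_pos q_pos by (simp add: s_def)
    \<comment> \<open>The least \<open>k\<close> with \<open>N \<le> k * s + 1\<close>, that is (N -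
      1) / s rounded up; \<open>u\<close> and \<open>u'\<close> agree before it.\<close>
    define k where "k = (N + s - 2) div s"
    have k1: "N \<le> k * s + 1"
    proof -
      have "N + s - 2 < s + k * s"
        unfolding k_def using s by (intro dividend_less_div_times) simp
      then show ?thesis using s N by linarith
    qed
    have k2: "k * s \<le> N + s - 2" unfolding k_def by simp
    have zero: "(u - u') $ r = 0" if "r < k" for r
    proof -
      have "(r + 1) * s \<le> k * s" using that by (intro mult_le_mono1) simp
      then have "r * s + s \<le> N + s - 2" using k2 by simp
      then have "r * s + 1 < N \<or> r = 0" using s N by linarith
      then show ?thesis using u by (auto simp: coeffs_agree_def s_def[symmetric])
    qed
    have lead: "lead ((u - u') $ k) (A' * subst_fps (u - u') W') (\<alpha> + k * q) (\<beta> + k * p)"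
      using lead_mult[OF A' lead_subst_fps[OF W(2) p_pos, of k "u - u'"]] zero by simp
    have tot: "(\<alpha> + k * q) + (\<beta> + k * p) = k * s + 1"
      using ab by (simp add: s_def algebra_simps)
    have res: "r = k" if "i = \<alpha> + r * q" "j = \<beta> + r * p" for r
    proof -
      have N_eq: "N = r * s + 1" using that ij ab by (simp add: s_def algebra_simps)
      have "r * s \<le> k * s" using k1 N_eq by simp
      moreover have "k * s < (r + 1) * s" using k2 N_eq s by simp
      then have "k < r + 1" by (simp only: mult_less_cancel2)
      ultimately show ?thesis using s by simp
    qed
    have div: "N div (p + q) = k" if "i = \<alpha> + k * q" "j = \<beta> + k * p"
    proof -
      have "N = k * s + 1" using that ij tot by simp
      then show ?thesis using mult_plus_one_div[OF s, of k] unfolding s_def[symmetric] by simp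
    qed
    have "i + j \<le> (\<alpha> + k * q) + (\<beta> + k * p)" using ij k1 tot by linarith
    note coeff = lead_nth[OF lead this]
    show ?thesis
    proof (cases "i = \<alpha> + k * q \<and> j = \<beta> + k * p")
      case True
      then have ex: "\<exists>k. i = \<alpha> + k * q \<and> j = \<beta> + k * p" by blast
      have "N div (p + q) = k" by (rule div) (use True in auto)
      then show ?thesis unfolding trans[OF coeff if_P[OF True]] if_P[OF ex] by simp
    next
      case False
      then have "\<not> (\<exists>k. i = \<alpha> + k * q \<and> j = \<beta> + k * p)" using res by blast
      then show ?thesis unfolding trans[OF coeff if_not_P[OF False]] by (simp only: if_False)
    qed
  qed
  show ?thesis
    unfolding split by (simp only: fps_add_nth 1 2 3) simp
qed

text \<open>The linear part of the system acts diagonally on monomials. Differentiation lowers the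
  order by one while \<open>P\<close> and \<open>Q\<close> raise it by two, so the nonlinear terms
  cannot see a change of \<open>A\<close> in degree \<open>N\<close>.\<close>

lemma defect_diff_nth:
  assumes ab: "\<alpha> + \<beta> = 1" and N: "0 < N"
    and A': "lead 1 A' \<alpha> \<beta>" and A: "low N (A - A')"
    and W: "lead 1 W q p" "lead 1 W' q p" "low N (W - W')"
    and u0: "u $ 0 = 1" and u: "coeffs_agree (p + q) N u u'"
    and ij: "i + j = N"
  shows "(defect c A u W - defect c A' u' W') $ i $ j
    = of_int (int p * int i - int q * int j - c) * (A - A') $ i $ j
      - of_int c * (if \<exists>k. i = \<alpha> + k * q \<and> j = \<beta> + k * p then (u - u') $ (N div (p + q)) else 0)"
proof -
  have dx: "deriv_x A * P - deriv_x A' * P = deriv_x (A - A') * P"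
    by (simp add: deriv_x_def algebra_simps)
  have dy: "deriv_y A * Q - deriv_y A' * Q = deriv_y (A - A') * Q"
  proof -
    have "deriv_y (A - A') = deriv_y A - deriv_y A'"
      by (rule fps2_eqI) (simp add: deriv_y_nth algebra_simps)
    then show ?thesis by (simp only: left_diff_distrib)
  qed
  have lA: "low (Suc (N - 1)) (A - A')" using A N by simp
  have "low (N - 1 + 2) (deriv_x (A - A') * P)" "low (N - 1 + 2) (deriv_y (A - A') * Q)"
    by (intro low_mult low_deriv_x low_deriv_y lA low_P low_Q)+
  then have "(deriv_x (A - A') * P) $ i $ j = 0" "(deriv_y (A - A') * Q) $ i $ j = 0"
    using ij N by (auto intro: lowD)
  then have "(deriv_x A * P + deriv_y A * Q) $ i $ j = (deriv_x A' * P + deriv_y A' * Q) $ i $ j"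
    using arg_cong[OF dx, of "\<lambda>F. F $ i $ j"] arg_cong[OF dy, of "\<lambda>F. F $ i $ j"] by simp
  then have lie: "(lie A - lie A') $ i $ j = of_int (int p * int i - int q * int j) * (A - A') $ i $ j"
    by (simp add: lie_nth algebra_simps)
  have "defect c A u W - defect c A' u' W'
      = (lie A - lie A') - of_int c * (A * subst_fps u W - A' * subst_fps u' W')"
    by (simp add: defect_def algebra_simps)
  then show ?thesis
    by (simp only: fps_sub_nth[of "lie A - lie A'"] fps_sub_nth[of "(lie A - lie A') $ i"]
        lie of_int_mult_nth2 mult_subst_fps_diff[OF assms]) (simp add: algebra_simps)
qed

lemma defect_low_diff:
  assumes ab: "\<alpha> + \<beta> = 1"
    and A': "lead 1 A' \<alpha> \<beta>" and A: "low N (A - A')"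
    and W: "lead 1 W q p" "lead 1 W' q p" "low N (W - W')"
    and u0: "u $ 0 = 1" and u: "coeffs_agree (p + q) N u u'"
  shows "low N (defect c A u W - defect c A' u' W')"
  unfolding low_def
proof (intro allI impI)
  fix i j assume ij: "i + j < N"
  show "(defect c A u W - defect c A' u' W') $ i $ j = 0"
  proof (cases "i + j = 0")
    case False
    let ?M = "i + j"
    have agree: "coeffs_agree (p + q) ?M u u'"
      using u ij by (auto simp: coeffs_agree_def)
    have k0: "(u - u') $ (?M div (p + q)) = 0" if "i = \<alpha> + k * q" "j = \<beta> + k * p" for k
    proof -
      have "?M = k * (p + q) + 1" using that ab by (simp add: algebra_simps)
      moreover have "(k * (p + q) + 1) div (p + q) = k"
        using p_pos q_pos by (intro mult_plus_one_div) simp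
      ultimately have "?M div (p + q) * (p + q) + 1 < N" using ij by simp
      then show ?thesis using u by (simp add: coeffs_agree_def)
    qed
    have "(A - A') $ i $ j = 0" using A ij by (rule lowD)
    then show ?thesis
      using k0 by (subst defect_diff_nth[OF ab _ A' low_mono[OF A] W(1,2) low_mono[OF W(3)] u0 agree])
        (use ij False in auto)
  next
    case True
    have "A $ 0 $ 0 = A' $ 0 $ 0" using lowD[OF A, of 0 0] ij True by simp
    moreover have "P $ 0 $ 0 = 0" "Q $ 0 $ 0 = 0" using low_P low_Q by (auto intro: lowD)
    moreover have "A' $ 0 $ 0 = 0" using lead_nth[OF A', of 0 0] ab by auto
    ultimately show ?thesis
      using True by (simp add: defect_def mult.assoc of_int_mult_nth2 lie_nth)
  qed
qed

text \<open>Coprimality makes (i - \<alpha>, j - \<beta>) an integer multiple k of (q, p). A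
  negative k would force i + j \<le> 1 - p - q < 0.\<close>

lemma resonance:
  assumes ab: "\<alpha> + \<beta> = 1" and eq: "int p * int i - int q * int j = int p * int \<alpha> - int q * int \<beta>"
  shows "\<exists>k. i = \<alpha> + k * q \<and> j = \<beta> + k * p"
proof -
  have e: "int p * (int i - int \<alpha>) = int q * (int j - int \<beta>)"
    using eq by (simp add: algebra_simps)
  have "coprime (int p) (int q)" using coprime_pq by simp
  then have "int q dvd int i - int \<alpha>"
    using e by (metis coprime_commute coprime_dvd_mult_right_iff dvd_triv_left)
  then obtain k where k: "int i - int \<alpha> = int q * k" by (elim dvdE)
  have "int q * (int p * k) = int q * (int j - int \<beta>)"
    using e k by (simp add: algebra_simps)
  then have k': "int j - int \<beta> = int p * k" using q_pos by simp
  have "0 \<le> k"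
  proof (rule ccontr)
    assume "\<not> 0 \<le> k"
    then have "int q * k \<le> int q * - 1" "int p * k \<le> int p * - 1"
      by (intro mult_left_mono; simp)+
    then have "int i + int j \<le> 1 - int p - int q"
      using k k' ab by linarith
    then show False using p_pos q_pos by linarith
  qed
  then obtain r where "k = int r" by (elim nonneg_int_cases)
  then show ?thesis
    using k k' by (intro exI[of _ r]) (simp add: algebra_simps flip: of_nat_eq_iff[where ?'a = int])
qed

lemma not_resonance:
  assumes "i = \<alpha> + k * q" "j = \<beta> + k * p"
  shows "int p * int i - int q * int j = int p * int \<alpha> - int q * int \<beta>"
  using assms by (simp add: algebra_simps)

definition normalized :: "nat \<Rightarrow> nat \<Rightarrow> 'a fps2 \<Rightarrow> bool" where
  "normalized \<alpha> \<beta> A \<longleftrightarrow> lead 1 A \<alpha> \<beta> \<and> (\<forall>k\<ge>1. A $ (\<alpha> + k * q) $ (\<beta> + k * p) = 0)"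

text \<open>One step of the normal form construction: nonresonant terms of the defect in degree
  \<open>N\<close> are removed by dividing by the nonzero integer \<open>p i - q j - c\<close>,
  resonant ones are absorbed into \<open>u\<close>. The quantifier over \<open>W'\<close> is there
  because the new \<open>W\<close> depends on both improved coordinates, which are built
  separately.\<close>

lemma extend:
  assumes ab: "\<alpha> + \<beta> = 1" and c: "c = int p * int \<alpha> - int q * int \<beta>" and N: "2 \<le> N"
    and A: "normalized \<alpha> \<beta> A" and u0: "u $ 0 = 1" and W: "lead 1 W q p"
    and D: "low N (defect c A u W)"
  shows "\<exists>A' u'. normalized \<alpha> \<beta> A' \<and> u' $ 0 = 1 \<and> low N (A' - A) \<and> coeffs_agree (p + q) N u' u \<and>
    (\<forall>W'. lead 1 W' q p \<longrightarrow> low N (W' - W) \<longrightarrow> low (Suc N) (defect c A' u' W'))"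
proof -
  have "\<forall>z. \<exists>r :: 'a. z \<noteq> 0 \<longrightarrow> of_int z * r = 1"
    using int_unit by blast
  then obtain iv :: "int \<Rightarrow> 'a" where iv: "\<And>z. z \<noteq> 0 \<Longrightarrow> of_int z * iv z = 1"
    using choice[of "\<lambda>z r. z \<noteq> 0 \<longrightarrow> of_int z * r = (1 :: 'a)"] by blast
  define D where "D = defect c A u W"
  define \<Delta> where "\<Delta> = Abs_fps (\<lambda>i. Abs_fps (\<lambda>j. if i + j = N \<and> int p * int i - int q * int j \<noteq> c
    then - D $ i $ j * iv (int p * int i - int q * int j - c) else 0))"
  define A' where "A' = A + \<Delta>"
  define u' where "u' = u + Abs_fps (\<lambda>k. if k * (p + q) + 1 = N
    then D $ (\<alpha> + k * q) $ (\<beta> + k * p) * iv c else 0)"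
  have c0: "c \<noteq> 0" using ab p_pos q_pos unfolding c by (cases \<alpha>) auto
  have \<Delta>: "\<Delta> $ i $ j = (if i + j = N \<and> int p * int i - int q * int j \<noteq> c
    then - D $ i $ j * iv (int p * int i - int q * int j - c) else 0)" for i j
    by (simp add: \<Delta>_def)
  have low\<Delta>: "low N \<Delta>" by (simp add: low_def \<Delta>)
  have leadA: "lead 1 A \<alpha> \<beta>" using A by (simp add: normalized_def)
  have "lead 1 A' \<alpha> \<beta>"
    using leadA N ab by (auto simp: lead_iff A'_def \<Delta>)
  moreover have "A' $ (\<alpha> + k * q) $ (\<beta> + k * p) = 0" if "k \<ge> 1" for k
    using A that not_resonance[of "\<alpha> + k * q" \<alpha> k "\<beta> + k * p" \<beta>]
    by (simp add: A'_def \<Delta> normalized_def c)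
  ultimately have n: "normalized \<alpha> \<beta> A'" by (simp add: normalized_def)
  have u'0: "u' $ 0 = 1" using u0 N by (simp add: u'_def)
  have agree: "coeffs_agree (p + q) N u' u" using N by (auto simp: coeffs_agree_def u'_def)
  have "low (Suc N) (defect c A' u' W')" if W': "lead 1 W' q p" "low N (W' - W)" for W'
    unfolding low_def
  proof (intro allI impI)
    fix i j assume ij: "i + j < Suc N"
    have diff: "A' - A = \<Delta>" by (simp add: A'_def)
    show "defect c A' u' W' $ i $ j = 0"
    proof (cases "i + j = N")
      case True
      have *: "(defect c A' u' W' - D) $ i $ j
        = of_int (int p * int i - int q * int j - c) * \<Delta> $ i $ j
          - of_int c * (if \<exists>k. i = \<alpha> + k * q \<and> j = \<beta> + k * p then (u' - u) $ (N div (p + q)) else 0)"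
        unfolding D_def diff[symmetric]
        by (rule defect_diff_nth[OF ab _ leadA _ W'(1) W W'(2) u'0 agree True]) (use N low\<Delta> diff in auto)
      show ?thesis
      proof (cases "\<exists>k. i = \<alpha> + k * q \<and> j = \<beta> + k * p")
        case res: True
        then obtain k where k: "i = \<alpha> + k * q" "j = \<beta> + k * p" by blast
        have "\<Delta> $ i $ j = 0" using not_resonance[OF k] by (simp add: \<Delta> c)
        moreover have kN: "k * (p + q) + 1 = N" using k ab True by (simp add: algebra_simps)
        moreover
        have "N div (p + q) = k" unfolding kN[symmetric] using p_pos q_pos
          by (intro mult_plus_one_div) simp
        moreover have "(u' - u) $ k = D $ i $ j * iv c" using kN k by (simp add: u'_def)
        ultimately have "(defect c A' u' W' - D) $ i $ j = - (of_int c * iv c) * D $ i $ j"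
          using * res by (simp add: algebra_simps)
        then show ?thesis using iv[OF c0] by simp
      next
        case False
        then have nz: "int p * int i - int q * int j - c \<noteq> 0"
          using resonance[OF ab, of i j] c by auto
        then have "(defect c A' u' W' - D) $ i $ j
            = - (of_int (int p * int i - int q * int j - c) * iv (int p * int i - int q * int j - c)) * D $ i $ j"
          using * False True by (simp add: \<Delta> algebra_simps)
        then show ?thesis using iv[OF nz] by simp
      qed
    next
      case False
      then have ij': "i + j < N" using ij by simp
      have "low N (defect c A' u' W' - D)"
        unfolding D_def
        by (rule defect_low_diff[OF ab leadA _ W'(1) W W'(2) u'0 agree]) (use low\<Delta> diff in simp)
      then have "(defect c A' u' W' - D) $ i $ j = 0" using ij' by (rule lowD)
      moreover have "D $ i $ j = 0" using D ij' unfolding D_def by (rule lowD)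
      ultimately show ?thesis by simp
    qed
  qed
  then show ?thesis using n u'0 agree low\<Delta> by (intro exI[of _ A'] exI[of _ u']) (auto simp: A'_def)
qed

lemma lead_monomial_W:
  assumes "lead 1 X 1 0" "lead 1 Y 0 1"
  shows "lead 1 (X ^ q * Y ^ p) q p"
  using lead_mult[OF lead_power[OF assms(1), of q] lead_power[OF assms(2), of p]] by simp

lemma is_normalization_iff:
  "is_normalization p q (of_nat p * x_var + P) (- of_nat q * y_var + Q) X Y u v \<longleftrightarrow>
    normalized 1 0 X \<and> normalized 0 1 Y \<and> u $ 0 = 1 \<and> v $ 0 = 1 \<and>
    defect (int p) X u (X ^ q * Y ^ p) = 0 \<and> defect (- int q) Y v (X ^ q * Y ^ p) = 0"
proof -
  have split: "(\<forall>i j. i + j \<le> Suc 0 \<longrightarrow> R i j) \<longleftrightarrow> R 0 0 \<and> R 1 0 \<and> R 0 1" for R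
    by (auto simp: le_Suc_eq add_is_1)
  show ?thesis
    unfolding is_normalization_def normalized_def lead_iff defect_def lie_def
    by (auto simp: split eq_neg_iff_add_eq_0)
qed

text \<open>Dependent choice yields normalizations up to degree \<open>n + 2\<close> that are
  compatible with each other; their coefficientwise limit is an exact one.\<close>

lemma normalization_exists:
  "\<exists>X Y u v. is_normalization p q (of_nat p * x_var + P) (- of_nat q * y_var + Q) X Y u v"
proof -
  define good where "good = (\<lambda>n (X, Y, u, v). normalized 1 0 X \<and> normalized 0 1 Y \<and>
    u $ 0 = 1 \<and> v $ 0 = 1 \<and> low (n + 2) (defect (int p) X u (X ^ q * Y ^ p)) \<and>
    low (n + 2) (defect (- int q) Y v (X ^ q * Y ^ p)))"
  define next_ok where "next_ok = (\<lambda>n (X, Y, u, v) (X', Y', u', v').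
    low (n + 2) (X' - X :: 'a fps2) \<and> low (n + 2) (Y' - Y :: 'a fps2) \<and>
    coeffs_agree (p + q) (n + 2) u' (u :: 'a fps) \<and> coeffs_agree (p + q) (n + 2) v' (v :: 'a fps))"
  have "\<exists>f. \<forall>n. good n (f n) \<and> next_ok n (f n) (f (Suc n))"
  proof (rule dependent_nat_choice)
    have nx: "normalized 1 0 (fps2_monom 1 1 0)" and ny: "normalized 0 1 (fps2_monom 1 0 1)"
      using p_pos q_pos by (auto simp: normalized_def lead_def)
    have W: "lead 1 (fps2_monom 1 1 0 ^ q * fps2_monom 1 0 1 ^ p :: 'a fps2) q p"
      by (intro lead_monomial_W) (auto simp: lead_def)
    have dx: "lie (fps2_monom 1 1 0) = of_nat p * x_var + P"
    proof -
      have "deriv_x (fps2_monom 1 1 0) = (1 :: 'a fps2)" "deriv_y (fps2_monom 1 1 0) = (0 :: 'a fps2)"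
        by (rule fps2_eqI; auto simp: deriv_x_nth deriv_y_nth)+
      then show ?thesis by (simp add: lie_def)
    qed
    have dy: "lie (fps2_monom 1 0 1) = - of_nat q * y_var + Q"
    proof -
      have "deriv_x (fps2_monom 1 0 1) = (0 :: 'a fps2)" "deriv_y (fps2_monom 1 0 1) = (1 :: 'a fps2)"
        by (rule fps2_eqI; auto simp: deriv_x_nth deriv_y_nth)+
      then show ?thesis by (simp add: lie_def)
    qed
    have one: "subst_fps 1 V = 1" for V :: "'a fps2"
    proof (rule fps2_eqI)
      fix i j
      have "(\<Sum>k\<le>i + j. 1 $ k * (V ^ k) $ i $ j) = (\<Sum>k\<in>{0}. 1 $ k * (V ^ k) $ i $ j)"
        by (rule sum.mono_neutral_right) auto
      then show "subst_fps 1 V $ i $ j = 1 $ i $ j"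
        by (simp add: subst_fps_def)
    qed
    \<comment> \<open>The construction starts at the identity with \<open>u = v = 1\<close>; its
      defects are \<open>P\<close> and \<open>Q\<close>, which have order 2.\<close>
    have "defect (int p) (fps2_monom 1 1 0) 1 (fps2_monom 1 1 0 ^ q * fps2_monom 1 0 1 ^ p) = P"
      "defect (- int q) (fps2_monom 1 0 1) 1 (fps2_monom 1 1 0 ^ q * fps2_monom 1 0 1 ^ p) = Q"
      unfolding defect_def dx dy one x_var_eq_monom y_var_eq_monom by simp_all
    then show "\<exists>s. good 0 s"
      using nx ny low_P low_Q
      by (intro exI[of _ "(fps2_monom 1 1 0, fps2_monom 1 0 1, 1, 1)"])
         (simp add: good_def numeral_2_eq_2)
  next
    fix s n assume s: "good n s"
    obtain X Y u v where s_eq: "s = (X, Y, u, v)" by (cases s)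
    let ?W = "X ^ q * Y ^ p"
    have g: "normalized 1 0 X" "normalized 0 1 Y" "u $ 0 = 1" "v $ 0 = 1"
      "low (n + 2) (defect (int p) X u ?W)" "low (n + 2) (defect (- int q) Y v ?W)"
      using s by (auto simp: good_def s_eq)
    have W: "lead 1 ?W q p" using g(1,2) by (intro lead_monomial_W) (auto simp: normalized_def)
    obtain X' u' where X': "normalized 1 0 X'" "u' $ 0 = 1" "low (n + 2) (X' - X)"
        "coeffs_agree (p + q) (n + 2) u' u"
        "\<And>W'. lead 1 W' q p \<Longrightarrow> low (n + 2) (W' - ?W) \<Longrightarrow> low (Suc (n + 2)) (defect (int p) X' u' W')"
      using extend[of 1 0 "int p" "n + 2", OF _ _ _ g(1,3) W g(5)] by auto
    obtain Y' v' where Y': "normalized 0 1 Y'" "v' $ 0 = 1" "low (n + 2) (Y' - Y)"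
        "coeffs_agree (p + q) (n + 2) v' v"
        "\<And>W'. lead 1 W' q p \<Longrightarrow> low (n + 2) (W' - ?W) \<Longrightarrow> low (Suc (n + 2)) (defect (- int q) Y' v' W')"
      using extend[of 0 1 "- int q" "n + 2", OF _ _ _ g(2,4) W g(6)] by auto
    have W': "lead 1 (X' ^ q * Y' ^ p) q p"
      using X' Y' by (intro lead_monomial_W) (auto simp: normalized_def)
    have lW: "low (n + 2) (X' ^ q * Y' ^ p - ?W)"
      by (intro low_mult_diff low_power_diff X' Y')
    have "good (Suc n) (X', Y', u', v')"
      using X'(1,2) Y'(1,2) X'(5)[OF W' lW] Y'(5)[OF W' lW] by (simp add: good_def)
    moreover have "next_ok n s (X', Y', u', v')"
      using X' Y' by (simp add: next_ok_def s_eq)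
    ultimately show "\<exists>s'. good (Suc n) s' \<and> next_ok n s s'" by blast
  qed
  then obtain f where f: "\<And>n. good n (f n)" "\<And>n. next_ok n (f n) (f (Suc n))" by blast
  define X Y u v where "X = fst \<circ> f" "Y = fst \<circ> snd \<circ> f" "u = fst \<circ> snd \<circ> snd \<circ> f" "v = snd \<circ> snd \<circ> snd \<circ> f"
  have f_eq: "f n = (X n, Y n, u n, v n)" for n
    by (simp add: X_Y_u_v_def)
  have g: "normalized 1 0 (X n)" "normalized 0 1 (Y n)" "u n $ 0 = 1" "v n $ 0 = 1"
      "low (n + 2) (defect (int p) (X n) (u n) (X n ^ q * Y n ^ p))"
      "low (n + 2) (defect (- int q) (Y n) (v n) (X n ^ q * Y n ^ p))" for n
    using f(1)[of n] by (auto simp: good_def f_eq)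
  \<comment> \<open>Stage \<open>n\<close> is final in all degrees below \<open>n + 2\<close>, so
    the coefficient at \<open>(i, j)\<close> may be read off at stage \<open>i + j\<close>.\<close>
  have limit2: "low (n + 2) (Abs_fps (\<lambda>i. Abs_fps (\<lambda>j. A (i + j) $ i $ j)) - A n)"
    if step: "\<And>n. low (n + 2) (A (Suc n) - A n)" for A :: "nat \<Rightarrow> 'a fps2" and n
  proof -
    have mono: "low (n + 2) (A (n + m) - A n)" for n m
    proof (induction m)
      case (Suc m)
      have "A (n + Suc m) - A n = (A (Suc (n + m)) - A (n + m)) + (A (n + m) - A n)" by simp
      moreover have "low (n + 2) (A (Suc (n + m)) - A (n + m))"
        by (rule low_mono[OF step]) simp
      ultimately show ?case using low_add Suc by metis
    qed simp
    have "A (i + j) $ i $ j = A n $ i $ j" if ij: "i + j < n + 2" for i j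
    proof (cases "i + j \<le> n")
      case True
      then show ?thesis using lowD[OF mono[of "i + j" "n - (i + j)"], of i j] by simp
    next
      case False
      then have "i + j = Suc n" using ij by simp
      then show ?thesis using lowD[OF step[of n], of i j] ij by simp
    qed
    then show ?thesis by (simp add: low_def)
  qed
  \<comment> \<open>The coefficient \<open>u $ k\<close> enters in degree
    \<open>k * (p + q) + 1\<close>, hence is settled at stage \<open>k * (p + q)\<close>.\<close>
  have limit1: "coeffs_agree (p + q) (n + 2) (Abs_fps (\<lambda>k. a (k * (p + q)) $ k)) (a n)"
    if step: "\<And>n. coeffs_agree (p + q) (n + 2) (a (Suc n)) (a n)" for a :: "nat \<Rightarrow> 'a fps" and n
  proof -
    have mono: "coeffs_agree (p + q) (n + 2) (a (n + m)) (a n)" for n m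
    proof (induction m)
      case (Suc m)
      then show ?case using step[of "n + m"] by (auto simp: coeffs_agree_def)
    qed (simp add: coeffs_agree_def)
    have "a (k * (p + q)) $ k = a n $ k" if k: "k * (p + q) + 1 < n + 2" for k
    proof -
      have "k * (p + q) \<le> n" using k by simp
      then show ?thesis using mono[of "k * (p + q)" "n - k * (p + q)"] by (simp add: coeffs_agree_def)
    qed
    from this this[of 0] show ?thesis by (simp add: coeffs_agree_def)
  qed
  define X' Y' u' v' where "X' = Abs_fps (\<lambda>i. Abs_fps (\<lambda>j. X (i + j) $ i $ j))"
    "Y' = Abs_fps (\<lambda>i. Abs_fps (\<lambda>j. Y (i + j) $ i $ j))"
    "u' = Abs_fps (\<lambda>k. u (k * (p + q)) $ k)" "v' = Abs_fps (\<lambda>k. v (k * (p + q)) $ k)"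
  have steps: "low (n + 2) (X (Suc n) - X n)" "low (n + 2) (Y (Suc n) - Y n)"
     "coeffs_agree (p + q) (n + 2) (u (Suc n)) (u n)" "coeffs_agree (p + q) (n + 2) (v (Suc n)) (v n)" for n
    using f(2)[of n] by (auto simp: next_ok_def f_eq)
  have l: "low (n + 2) (X' - X n)" "low (n + 2) (Y' - Y n)"
     "coeffs_agree (p + q) (n + 2) u' (u n)" "coeffs_agree (p + q) (n + 2) v' (v n)" for n
    unfolding X'_Y'_u'_v'_def by (intro limit1 limit2 steps)+
  have nX: "normalized 1 0 X'" and nY: "normalized 0 1 Y'"
    using g(1,2) by (auto simp: X'_Y'_u'_v'_def normalized_def lead_iff)
  have uv0: "u' $ 0 = 1" "v' $ 0 = 1" using g(3,4) by (auto simp: X'_Y'_u'_v'_def)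
  have W: "lead 1 (X' ^ q * Y' ^ p) q p" "lead 1 (X n ^ q * Y n ^ p) q p" for n
    using nX nY g(1,2) by (auto intro!: lead_monomial_W simp: normalized_def)
  have lW: "low (n + 2) (X' ^ q * Y' ^ p - X n ^ q * Y n ^ p)" for n
    by (intro low_mult_diff low_power_diff l)
  have zero: "F = 0" if "\<And>n. low (n + 2) F" for F :: "'a fps2"
  proof (rule fps2_eqI)
    fix i j show "F $ i $ j = 0 $ i $ j" using lowD[OF that[of "i + j"], of i j] by simp
  qed
  have "low (n + 2) (defect (int p) X' u' (X' ^ q * Y' ^ p))" for n
  proof -
    have "low (n + 2) (defect (int p) X' u' (X' ^ q * Y' ^ p) - defect (int p) (X n) (u n) (X n ^ q * Y n ^ p))"
      by (rule defect_low_diff[of 1 0]) (use g l W lW uv0 in \<open>auto simp: normalized_def\<close>)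
    from low_add[OF this g(5)] show ?thesis by simp
  qed
  moreover have "low (n + 2) (defect (- int q) Y' v' (X' ^ q * Y' ^ p))" for n
  proof -
    have "low (n + 2) (defect (- int q) Y' v' (X' ^ q * Y' ^ p) - defect (- int q) (Y n) (v n) (X n ^ q * Y n ^ p))"
      by (rule defect_low_diff[of 0 1]) (use g l W lW uv0 in \<open>auto simp: normalized_def\<close>)
    from low_add[OF this g(6)] show ?thesis by simp
  qed
  ultimately show ?thesis
    using nX nY uv0 zero unfolding is_normalization_iff by blast
qed

text \<open>
  The first degree in which two approximate normalizations differ is governed by the linear part
  alone, so that agreement of the defects forces agreement of the next degree.
\<close>

lemma agree_step:
  assumes ab: "\<alpha> + \<beta> = 1" and c: "c = int p * int \<alpha> - int q * int \<beta>" and N: "2 \<le> N"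
    and A: "normalized \<alpha> \<beta> A" "normalized \<alpha> \<beta> A'" "low N (A - A')"
    and W: "lead 1 W q p" "lead 1 W' q p" "low N (W - W')"
    and u0: "u $ 0 = 1" and u: "coeffs_agree (p + q) N u u'"
    and D: "\<And>i j. i + j = N \<Longrightarrow> defect c A u W $ i $ j = defect c A' u' W' $ i $ j"
  shows "low (Suc N) (A - A')" "coeffs_agree (p + q) (Suc N) u u'"
proof -
  have c0: "c \<noteq> 0" using ab p_pos q_pos unfolding c by (cases \<alpha>) auto
  have cancel: "x = 0" if zx: "of_int z * x = 0" and z: "z \<noteq> 0" for z and x :: 'a
  proof -
    obtain r :: 'a where "of_int z * r = 1" using int_unit[OF z] by blast
    then have "x = r * (of_int z * x)" by (simp add: mult.assoc[symmetric] mult.commute)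
    then show ?thesis using zx by simp
  qed
  have *: "of_int (int p * int i - int q * int j - c) * (A - A') $ i $ j
      - of_int c * (if \<exists>k. i = \<alpha> + k * q \<and> j = \<beta> + k * p then (u - u') $ (N div (p + q)) else 0) = 0"
    if "i + j = N" for i j
    using defect_diff_nth[OF ab _ _ A(3) W u0 u that, of c] D[OF that] N A(2)
    by (simp add: normalized_def)
  have "(A - A') $ i $ j = 0" if ij: "i + j < Suc N" for i j
  proof (cases "i + j = N")
    case True
    show ?thesis
    proof (cases "\<exists>k. i = \<alpha> + k * q \<and> j = \<beta> + k * p")
      case res: True
      then obtain k where k: "i = \<alpha> + k * q" "j = \<beta> + k * p" by blast
      then have "k \<ge> 1" using True N ab by (cases k) auto
      then show ?thesis using A(1,2) k by (simp add: normalized_def)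
    next
      case False
      then have nz: "int p * int i - int q * int j - c \<noteq> 0"
        using resonance[OF ab, of i j] c by auto
      show ?thesis by (rule cancel[OF _ nz]) (use *[OF True] False in simp)
    qed
  next
    case False
    then have "i + j < N" using ij by simp
    with A(3) show ?thesis by (rule lowD)
  qed
  then show "low (Suc N) (A - A')" unfolding low_def by blast
  have "u $ k = u' $ k" if "k * (p + q) + 1 < Suc N" for k
  proof (cases "k * (p + q) + 1 = N")
    case True
    have div: "N div (p + q) = k" unfolding True[symmetric] using p_pos q_pos
      by (intro mult_plus_one_div) simp
    define i j where "i = \<alpha> + k * q" "j = \<beta> + k * p"
    then have ij: "i + j = N" using True ab by (simp add: algebra_simps)
    have "\<exists>k. i = \<alpha> + k * q \<and> j = \<beta> + k * p" using i_j_def by blast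
    moreover have "int p * int i - int q * int j - c = 0"
      using not_resonance[OF i_j_def] c by simp
    ultimately have "of_int c * (u - u') $ k = 0" using *[OF ij] div by simp
    from cancel[OF this c0] show ?thesis by simp
  next
    case False
    then show ?thesis using u that by (simp add: coeffs_agree_def)
  qed
  then show "coeffs_agree (p + q) (Suc N) u u'"
    using u by (simp add: coeffs_agree_def)
qed

text \<open>Two normalizations share their linear parts and constant terms, which is agreement up to
  degree 2; \<open>agree_step\<close> propagates this to all degrees.\<close>

lemma normalization_unique:
  assumes "is_normalization p q (of_nat p * x_var + P) (- of_nat q * y_var + Q) X Y u v"
    and "is_normalization p q (of_nat p * x_var + P) (- of_nat q * y_var + Q) X' Y' u' v'"
  shows "X = X' \<and> Y = Y' \<and> u = u' \<and> v = v'"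
proof -
  note h = assms[unfolded is_normalization_iff]
  have leads: "lead 1 X 1 0" "lead 1 Y 0 1" "lead 1 X' 1 0" "lead 1 Y' 0 1"
    using h by (auto simp: normalized_def)
  then have W: "lead 1 (X ^ q * Y ^ p) q p" "lead 1 (X' ^ q * Y' ^ p) q p"
    by (auto intro: lead_monomial_W)
  have "low (N + 2) (X - X') \<and> low (N + 2) (Y - Y') \<and>
    coeffs_agree (p + q) (N + 2) u u' \<and> coeffs_agree (p + q) (N + 2) v v'" for N
  proof (induction N)
    case 0
    have agree: "coeffs_agree (p + q) 2 w w'" if "w $ 0 = w' $ 0" for w w' :: "'a fps"
      unfolding coeffs_agree_def
    proof (intro conjI allI impI)
      fix k assume "k * (p + q) + 1 < 2"
      then have "k = 0" using p_pos q_pos by simp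
      then show "w $ k = w' $ k" using that by simp
    qed (rule that)
    have "coeffs_agree (p + q) 2 u u'" "coeffs_agree (p + q) 2 v v'"
      by (rule agree; use h in simp)+
    moreover have "low 2 (X - X')" "low 2 (Y - Y')"
      using leads[unfolded lead_def] low_diff[of 2 "X - fps2_monom 1 1 0" "X' - fps2_monom 1 1 0"]
        low_diff[of 2 "Y - fps2_monom 1 0 1" "Y' - fps2_monom 1 0 1"] by (simp_all add: numeral_2_eq_2)
    ultimately show ?case by (simp add: numeral_2_eq_2)
  next
    case (Suc N)
    have lW: "low (N + 2) (X ^ q * Y ^ p - X' ^ q * Y' ^ p)"
      using Suc by (intro low_mult_diff low_power_diff) auto
    have x: "low (Suc (N + 2)) (X - X')" "coeffs_agree (p + q) (Suc (N + 2)) u u'"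
      by (rule agree_step[of 1 0 "int p" "N + 2" X X' _ _ u u', OF _ _ _ _ _ _ W lW]; use h Suc in simp)+
    have y: "low (Suc (N + 2)) (Y - Y')" "coeffs_agree (p + q) (Suc (N + 2)) v v'"
      by (rule agree_step[of 0 1 "- int q" "N + 2" Y Y' _ _ v v', OF _ _ _ _ _ _ W lW]; use h Suc in simp)+
    show ?case using x y by simp
  qed
  note low_all = this
  have "(X - X') $ i $ j = 0" "(Y - Y') $ i $ j = 0" for i j
    by (rule lowD[of "i + j + 2"]; use low_all[of "i + j"] in simp)+
  then have "X - X' = 0" "Y - Y' = 0" by (simp_all add: fps2_eqI)
  then have "X = X'" "Y = Y'" by simp_all
  moreover have "u $ k = u' $ k" "v $ k = v' $ k" for k
    using low_all[of "k * (p + q)"] by (simp_all add: coeffs_agree_def)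
  then have "u = u'" "v = v'" by (simp_all add: fps_eq_iff)
  ultimately show ?thesis by blast
qed

end

section \<open>Degrees of the normalization, and change of coefficients\<close>

text \<open>Homogeneity for the grading by total degree modulo \<open>s\<close>. The residue is an
  integer so that derivatives can lower it without truncation.\<close>

definition supp_mod :: "int \<Rightarrow> int \<Rightarrow> 'a::comm_ring_1 fps2 \<Rightarrow> bool" where
  "supp_mod s r F \<longleftrightarrow> (\<forall>i j. F $ i $ j \<noteq> 0 \<longrightarrow> s dvd int i + int j - r)"

lemma supp_modI: "(\<And>i j. F $ i $ j \<noteq> 0 \<Longrightarrow> s dvd int i + int j - r) \<Longrightarrow> supp_mod s r F"
  by (simp add: supp_mod_def)

lemma supp_modD: "supp_mod s r F \<Longrightarrow> F $ i $ j \<noteq> 0 \<Longrightarrow> s dvd int i + int j - r"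
  by (simp add: supp_mod_def)

lemma supp_mod_nth_eq_0: "supp_mod s r F \<Longrightarrow> \<not> s dvd int i + int j - r \<Longrightarrow> F $ i $ j = 0"
  by (auto simp: supp_mod_def)

lemma supp_mod_add: "supp_mod s r F \<Longrightarrow> supp_mod s r G \<Longrightarrow> supp_mod s r (F + G)"
  unfolding supp_mod_def by (metis add.right_neutral fps_add_nth)

lemma supp_mod_minus: "supp_mod s r F \<Longrightarrow> supp_mod s r (- F)"
  by (simp add: supp_mod_def)

lemma supp_mod_diff: "supp_mod s r F \<Longrightarrow> supp_mod s r G \<Longrightarrow> supp_mod s r (F - G)"
  using supp_mod_add[of s r F "- G"] by (simp add: supp_mod_minus)

lemma supp_mod_monom: "s dvd int a + int b - r \<Longrightarrow> supp_mod s r (fps2_monom c a b)"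
  by (auto simp: supp_mod_def)

lemma supp_mod_mult:
  assumes "supp_mod s r F" "supp_mod s r' G"
  shows "supp_mod s (r + r') (F * G)"
proof (rule supp_modI)
  fix i j assume "(F * G) $ i $ j \<noteq> 0"
  then obtain a b where ab: "a \<le> i" "b \<le> j" "F $ a $ b * G $ (i - a) $ (j - b) \<noteq> 0"
    unfolding fps2_mult_nth by (metis (no_types, lifting) atMost_iff sum.neutral)
  then have "F $ a $ b \<noteq> 0" "G $ (i - a) $ (j - b) \<noteq> 0" by auto
  then have "s dvd (int a + int b - r) + (int (i - a) + int (j - b) - r')"
    using assms by (intro dvd_add supp_modD)
  also have "\<dots> = int i + int j - (r + r')" using ab by (simp add: of_nat_diff)
  finally show "s dvd int i + int j - (r + r')" .
qed

lemma supp_mod_1: "supp_mod s 0 1"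
  using supp_mod_monom[of s 0 0 0 1] by (simp add: fps2_monom_1)

lemma supp_mod_power: "supp_mod s r F \<Longrightarrow> supp_mod s (int k * r) (F ^ k)"
proof (induction k)
  case (Suc k)
  then show ?case using supp_mod_mult[of s r F "int k * r" "F ^ k"] by (simp add: algebra_simps)
qed (simp add: supp_mod_1)

lemma supp_mod_deriv_x: "supp_mod s r F \<Longrightarrow> supp_mod s (r - 1) (deriv_x F)"
proof (rule supp_modI)
  fix i j assume F: "supp_mod s r F" and "deriv_x F $ i $ j \<noteq> 0"
  then have "F $ (i + 1) $ j \<noteq> 0" by (auto simp: deriv_x_nth)
  from supp_modD[OF F this] show "s dvd int i + int j - (r - 1)" by (simp add: algebra_simps)
qed

lemma supp_mod_deriv_y: "supp_mod s r F \<Longrightarrow> supp_mod s (r - 1) (deriv_y F)"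
proof (rule supp_modI)
  fix i j assume F: "supp_mod s r F" and "deriv_y F $ i $ j \<noteq> 0"
  then have "F $ i $ (j + 1) \<noteq> 0" by (auto simp: deriv_y_nth)
  from supp_modD[OF F this] show "s dvd int i + int j - (r - 1)" by (simp add: algebra_simps)
qed

lemma supp_mod_subst_fps:
  assumes W: "supp_mod s r W" and f: "\<And>k. f $ k \<noteq> 0 \<Longrightarrow> s dvd int k * r"
  shows "supp_mod s 0 (subst_fps f W)"
proof (rule supp_modI)
  fix i j assume "subst_fps f W $ i $ j \<noteq> 0"
  then obtain k where k: "f $ k * (W ^ k) $ i $ j \<noteq> 0"
    by (auto simp: subst_fps_def elim: sum.not_neutral_contains_not_neutral)
  then have "f $ k \<noteq> 0" "(W ^ k) $ i $ j \<noteq> 0" by (metis mult_zero_left, metis mult_zero_right)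
  then have "s dvd int k * r" using f by blast
  moreover have "s dvd int i + int j - int k * r"
    by (intro supp_modD[OF supp_mod_power[OF W]]) fact
  ultimately have "s dvd int k * r + (int i + int j - int k * r)" by (rule dvd_add)
  then show "s dvd int i + int j - 0" by simp
qed

context resonant_system
begin

definition supp_proj :: "int \<Rightarrow> 'a fps2 \<Rightarrow> 'a fps2" where
  "supp_proj s A = Abs_fps (\<lambda>i. Abs_fps (\<lambda>j. if s dvd int i + int j - 1 then A $ i $ j else 0))"

text \<open>The term \<open>u $ k * W ^ k\<close> lives in degrees congruent to
  \<open>k * (p + q)\<close>, so it is compatible with degree 0 modulo \<open>s\<close> only for the
  indices kept here.\<close>

definition coeff_proj :: "int \<Rightarrow> 'a fps \<Rightarrow> 'a fps" where
  "coeff_proj s u = Abs_fps (\<lambda>k. if s dvd int k * int (p + q) then u $ k else 0)"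

lemma supp_mod_defect:
  assumes P: "supp_mod s 1 P" and Q: "supp_mod s 1 Q" and A: "supp_mod s 1 A"
    and W: "supp_mod s (int (p + q)) W" and u: "\<And>k. u $ k \<noteq> 0 \<Longrightarrow> s dvd int k * int (p + q)"
  shows "supp_mod s 1 (defect c A u W)"
proof -
  have monom: "supp_mod s 0 (of_nat m)" for m :: nat
    unfolding of_nat_eq_monom by (rule supp_mod_monom) simp
  have c: "supp_mod s 0 (of_int c)"
    by (cases c) (simp_all only: of_int_minus of_int_of_nat_eq monom supp_mod_minus)
  have F: "supp_mod s 1 (of_nat p * x_var + P)"
    using supp_mod_mult[OF monom supp_mod_monom[of s 1 0 1 1]] P
    by (intro supp_mod_add) (simp_all add: x_var_eq_monom)
  have G: "supp_mod s 1 (- of_nat q * y_var + Q)"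
    using supp_mod_mult[OF supp_mod_minus[OF monom] supp_mod_monom[of s 0 1 1 1]] Q
    by (intro supp_mod_add) (simp_all add: y_var_eq_monom)
  have "supp_mod s 1 (lie A)"
    unfolding lie_def
    using supp_mod_mult[OF supp_mod_deriv_x[OF A] F] supp_mod_mult[OF supp_mod_deriv_y[OF A] G]
    by (intro supp_mod_add) simp_all
  moreover have "supp_mod s 1 (of_int c * A * subst_fps u W)"
    using supp_mod_mult[OF supp_mod_mult[OF c A] supp_mod_subst_fps[OF W u]] by simp
  ultimately show ?thesis unfolding defect_def by (rule supp_mod_diff)
qed

lemma normalized_supp_proj:
  assumes "normalized \<alpha> \<beta> A" "\<alpha> + \<beta> = 1"
  shows "normalized \<alpha> \<beta> (supp_proj s A)"
  using assms by (auto simp: normalized_def lead_iff supp_proj_def simp flip: of_nat_add)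

text \<open>
  Projecting a normalization to the degrees it should live in does not change it: in the other
  degrees both defects vanish, so that the next coefficients agree.
\<close>

lemma supp_proj_step:
  assumes ab: "\<alpha> + \<beta> = 1" and c: "c = int p * int \<alpha> - int q * int \<beta>" and N: "2 \<le> N"
    and A: "normalized \<alpha> \<beta> A" "low N (A - supp_proj s A)"
    and W: "lead 1 W q p" "lead 1 W' q p" "low N (W - W')"
    and u0: "u $ 0 = 1" and u: "coeffs_agree (p + q) N u (coeff_proj s u)"
    and D: "defect c A u W = 0" and D': "supp_mod s 1 (defect c (supp_proj s A) (coeff_proj s u) W')"
  shows "low (Suc N) (A - supp_proj s A) \<and> coeffs_agree (p + q) (Suc N) u (coeff_proj s u)"
proof (cases "s dvd int N - 1")
  case False
  have "defect c A u W $ i $ j = defect c (supp_proj s A) (coeff_proj s u) W' $ i $ j"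
    if "i + j = N" for i j
    using D supp_mod_nth_eq_0[OF D', of i j] False that by auto
  then show ?thesis
    using agree_step[OF ab c N A(1) normalized_supp_proj[OF A(1) ab] A(2) W u0 u] by blast
next
  case True
  have "(A - supp_proj s A) $ i $ j = 0" if "i + j < Suc N" for i j
  proof (cases "i + j = N")
    case ij: True
    then have "s dvd int i + int j - 1" using True by (metis of_nat_add)
    then show ?thesis by (simp add: supp_proj_def)
  next
    case False
    then show ?thesis using that by (intro lowD[OF A(2)]) simp
  qed
  moreover have "u $ k = coeff_proj s u $ k" if "k * (p + q) + 1 < Suc N" for k
  proof (cases "k * (p + q) + 1 = N")
    case kN: True
    then have "int N - 1 = int k * int (p + q)" by (metis add_diff_cancel_right' of_nat_1 of_nat_add of_nat_mult)
    then show ?thesis using True by (simp add: coeff_proj_def)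
  next
    case False
    then show ?thesis using that u by (simp add: coeffs_agree_def)
  qed
  ultimately show ?thesis using u by (simp add: low_def coeffs_agree_def)
qed

text \<open>The normalization coincides with its own projection. For a system of degree
  \<open>s + 1\<close> this leaves only those coefficients of \<open>u\<close> and \<open>v\<close>
  whose index times \<open>p + q\<close> is divisible by \<open>s\<close>.\<close>

lemma normalization_supp:
  assumes P: "supp_mod s 1 P" and Q: "supp_mod s 1 Q"
    and norm: "is_normalization p q (of_nat p * x_var + P) (- of_nat q * y_var + Q) X Y u v"
  shows "supp_mod s 1 X" "supp_mod s 1 Y"
    "u $ k \<noteq> 0 \<Longrightarrow> s dvd int k * int (p + q)" "v $ k \<noteq> 0 \<Longrightarrow> s dvd int k * int (p + q)"
proof -
  note h = norm[unfolded is_normalization_iff]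
  define X' Y' u' v' where defs: "X' = supp_proj s X" "Y' = supp_proj s Y" "u' = coeff_proj s u" "v' = coeff_proj s v"
  have X': "normalized 1 0 X'" "supp_mod s 1 X'" and Y': "normalized 0 1 Y'" "supp_mod s 1 Y'"
    using h by (simp_all add: defs normalized_supp_proj) (simp_all add: supp_proj_def supp_mod_def)
  have u': "s dvd int k * int (p + q)" if "u' $ k \<noteq> 0" for k
    using that by (simp add: defs coeff_proj_def split: if_splits)
  have v': "s dvd int k * int (p + q)" if "v' $ k \<noteq> 0" for k
    using that by (simp add: defs coeff_proj_def split: if_splits)
  have W: "lead 1 (X ^ q * Y ^ p) q p" "lead 1 (X' ^ q * Y' ^ p) q p"
    by (rule lead_monomial_W; use h X' Y' in \<open>simp add: normalized_def\<close>)+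
  have sW: "supp_mod s (int (p + q)) (X' ^ q * Y' ^ p)"
    using supp_mod_mult[OF supp_mod_power[OF X'(2), of q] supp_mod_power[OF Y'(2), of p]]
    by (simp add: add.commute)
  have "low (N + 2) (X - X') \<and> low (N + 2) (Y - Y') \<and>
    coeffs_agree (p + q) (N + 2) u u' \<and> coeffs_agree (p + q) (N + 2) v v'" for N
  proof (induction N)
    case 0
    have agree: "coeffs_agree (p + q) 2 w (coeff_proj s w)" for w
      unfolding coeffs_agree_def
    proof (intro conjI allI impI)
      fix k assume "k * (p + q) + 1 < 2"
      then have "k = 0" using p_pos q_pos by simp
      then show "w $ k = coeff_proj s w $ k" by (simp add: coeff_proj_def)
    qed (simp add: coeff_proj_def)
    have "low 2 (A - A')" if "lead 1 A \<alpha> \<beta>" "lead 1 A' \<alpha> \<beta>" "\<alpha> + \<beta> = 1" for A A' :: "'a fps2" and \<alpha> \<beta>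
      using low_diff[OF that(1,2)[unfolded lead_def]] that(3) by (simp add: numeral_2_eq_2)
    then have "low 2 (X - X')" "low 2 (Y - Y')"
      using h X' Y' by (auto simp: normalized_def)
    then show ?case using agree by (simp add: defs numeral_2_eq_2)
  next
    case (Suc N)
    have lW: "low (N + 2) (X ^ q * Y ^ p - X' ^ q * Y' ^ p)"
      using Suc by (intro low_mult_diff low_power_diff) auto
    have "low (Suc (N + 2)) (X - supp_proj s X) \<and> coeffs_agree (p + q) (Suc (N + 2)) u (coeff_proj s u)"
      by (rule supp_proj_step[of 1 0 "int p" "N + 2" X s _ _ u, OF _ _ _ _ _ W lW])
        (use h Suc supp_mod_defect[OF P Q X'(2) sW u'] in \<open>simp_all add: defs\<close>)
    moreover have "low (Suc (N + 2)) (Y - supp_proj s Y) \<and> coeffs_agree (p + q) (Suc (N + 2)) v (coeff_proj s v)"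
      by (rule supp_proj_step[of 0 1 "- int q" "N + 2" Y s _ _ v, OF _ _ _ _ _ W lW])
        (use h Suc supp_mod_defect[OF P Q Y'(2) sW v'] in \<open>simp_all add: defs\<close>)
    ultimately show ?case by (simp add: defs)
  qed
  note low_all = this
  have "(X - X') $ i $ j = 0" "(Y - Y') $ i $ j = 0" for i j
    by (rule lowD[of "i + j + 2"]; use low_all[of "i + j"] in simp)+
  then have "X - X' = 0" "Y - Y' = 0" by (simp_all add: fps2_eqI)
  then show "supp_mod s 1 X" "supp_mod s 1 Y" using X' Y' by simp_all
  have "u $ k = u' $ k" "v $ k = v' $ k" for k
    using low_all[of "k * (p + q)"] by (simp_all add: coeffs_agree_def)
  then show "u $ k \<noteq> 0 \<Longrightarrow> s dvd int k * int (p + q)" "v $ k \<noteq> 0 \<Longrightarrow> s dvd int k * int (p + q)"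
    using u'[of k] v'[of k] by simp_all
qed

end

section \<open>Ring homomorphisms applied to coefficients\<close>

locale coeff_hom =
  fixes h :: "'a::comm_ring_1 \<Rightarrow> 'b::comm_ring_1"
  assumes add: "h (x + y) = h x + h y" and mult: "h (x * y) = h x * h y" and one: "h 1 = 1"
begin

lemma zero: "h 0 = 0"
  using add[of 0 0] by simp

lemma minus: "h (- x) = - h x"
  using add[of x "- x"] by (simp add: zero eq_neg_iff_add_eq_0 add.commute)

lemma diff: "h (x - y) = h x - h y"
  using add[of x "- y"] by (simp add: minus)

lemma nat: "h (of_nat m) = of_nat m"
  by (induction m) (simp_all add: zero one add)

lemma sum: "h (sum f A) = (\<Sum>x\<in>A. h (f x))"
  by (induction A rule: infinite_finite_induct) (simp_all add: zero add)

definition map1 :: "'a fps \<Rightarrow> 'b fps" where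
  "map1 f = Abs_fps (\<lambda>k. h (f $ k))"

definition map2 :: "'a fps2 \<Rightarrow> 'b fps2" where
  "map2 F = Abs_fps (\<lambda>i. Abs_fps (\<lambda>j. h (F $ i $ j)))"

lemma map1_nth [simp]: "map1 f $ k = h (f $ k)"
  by (simp add: map1_def)

lemma map2_nth [simp]: "map2 F $ i $ j = h (F $ i $ j)"
  by (simp add: map2_def)

lemma map2_add: "map2 (F + G) = map2 F + map2 G"
  by (rule fps2_eqI) (simp add: add)

lemma map2_minus: "map2 (- F) = - map2 F"
  by (rule fps2_eqI) (simp add: minus)

lemma map2_diff: "map2 (F - G) = map2 F - map2 G"
  by (rule fps2_eqI) (simp add: diff)

lemma map2_mult: "map2 (F * G) = map2 F * map2 G"
  by (rule fps2_eqI) (simp add: fps2_mult_nth sum mult)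

lemma map2_monom: "map2 (fps2_monom c a b) = fps2_monom (h c) a b"
  by (rule fps2_eqI) (simp add: zero)

lemma map2_of_nat: "map2 (of_nat m) = of_nat m"
  by (simp add: of_nat_eq_monom map2_monom nat)

lemma map2_1: "map2 1 = 1"
  using map2_of_nat[of 1] by simp

lemma map2_power: "map2 (F ^ k) = map2 F ^ k"
  by (induction k) (simp_all add: map2_mult map2_1)

lemma map2_deriv_x: "map2 (deriv_x F) = deriv_x (map2 F)"
  by (rule fps2_eqI) (simp add: deriv_x_nth mult nat del: of_nat_Suc of_nat_add)

lemma map2_deriv_y: "map2 (deriv_y F) = deriv_y (map2 F)"
  by (rule fps2_eqI) (simp add: deriv_y_nth mult nat del: of_nat_Suc of_nat_add)

lemma map2_subst_fps: "map2 (subst_fps u W) = subst_fps (map1 u) (map2 W)"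
  by (rule fps2_eqI) (simp add: subst_fps_def sum mult map2_power[symmetric])

text \<open>The defining equations are built from ring operations, derivatives and substitution, so
  a normalization of the generic system specializes to one of each specialized system.\<close>

lemma is_normalization_map:
  assumes "is_normalization p q F G X Y u v"
  shows "is_normalization p q (map2 F) (map2 G) (map2 X) (map2 Y) (map1 u) (map1 v)"
proof -
  have *: "map2 (deriv_x X * F + deriv_y X * G) = map2 (of_nat p * X * subst_fps u (X ^ q * Y ^ p))"
    "map2 (deriv_x Y * F + deriv_y Y * G) = map2 (- of_nat q * Y * subst_fps v (X ^ q * Y ^ p))"
    using assms by (simp_all add: is_normalization_def)
  show ?thesis
    using assms *[unfolded map2_add map2_mult map2_minus map2_of_nat map2_deriv_x map2_deriv_y
        map2_subst_fps map2_power]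
    by (simp add: is_normalization_def zero one)
qed

end

section \<open>Centres of radial type and residues\<close>

text \<open>The derivation \<alpha> x d/dx + \<beta> y d/dy. With \<open>p\<close> and
  \<open>- q\<close> it is the linear part of the system, with 1 and 1 the Euler field.\<close>

definition wt :: "'a \<Rightarrow> 'a \<Rightarrow> 'a::comm_ring_1 fps2 \<Rightarrow> 'a fps2" where
  "wt \<alpha> \<beta> F = Abs_fps (\<lambda>i. Abs_fps (\<lambda>j. (of_nat i * \<alpha> + of_nat j * \<beta>) * F $ i $ j))"

lemma wt_nth [simp]: "wt \<alpha> \<beta> F $ i $ j = (of_nat i * \<alpha> + of_nat j * \<beta>) * F $ i $ j"
  by (simp add: wt_def)

lemma wt_mult: "wt \<alpha> \<beta> (F * G) = wt \<alpha> \<beta> F * G + F * wt \<alpha> \<beta> G"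
proof (rule fps2_eqI)
  fix i j
  have *: "(of_nat i * \<alpha> + of_nat j * \<beta>) * (F $ a $ b * G $ (i - a) $ (j - b))
    = (of_nat a * \<alpha> + of_nat b * \<beta>) * F $ a $ b * G $ (i - a) $ (j - b)
      + F $ a $ b * ((of_nat (i - a) * \<alpha> + of_nat (j - b) * \<beta>) * G $ (i - a) $ (j - b))"
    if "a \<le> i" "b \<le> j" for a b
    using that by (simp add: of_nat_diff algebra_simps)
  have "wt \<alpha> \<beta> (F * G) $ i $ j
      = (\<Sum>a\<le>i. \<Sum>b\<le>j. (of_nat i * \<alpha> + of_nat j * \<beta>) * (F $ a $ b * G $ (i - a) $ (j - b)))"
    by (simp add: fps2_mult_nth sum_distrib_left)
  also have "\<dots> = (\<Sum>a\<le>i. \<Sum>b\<le>j. (of_nat a * \<alpha> + of_nat b * \<beta>) * F $ a $ b * G $ (i - a) $ (j - b)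
      + F $ a $ b * ((of_nat (i - a) * \<alpha> + of_nat (j - b) * \<beta>) * G $ (i - a) $ (j - b)))"
    by (intro sum.cong refl *) auto
  also have "\<dots> = (wt \<alpha> \<beta> F * G + F * wt \<alpha> \<beta> G) $ i $ j"
    by (simp add: fps2_mult_nth sum.distrib)
  finally show "wt \<alpha> \<beta> (F * G) $ i $ j = (wt \<alpha> \<beta> F * G + F * wt \<alpha> \<beta> G) $ i $ j" .
qed

lemma wt_add: "wt \<alpha> \<beta> (F + G) = wt \<alpha> \<beta> F + wt \<alpha> \<beta> G"
  by (rule fps2_eqI) (simp add: algebra_simps)

lemma wt_diff: "wt \<alpha> \<beta> (F - G) = wt \<alpha> \<beta> F - wt \<alpha> \<beta> G"
  by (rule fps2_eqI) (simp add: algebra_simps)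

lemma wt_monom: "wt \<alpha> \<beta> (fps2_monom c a b) = fps2_monom ((of_nat a * \<alpha> + of_nat b * \<beta>) * c) a b"
  by (rule fps2_eqI) auto

lemma wt_1: "wt \<alpha> \<beta> 1 = 0"
  using wt_monom[of \<alpha> \<beta> 1 0 0] by (simp add: fps2_monom_1) (rule fps2_eqI, simp)

lemma low_wt: "low N F \<Longrightarrow> low N (wt \<alpha> \<beta> F)"
  by (simp add: low_def)

text \<open>An invariant series with cofactor \<open>H\<close> has powers with cofactor
  \<open>k H\<close>. The derivation is arbitrary because this serves \<open>wt\<close>,
  \<open>L0\<close> and the Lie derivative alike.\<close>

lemma derivation_power_eq:
  fixes L :: "'a::comm_ring_1 fps2 \<Rightarrow> 'a fps2"
  assumes mult: "\<And>F G. L (F * G) = L F * G + F * L G" and F: "L F = H * F"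
  shows "L (F ^ k) = of_nat k * H * F ^ k"
proof (induction k)
  case 0
  have "L 1 = 0" using mult[of 1 1] by simp
  then show ?case by simp
qed (simp add: mult F algebra_simps)

lemma inverse_one_minus:
  fixes C :: "'a::comm_ring_1 fps2"
  assumes "low 1 C"
  shows "\<exists>E. (1 - C) * E = 1"
proof -
  \<comment> \<open>The geometric series in \<open>C\<close>; each coefficient is checked against a
    finite partial sum.\<close>
  define E where "E = subst_fps (Abs_fps (\<lambda>_. 1)) C"
  have "((1 - C) * E - 1) $ i $ j = 0" for i j
  proof -
    define N where "N = i + j + 1"
    define G where "G = (\<Sum>k<N. C ^ k)"
    have "low N (E - G)"
      unfolding low_def
    proof (intro allI impI)
      fix a b assume "a + b < N"
      then have "E $ a $ b = (\<Sum>k\<le>N - 1. (C ^ k) $ a $ b)"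
        unfolding E_def by (subst subst_fps_nth[OF assms]) auto
      also have "\<dots> = G $ a $ b"
        by (simp add: G_def fps_sum_nth N_def lessThan_Suc_atMost)
      finally show "(E - G) $ a $ b = 0" by simp
    qed
    then have "low N ((1 - C) * (E - G) - C ^ N)"
      using low_power[OF assms, of N] by (intro low_diff[OF low_mult_right]) simp_all
    moreover have "(1 - C) * E - 1 = (1 - C) * (E - G) - C ^ N"
      using one_diff_power_eq[of C N] by (simp add: G_def algebra_simps)
    ultimately show ?thesis by (simp only:) (rule lowD, auto simp: N_def)
  qed
  then have "(1 - C) * E - 1 = 0" by (intro fps2_eqI) simp
  then show ?thesis by (intro exI[of _ E]) simp
qed

definition homog :: "nat \<Rightarrow> 'a::comm_ring_1 fps2 \<Rightarrow> bool" where
  "homog s F \<longleftrightarrow> (\<forall>i j. i + j \<noteq> s \<longrightarrow> F $ i $ j = 0)"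

lemma homog_low: "homog s F \<Longrightarrow> low s F"
  by (simp add: homog_def low_def)

lemma homog_supp_mod: "homog s F \<Longrightarrow> supp_mod (int s) 0 F"
  unfolding homog_def supp_mod_def by (metis diff_0_right dvd_refl of_nat_add)

text \<open>Here \<open>s\<close> is one less than the degree of the system. Coprimality of
  \<open>M\<close> and \<nu> makes \<open>d\<close> the gcd of \<open>s\<close> and
  \<open>p + q\<close>.\<close>

locale radial_system =
  fixes p q s d M \<nu> :: nat and C S :: "'a::field_char_0 fps2"
  assumes p_pos: "0 < p" and q_pos: "0 < q" and coprime_pq: "coprime p q"
    and s_pos: "0 < s" and s_eq: "s = M * d" and pq_eq: "p + q = \<nu> * d" and coprime_M\<nu>: "coprime M \<nu>"
    and homog_C: "homog s C" and homog_S: "homog s S"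
begin

definition R :: "'a fps2" where
  "R = Abs_fps (\<lambda>i. Abs_fps (\<lambda>j. - ((of_nat i * of_nat p - of_nat j * of_nat q) / of_nat s) * C $ i $ j))"

definition L0 :: "'a fps2 \<Rightarrow> 'a fps2" where
  "L0 F = wt (of_nat p) (- of_nat q) F + R * wt 1 1 F"

lemma M_pos: "0 < M" and d_pos: "0 < d" and \<nu>_pos: "0 < \<nu>"
  using s_pos s_eq pq_eq p_pos by (auto intro: Nat.gr0I)

lemma \<nu>s: "\<nu> * s = M * (p + q)"
  by (simp add: s_eq pq_eq)

lemma homog_R: "homog s R"
  using homog_C by (simp add: homog_def R_def)

lemma L0_mult: "L0 (F * G) = L0 F * G + F * L0 G"
  by (simp add: L0_def wt_mult algebra_simps)

lemma L0_diff: "L0 (F - G) = L0 F - L0 G"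
  by (simp add: L0_def wt_diff algebra_simps)

abbreviation D :: "'a fps2" where "D \<equiv> 1 - C"

lemma L0_1: "L0 1 = 0"
  by (simp add: L0_def wt_1)

lemma wt_C: "wt (of_nat p) (- of_nat q) C = - (of_nat s * R)"
  by (rule fps2_eqI) (use s_pos in \<open>simp add: R_def of_nat_mult_nth2 field_simps\<close>)

lemma euler: "homog s F \<Longrightarrow> wt 1 1 F = of_nat s * (F :: 'a fps2)"
proof (rule fps2_eqI)
  fix i j assume F: "homog s F"
  show "wt 1 1 F $ i $ j = (of_nat s * F) $ i $ j"
  proof (cases "i + j = s")
    case True
    then have "of_nat s = (of_nat i + of_nat j :: 'a)" by (metis of_nat_add)
    then show ?thesis by (simp add: of_nat_mult_nth2)
  next
    case False
    then show ?thesis using F by (simp add: homog_def of_nat_mult_nth2)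
  qed
qed

text \<open>\<open>R\<close> is defined so that \<open>wt p (- q)\<close> sends \<open>D\<close> to
  \<open>s R\<close>; by Euler's relation the radial part contributes \<open>- s R C\<close>, and
  together \<open>D\<close> is invariant with cofactor \<open>s R\<close>.\<close>

lemma L0_D: "L0 D = of_nat s * R * D"
  by (simp add: L0_diff L0_1) (simp add: L0_def wt_C euler[OF homog_C] algebra_simps)

definition coeffJ :: "nat \<Rightarrow> 'a fps2 \<Rightarrow> 'a" where
  "coeffJ m F = (D ^ (m * \<nu> - 1) * F) $ (m * M * q) $ (m * M * p)"

lemma coeffJ_add: "coeffJ m (F + G) = coeffJ m F + coeffJ m G"
  by (simp add: coeffJ_def algebra_simps)

lemma coeffJ_diff: "coeffJ m (F - G) = coeffJ m F - coeffJ m G"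
  by (simp add: coeffJ_def algebra_simps)

text \<open>
  \<open>1 / (x y D)\<close> is an integrating factor of \<open>L0\<close> and \<open>(x\<^sup>q y\<^sup>p)\<^sup>M D\<^sup>-\<^sup>\<nu>\<close> is a first integral, so that
  \<open>coeffJ m F\<close> is the residue of \<open>F\<close> against a closed form; residues of divergences vanish.
\<close>

lemma coeffJ_L0:
  assumes "0 < m"
  shows "coeffJ m (L0 F) = 0"
proof -
  define N where "N = m * \<nu> - 1"
  define H where "H = D ^ N * F"
  let ?i = "m * M * q" and ?j = "m * M * p"
  have N: "Suc N = m * \<nu>" using assms \<nu>_pos by (simp add: N_def)
  have "L0 (D ^ N) = of_nat N * (of_nat s * R) * D ^ N"
    by (rule derivation_power_eq) (simp_all add: L0_mult L0_D)
  then have "D ^ N * L0 F = L0 H - of_nat N * of_nat s * (R * H)"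
    by (simp add: H_def L0_mult algebra_simps)
  also have "L0 H = wt (of_nat p) (- of_nat q) H + (wt 1 1 (R * H) - of_nat s * (R * H))"
    by (simp add: L0_def wt_mult euler[OF homog_R] algebra_simps)
  \<comment> \<open>At the monomial \<open>(x^q y^p)^(m M)\<close> the weight with \<open>p\<close>
    and \<open>- q\<close> is zero, and the Euler field multiplies by the degree. That degree is
    \<open>Suc N * s\<close>, so the three contributions cancel.\<close>
  finally have "coeffJ m (L0 F) = (of_nat (?i + ?j) - of_nat s - of_nat N * of_nat s) * (R * H) $ ?i $ ?j"
    unfolding coeffJ_def N_def[symmetric]
    by (simp add: of_nat_mult_nth2 mult.assoc[of "of_nat N"]) (simp add: algebra_simps)
  also have "?i + ?j = Suc N * s"
    unfolding N using arg_cong[OF \<nu>s, of "\<lambda>k. m * k"] by (simp add: algebra_simps)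
  finally show ?thesis by (simp add: algebra_simps)
qed

definition E :: "'a fps2" where
  "E = (SOME E. D * E = 1)"

lemma D_E: "D * E = 1"
proof -
  have "low 1 C" using homog_low[OF homog_C] s_pos by (auto intro: low_mono)
  then show ?thesis unfolding E_def by (rule someI_ex[OF inverse_one_minus])
qed

lemma lead_D: "lead 1 D 0 0"
proof -
  have "C $ 0 $ 0 = 0" using homog_C s_pos by (simp add: homog_def)
  then show ?thesis by (simp add: lead_iff)
qed

lemma lead_E: "lead 1 E 0 0"
proof -
  have "(D * E) $ 0 $ 0 = 1" by (simp add: D_E)
  moreover have "D $ 0 $ 0 = 1" using lead_nth[OF lead_D, of 0 0] by simp
  ultimately show ?thesis by (simp add: lead_iff fps2_mult_nth)
qed

text \<open>Induction on the degree through the recursion \<open>E = 1 + C * E\<close>, in which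
  \<open>C\<close> shifts degrees by exactly \<open>s\<close>.\<close>

lemma supp_E: "supp_mod (int s) 0 E"
proof (rule supp_modI)
  fix i j assume ij: "E $ i $ j \<noteq> 0"
  have "int s dvd int i + int j" if "i + j = h" "E $ i $ j \<noteq> 0" for h
    using that
  proof (induction h arbitrary: i j rule: less_induct)
    case (less h)
    show ?case
    proof (cases "i + j = 0")
      case False
      have "E = 1 + C * E" using D_E by (simp add: algebra_simps)
      then have "E $ i $ j = 1 $ i $ j + (C * E) $ i $ j" by (metis fps_add_nth)
      also have "1 $ i $ j = (0 :: 'a)" using False by auto
      finally have "(C * E) $ i $ j \<noteq> 0" using less.prems by simp
      then obtain a b where ab: "a \<le> i" "b \<le> j" "C $ a $ b * E $ (i - a) $ (j - b) \<noteq> 0"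
        unfolding fps2_mult_nth by (metis (no_types, lifting) atMost_iff sum.neutral)
      then have "a + b = s" using homog_C by (auto simp: homog_def)
      moreover have "int s dvd int (i - a) + int (j - b)"
        using ab less.prems \<open>a + b = s\<close> s_pos by (intro less.IH[of "(i - a) + (j - b)"]) auto
      ultimately have "int s dvd int (i - a) + int (j - b) + int (a + b)" by (simp add: dvd_add)
      also have "\<dots> = int i + int j" using ab by (simp add: of_nat_diff)
      finally show ?thesis .
    qed simp
  qed
  then show "int s dvd int i + int j - 0" using ij by simp
qed

text \<open>The first integral of the radial system, with the inverse power of \<open>D\<close>
  written as a power of \<open>E\<close>.\<close>

definition Z :: "'a fps2" where
  "Z = fps2_monom 1 (M * q) (M * p) * E ^ \<nu>"

lemma lead_Z: "lead 1 Z (M * q) (M * p)"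
proof -
  have "lead 1 (fps2_monom 1 (M * q) (M * p) :: 'a fps2) (M * q) (M * p)" by (simp add: lead_def)
  from lead_mult[OF this lead_power[OF lead_E, of \<nu>]] show ?thesis by (simp add: Z_def)
qed

lemma supp_Z: "supp_mod (int s) 0 Z"
proof -
  have "int s dvd int (M * q) + int (M * p) - 0"
    using \<nu>s by (metis add.commute diff_0_right distrib_left dvd_triv_right of_nat_add of_nat_dvd_iff)
  from supp_mod_mult[OF supp_mod_monom[OF this] supp_mod_power[OF supp_E, of \<nu>]]
  show ?thesis by (simp add: Z_def)
qed

text \<open>The monomial has cofactor \<open>M (p + q) R\<close> and \<open>E ^ \<nu>\<close> has
  cofactor \<open>- \<nu> s R\<close>; these are opposite by \<open>\<nu>s\<close>.\<close>

lemma L0_Z: "L0 Z = 0"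
proof -
  have "0 = (L0 D * E + D * L0 E) * E" using L0_mult[of D E] by (simp add: D_E L0_1)
  also have "\<dots> = of_nat s * R * E * (D * E) + L0 E * (D * E)" by (simp add: L0_D algebra_simps)
  finally have "L0 E = - (of_nat s * R) * E"
    unfolding D_E by (simp add: eq_neg_iff_add_eq_0 add.commute)
  then have E: "L0 (E ^ \<nu>) = of_nat \<nu> * (- (of_nat s * R)) * E ^ \<nu>"
    by (rule derivation_power_eq[rotated]) (rule L0_mult)
  let ?m = "fps2_monom 1 (M * q) (M * p) :: 'a fps2"
  have "wt (of_nat p) (- of_nat q) ?m = 0"
    by (rule fps2_eqI) (simp add: wt_monom)
  moreover have "wt 1 1 ?m = of_nat (M * (p + q)) * ?m"
    by (rule fps2_eqI) (auto simp: of_nat_mult_nth2 algebra_simps)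
  ultimately have "L0 ?m = R * (of_nat (\<nu> * s) * ?m)"
    by (simp only: L0_def \<nu>s add_0)
  then show ?thesis
    by (simp add: Z_def L0_mult E algebra_simps)
qed

text \<open>The perturbation changes only the y-equation, so its first-order effect on
  \<open>Z\<close> is this derivative. Euler's relation expresses \<nu> times the y-weight of
  \<open>C\<close> through \<open>R\<close> and \<open>C\<close>, and the terms in \<open>C\<close>
  then cancel.\<close>

lemma wt_y_Z: "wt 0 1 Z = of_nat M * (of_nat p + R) * Z * E"
proof -
  have "0 = (wt 0 1 D * E + D * wt 0 1 E) * E" using wt_mult[of 0 1 D E] by (simp add: D_E wt_1)
  also have "\<dots> = - (wt 0 1 C * E) * E + wt 0 1 E * (D * E)" by (simp add: wt_diff wt_1 algebra_simps)
  finally have "wt 0 1 E = (wt 0 1 C * E) * E"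
    unfolding D_E by simp
  then have E: "wt 0 1 (E ^ \<nu>) = of_nat \<nu> * (wt 0 1 C * E) * E ^ \<nu>"
    by (rule derivation_power_eq[rotated]) (rule wt_mult)
  let ?m = "fps2_monom 1 (M * q) (M * p) :: 'a fps2"
  have m: "wt 0 1 ?m = of_nat (M * p) * ?m"
    by (simp add: wt_monom of_nat_eq_monom fps2_monom_mult)
  have C: "of_nat \<nu> * wt 0 1 C = of_nat M * (R + of_nat p * C)"
  proof (rule fps2_eqI)
    fix i j
    show "(of_nat \<nu> * wt 0 1 C) $ i $ j = (of_nat M * (R + of_nat p * C)) $ i $ j"
    proof (cases "i + j = s")
      case True
      have "of_nat \<nu> * of_nat s = (of_nat M * (of_nat p + of_nat q) :: 'a)"
        using \<nu>s by (metis of_nat_add of_nat_mult)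
      then have \<nu>: "of_nat \<nu> = (of_nat M * (of_nat p + of_nat q) / of_nat s :: 'a)"
        using s_pos by (simp add: field_simps)
      have i: "of_nat i = (of_nat s - of_nat j :: 'a)"
        using True by (metis add_diff_cancel_right' of_nat_add)
      show ?thesis
        using s_pos by (simp add: of_nat_mult_nth2 R_def \<nu> i divide_simps) (simp add: algebra_simps)
    next
      case False
      then show ?thesis using homog_C homog_R by (simp add: homog_def of_nat_mult_nth2)
    qed
  qed
  have "wt 0 1 Z = of_nat M * of_nat p * Z + (of_nat \<nu> * wt 0 1 C) * Z * E"
    by (simp add: Z_def wt_mult m E algebra_simps)
  also have "of_nat M * of_nat p * Z = of_nat M * of_nat p * Z * (D * E)"
    by (simp only: D_E mult_1_right)
  also have "of_nat M * of_nat p * Z * (D * E) + (of_nat \<nu> * wt 0 1 C) * Z * E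
      = of_nat M * of_nat p * Z * (D * E) + (of_nat M * (R + of_nat p * C)) * Z * E"
    unfolding C ..
  also have "\<dots> = of_nat M * (of_nat p + R) * Z * E"
    by (simp add: algebra_simps)
  finally show ?thesis .
qed

text \<open>The \<open>m\<close>-th first-order Melnikov coefficient: up to the factor
  \<open>M\<close> it is the residue \<open>coeffJ (m + 1)\<close> of \<open>S * wt 0 1 Z\<close>.
  The factor \<open>E\<close> is kept apart since \<open>m * \<nu> - 1\<close> may be 0.\<close>

definition melnikov :: "nat \<Rightarrow> 'a" where
  "melnikov m = (S * (of_nat p + R) * D ^ (m * \<nu> - 1) * E) $ (m * M * q) $ (m * M * p)"

text \<open>Multiplication by \<open>Z ^ r\<close> shifts the index of the residue by
  \<open>r\<close>: its monomial moves the exponent and its powers of \<open>E\<close> cancel powers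
  of \<open>D\<close>. For \<open>r \<ge> m\<close> at most the constant term could contribute, and
  \<open>S\<close> has none.\<close>

lemma coeffJ_Z_power:
  assumes r: "0 < r"
  shows "coeffJ m (S * wt 0 1 (Z ^ r)) = (if r < m then of_nat (r * M) * melnikov (m - r) else 0)"
proof -
  have "wt 0 1 (Z ^ r) = of_nat r * (of_nat M * (of_nat p + R) * E) * Z ^ r"
    by (rule derivation_power_eq) (simp_all add: wt_mult wt_y_Z algebra_simps)
  moreover have "Z ^ r = fps2_monom 1 (r * M * q) (r * M * p) * E ^ (r * \<nu>)"
    by (simp add: Z_def power_mult_distrib fps2_monom_power mult.assoc power_mult[symmetric] mult.commute[of r \<nu>])
  ultimately have eq: "D ^ (m * \<nu> - 1) * (S * wt 0 1 (Z ^ r)) = fps2_monom 1 (r * M * q) (r * M * p) *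
      (of_nat (r * M) * (S * (of_nat p + R) * (D ^ (m * \<nu> - 1) * E ^ (r * \<nu>)) * E))"
    by (simp add: algebra_simps)
  show ?thesis
  proof (cases "r < m")
    case True
    define k where "k = m - r"
    have m: "m = r + k" "0 < k" using True by (simp_all add: k_def)
    have "m * \<nu> - 1 = (k * \<nu> - 1) + r * \<nu>"
      using m \<nu>_pos by (simp add: algebra_simps)
    then have "D ^ (m * \<nu> - 1) * E ^ (r * \<nu>) = D ^ (k * \<nu> - 1) * (D * E) ^ (r * \<nu>)"
      by (simp add: power_add power_mult_distrib)
    then show ?thesis
      unfolding coeffJ_def eq
      using True by (simp add: D_E fps2_monom_mult_nth of_nat_mult_nth2 melnikov_def k_def diff_mult_distrib
          del: of_nat_mult)
  next
    case False
    have "(of_nat (r * M) * (S * (of_nat p + R) * (D ^ (m * \<nu> - 1) * E ^ (r * \<nu>)) * E)) $ 0 $ 0 = 0"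
      using homog_S s_pos by (simp add: fps2_mult_nth homog_def of_nat_mult_nth2 mult.assoc del: of_nat_mult)
    moreover have "m * M * q \<le> r * M * q" "m * M * p \<le> r * M * p" using False by simp_all
    ultimately show ?thesis
      unfolding coeffJ_def eq fps2_monom_mult_nth using False by auto
  qed
qed

lemma M_dvd: "int s dvd int k * int (p + q) \<Longrightarrow> M dvd k"
proof -
  assume "int s dvd int k * int (p + q)"
  then have "M * d dvd (k * \<nu>) * d" by (simp add: s_eq pq_eq mult.assoc flip: of_nat_mult)
  then have "M dvd k * \<nu>" using d_pos by simp
  then show "M dvd k" using coprime_M\<nu> by (simp add: coprime_dvd_mult_left_iff)
qed

text \<open>The term with \<open>R\<close> raises degrees, so the lowest part of a first integral is
  annihilated by \<open>wt p (- q)\<close> and consists of a power of \<open>x^q y^p\<close>. The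
  grading makes its exponent a multiple of \<open>M\<close>, so a multiple of a power of
  \<open>Z\<close> removes it.\<close>

lemma first_integral_step:
  assumes T: "L0 T = 0" "supp_mod (int s) 0 T" "low h T"
  shows "low (Suc h) T \<or> (\<exists>r t. h = r * M * (p + q) \<and> low (Suc h) (T - fps2_monom t 0 0 * Z ^ r))"
proof (cases "low (Suc h) T")
  case False
  then obtain i j where ij: "i + j = h" "T $ i $ j \<noteq> 0"
    using T(3) unfolding low_def by (metis less_Suc_eq)
  have pq: "p * i' = q * j'" if "i' + j' = h" "T $ i' $ j' \<noteq> 0" for i' j'
  proof -
    have "low (s + h) (R * wt 1 1 T)" by (intro low_mult homog_low homog_R low_wt T)
    then have "(R * wt 1 1 T) $ i' $ j' = 0" using that s_pos by (auto intro: lowD)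
    moreover have "L0 T $ i' $ j' = 0" using T(1) by simp
    ultimately have "(of_nat i' * of_nat p - of_nat j' * of_nat q) * T $ i' $ j' = 0"
      by (simp add: L0_def)
    then have "of_nat (p * i') = (of_nat (q * j') :: 'a)" using that by (simp add: mult.commute)
    then show ?thesis by (simp only: of_nat_eq_iff)
  qed
  have "q dvd p * i" using pq[OF ij] by simp
  then have "q dvd i" using coprime_pq by (simp add: coprime_dvd_mult_right_iff coprime_commute)
  then obtain k where k: "i = k * q" by (metis dvd_def mult.commute)
  have "q * j = q * (k * p)" using pq[OF ij] k by (auto simp: mult_ac)
  then have k': "j = k * p" using q_pos by simp
  have "int s dvd int i + int j - 0" using T(2) ij(2) by (rule supp_modD)
  then have "int s dvd int k * int (p + q)" by (simp add: k k' algebra_simps)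
  then obtain r where r: "k = r * M" by (metis M_dvd dvd_def mult.commute)
  define t where "t = T $ i $ j"
  have lead: "lead 1 (Z ^ r) i j"
    using lead_power[OF lead_Z, of r] by (simp add: k k' r mult.assoc)
  have "(T - fps2_monom t 0 0 * Z ^ r) $ a $ b = 0" if "a + b < Suc h" for a b
  proof -
    have Z: "(fps2_monom t 0 0 * Z ^ r) $ a $ b = (if a = i \<and> b = j then t else 0)"
      using lead_nth[OF lead, of a b] that ij by (auto simp: fps2_monom_mult_nth)
    show ?thesis
    proof (cases "T $ a $ b = 0")
      case True
      then show ?thesis using Z ij by (auto simp: t_def)
    next
      case False
      then have ab: "a + b = h" using lowD[OF T(3), of a b] that by linarith
      have "p * a + p * b = p * i + p * j" using ab ij by (metis distrib_left)
      then have "(q + p) * b = (q + p) * j"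
        using pq[OF ab False] pq[OF ij] by (simp add: algebra_simps)
      then have "b = j" using p_pos by simp
      moreover from this have "a = i" using ab ij by simp
      ultimately show ?thesis using Z by (simp add: t_def)
    qed
  qed
  then have "low (Suc h) (T - fps2_monom t 0 0 * Z ^ r)" by (simp add: low_def)
  moreover have "h = r * M * (p + q)" using ij k k' r by (simp add: algebra_simps)
  ultimately show ?thesis by blast
qed simp

text \<open>Powers \<open>Z ^ r\<close> with \<open>r \<ge> 2\<close> are peeled off one after
  another; each contributes zero or a multiple of a Melnikov coefficient of index below
  \<open>m\<close>. Once the order exceeds the degree of the target monomial nothing is left, so the
  recursion ends.\<close>

lemma coeffJ_higher_first_integral:
  assumes b: "\<And>i. 0 < i \<Longrightarrow> i < m \<Longrightarrow> melnikov i = 0"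
    and "L0 T = 0" "supp_mod (int s) 0 T" "low h T" "M * (p + q) < h"
  shows "coeffJ (m + 1) (S * wt 0 1 T) = 0"
  using assms(2-)
proof (induction "(m + 1) * M * (p + q) + 1 - h" arbitrary: h T rule: less_induct)
  case less
  show ?case
  proof (cases "(m + 1) * M * (p + q) < h")
    case True
    have "low h (D ^ ((m + 1) * \<nu> - 1) * (S * wt 0 1 T))"
      by (intro low_mult_right low_wt less.prems)
    then show ?thesis
      unfolding coeffJ_def by (rule lowD) (use True in \<open>simp add: algebra_simps\<close>)
  next
    case False
    then have dec: "(m + 1) * M * (p + q) + 1 - Suc h < (m + 1) * M * (p + q) + 1 - h" by simp
    consider "low (Suc h) T"
      | r t where "h = r * M * (p + q)" "low (Suc h) (T - fps2_monom t 0 0 * Z ^ r)"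
      using first_integral_step[OF less.prems(1,2,3)] by blast
    then show ?thesis
    proof cases
      case 1
      then show ?thesis using less.hyps[OF dec less.prems(1,2)] less.prems(4) by simp
    next
      case 2
      have "1 * (M * (p + q)) < r * (M * (p + q))" using less.prems(4) 2(1) by (simp add: mult.assoc)
      then have r: "1 < r" by (simp only: mult_less_cancel2)
      let ?t = "fps2_monom t 0 0"
      have t: "L0 (?t * F) = ?t * L0 F" for F
        by (simp add: L0_def wt_mult wt_monom algebra_simps)
           (simp add: fps2_monom_def fps_zero_def[symmetric])
      have "L0 (Z ^ r) = of_nat r * 0 * Z ^ r"
        by (rule derivation_power_eq) (simp_all add: L0_mult L0_Z)
      then have "L0 (T - ?t * Z ^ r) = 0" using less.prems(1) by (simp add: L0_diff t)
      moreover have "supp_mod (int s) 0 ?t" by (rule supp_mod_monom) simp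
      from supp_mod_mult[OF this supp_mod_power[OF supp_Z, of r]]
      have "supp_mod (int s) 0 (?t * Z ^ r)" by simp
      then have "supp_mod (int s) 0 (T - ?t * Z ^ r)"
        by (intro supp_mod_diff less.prems)
      ultimately have 1: "coeffJ (m + 1) (S * wt 0 1 (T - ?t * Z ^ r)) = 0"
        using 2(2) less.prems(4) by (intro less.hyps[OF dec]) auto
      have "melnikov (m + 1 - r) = 0" if "r < m + 1" using b[of "m + 1 - r"] r that by simp
      then have 2: "coeffJ (m + 1) (S * wt 0 1 (Z ^ r)) = 0"
        using coeffJ_Z_power[of r "m + 1"] r by simp
      have "wt 0 1 (?t * Z ^ r) = ?t * wt 0 1 (Z ^ r)"
        by (rule fps2_eqI) (simp add: fps2_monom_mult_nth)
      then have "S * wt 0 1 T = S * wt 0 1 (T - ?t * Z ^ r) + ?t * (S * wt 0 1 (Z ^ r))"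
        by (simp add: wt_diff algebra_simps)
      moreover have "coeffJ (m + 1) (?t * F) = t * coeffJ (m + 1) F" for F
        by (simp add: coeffJ_def mult.left_commute[of _ ?t] fps2_monom_mult_nth)
      ultimately show ?thesis using 1 2 by (simp add: coeffJ_add)
    qed
  qed
qed

text \<open>A first integral with the leading term of \<open>Z\<close> differs from \<open>Z\<close>
  only in higher order, where all contributions vanish.\<close>

lemma coeffJ_first_integral:
  assumes b: "\<And>i. 0 < i \<Longrightarrow> i < m \<Longrightarrow> melnikov i = 0" and m: "0 < m"
    and T: "L0 T = 0" "supp_mod (int s) 0 T" "lead 1 T (M * q) (M * p)"
  shows "coeffJ (m + 1) (S * wt 0 1 T) = of_nat M * melnikov m"
proof -
  have "low (M * q + M * p + 1) (T - Z)"
    using low_diff[OF T(3)[unfolded lead_def] lead_Z[unfolded lead_def]] by simp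
  then have "coeffJ (m + 1) (S * wt 0 1 (T - Z)) = 0"
    by (intro coeffJ_higher_first_integral[OF b])
       (use T L0_Z supp_Z in \<open>auto simp: L0_diff supp_mod_diff algebra_simps\<close>)
  moreover have "coeffJ (m + 1) (S * wt 0 1 (Z ^ 1)) = of_nat M * melnikov m"
    using m by (subst coeffJ_Z_power) auto
  ultimately show ?thesis
    by (simp add: wt_diff right_diff_distrib coeffJ_diff)
qed

end

section \<open>First-order perturbation of a centre\<close>

lemma deriv_x_x_var: "deriv_x A * x_var = wt 1 0 A"
  using fps2_monom_mult_nth[of 1 1 0 "deriv_x A"]
  by (intro fps2_eqI)
     (auto simp: x_var_eq_monom mult.commute[of _ "fps2_monom _ _ _"] deriv_x_nth Suc_le_eq simp del: of_nat_Suc)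

lemma deriv_y_y_var: "deriv_y A * y_var = wt 0 1 A"
  using fps2_monom_mult_nth[of 1 0 1 "deriv_y A"]
  by (intro fps2_eqI)
     (auto simp: y_var_eq_monom mult.commute[of _ "fps2_monom _ _ _"] deriv_y_nth Suc_le_eq simp del: of_nat_Suc)

lemma wt_split: "wt (of_nat a) (- of_nat b) F = of_nat a * wt 1 0 F - of_nat b * wt 0 1 F"
  by (rule fps2_eqI) (simp add: of_nat_mult_nth2 algebra_simps)

section \<open>Expansion to first order in the perturbation parameter\<close>

definition lift2 :: "'a::comm_ring_1 fps2 \<Rightarrow> 'a fps fps2" where
  "lift2 F = Abs_fps (\<lambda>i. Abs_fps (\<lambda>j. fps_const (F $ i $ j)))"

lemma lift2_nth [simp]: "lift2 F $ i $ j = fps_const (F $ i $ j)"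
  by (simp add: lift2_def)

definition lin_part :: "'a::comm_ring_1 fps fps2 \<Rightarrow> 'a fps2" where
  "lin_part F = Abs_fps (\<lambda>i. Abs_fps (\<lambda>j. F $ i $ j $ 1))"

lemma lin_part_nth [simp]: "lin_part F $ i $ j = F $ i $ j $ 1"
  by (simp add: lin_part_def)

global_interpretation const_part: coeff_hom "\<lambda>f :: 'a::comm_ring_1 fps. f $ 0"
  defines const_part1 = const_part.map1 and const_part2 = const_part.map2
  by unfold_locales simp_all

lemma lin_part_mult: "lin_part (F * G) = const_part2 F * lin_part G + lin_part F * const_part2 G"
  by (rule fps2_eqI) (simp add: fps2_mult_nth fps_sum_nth fps_mult_nth_1 sum.distrib)

lemma lin_part_add: "lin_part (F + G) = lin_part F + lin_part G"
  by (rule fps2_eqI) simp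

lemma lin_part_of_nat: "lin_part (of_nat m) = 0"
  by (rule fps2_eqI) (simp add: of_nat_eq_monom fps_of_nat[symmetric])

lemma lin_part_diff: "lin_part (F - G) = lin_part F - lin_part G"
  by (rule fps2_eqI) simp

lemma lin_part_wt: "lin_part (wt (of_nat a) (of_nat b) F) = wt (of_nat a) (of_nat b) (lin_part F)"
  by (rule fps2_eqI) (simp flip: fps_of_nat of_nat_mult of_nat_add)

lemma const_part_wt: "const_part2 (wt (of_nat a) (of_nat b) F) = wt (of_nat a) (of_nat b) (const_part2 F)"
  by (rule fps2_eqI) (simp flip: fps_of_nat)

text \<open>When \<open>f\<close> vanishes modulo \<epsilon>, the first-order part sees
  \<open>W\<close> only modulo \<epsilon>.\<close>

lemma lin_part_subst_fps:
  assumes "\<And>k. f $ k $ 0 = 0"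
  shows "lin_part (subst_fps f W) = subst_fps (Abs_fps (\<lambda>k. f $ k $ 1)) (const_part2 W)"
proof (rule fps2_eqI)
  fix i j
  have "(W ^ k) $ i $ j $ 0 = (const_part2 W ^ k) $ i $ j" for k
    by (simp flip: const_part.map2_power)
  then show "lin_part (subst_fps f W) $ i $ j = subst_fps (Abs_fps (\<lambda>k. f $ k $ 1)) (const_part2 W) $ i $ j"
    using assms by (simp add: subst_fps_def fps_sum_nth fps_mult_nth_1)
qed

context radial_system
begin

text \<open>The perturbation parameter \<open>\<epsilon>\<close> is \<open>fps_X\<close>, in the coefficient ring \<open>'a fps\<close>.\<close>

definition pert_P :: "'a fps fps2" where
  "pert_P = x_var * lift2 R"

definition pert_Q :: "'a fps fps2" where
  "pert_Q = y_var * (lift2 R + fps2_monom fps_X 0 0 * lift2 S)"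

lemma low_supp_pert:
  assumes "F \<in> {lift2 R, lift2 R + fps2_monom fps_X 0 0 * lift2 S}"
  shows "low 1 F" "supp_mod (int s) 0 F"
proof -
  have F: "F $ i $ j = 0" if "i + j \<noteq> s" for i j
    using assms that homog_R homog_S by (auto simp: homog_def fps2_monom_mult_nth)
  then show "low 1 F" using s_pos by (simp add: low_def)
  show "supp_mod (int s) 0 F"
    using F by (intro homog_supp_mod) (simp add: homog_def)
qed

sublocale res: resonant_system p q pert_P pert_Q
proof
  fix z :: int assume "z \<noteq> 0"
  then have "of_int z * fps_const (1 / of_int z) = (1 :: 'a fps)"
    by (simp flip: fps_of_int)
  then show "\<exists>r :: 'a fps. of_int z * r = 1" by blast
next
  have x: "low 1 (x_var :: 'a fps fps2)" unfolding x_var_eq_monom by (simp add: low_def)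
  have y: "low 1 (y_var :: 'a fps fps2)" unfolding y_var_eq_monom by (simp add: low_def)
  have "low (1 + 1) pert_P" "low (1 + 1) pert_Q"
    unfolding pert_P_def pert_Q_def
    by (rule low_mult[OF x low_supp_pert(1)] low_mult[OF y low_supp_pert(1)]; simp)+
  then show "low 2 pert_P" "low 2 pert_Q" by (simp_all add: numeral_2_eq_2)
qed (fact p_pos q_pos coprime_pq)+

lemma supp_mod_pert: "supp_mod (int s) 1 pert_P" "supp_mod (int s) 1 pert_Q"
proof -
  have x: "supp_mod (int s) 1 (x_var :: 'a fps fps2)"
    unfolding x_var_eq_monom by (rule supp_mod_monom) simp
  have y: "supp_mod (int s) 1 (y_var :: 'a fps fps2)"
    unfolding y_var_eq_monom by (rule supp_mod_monom) simp
  have "supp_mod (int s) (1 + 0) pert_P" "supp_mod (int s) (1 + 0) pert_Q"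
    unfolding pert_P_def pert_Q_def
    by (rule supp_mod_mult[OF x low_supp_pert(2)] supp_mod_mult[OF y low_supp_pert(2)]; simp)+
  then show "supp_mod (int s) 1 pert_P" "supp_mod (int s) 1 pert_Q" by simp_all
qed

lemma lie_eq: "res.lie A = wt 1 0 A * (of_nat p + lift2 R)
    + wt 0 1 A * (- of_nat q + (lift2 R + fps2_monom fps_X 0 0 * lift2 S))"
proof -
  have "res.lie A = (deriv_x A * x_var) * (of_nat p + lift2 R)
    + (deriv_y A * y_var) * (- of_nat q + (lift2 R + fps2_monom fps_X 0 0 * lift2 S))"
    unfolding res.lie_def unfolding pert_P_def pert_Q_def by (simp add: algebra_simps)
  then show ?thesis by (simp only: deriv_x_x_var deriv_y_y_var)
qed

lemma lie_mult: "res.lie (F * G) = res.lie F * G + F * res.lie G"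
  by (simp add: lie_eq wt_mult algebra_simps)

lemma parts:
  "const_part2 (lift2 F) = F" "lin_part (lift2 F) = 0"
  "const_part2 (fps2_monom fps_X 0 0) = 0" "lin_part (fps2_monom fps_X 0 0) = 1"
  by (rule fps2_eqI; auto)+

lemma wt_parts:
  "const_part2 (wt 1 0 A) = wt 1 0 (const_part2 A)" "const_part2 (wt 0 1 A) = wt 0 1 (const_part2 A)"
  "lin_part (wt 1 0 A) = wt 1 0 (lin_part A)" "lin_part (wt 0 1 A) = wt 0 1 (lin_part A)"
  using const_part_wt[of 1 0 A] const_part_wt[of 0 1 A] lin_part_wt[of 1 0 A] lin_part_wt[of 0 1 A]
  by simp_all

lemma L0_eq: "L0 A = wt 1 0 A * (of_nat p + R) + wt 0 1 A * (- of_nat q + R)"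
proof -
  have "wt 1 1 A = wt 1 0 A + wt 0 1 A" by (rule fps2_eqI) (simp add: algebra_simps)
  then show ?thesis by (simp add: L0_def wt_split algebra_simps)
qed

lemma const_part_lie: "const_part2 (res.lie A) = L0 (const_part2 A)"
  unfolding lie_eq L0_eq
  by (simp add: const_part.map2_add const_part.map2_mult const_part.map2_diff const_part.map2_of_nat
      parts wt_parts)

lemma lin_part_lie: "lin_part (res.lie A) = L0 (lin_part A) + S * wt 0 1 (const_part2 A)"
  unfolding lie_eq L0_eq
  by (simp add: lin_part_add lin_part_mult lin_part_diff lin_part_of_nat
      const_part.map2_add const_part.map2_mult const_part.map2_diff const_part.map2_of_nat
      parts wt_parts algebra_simps)

text \<open>\<open>V\<close> supplies one factor \<open>(x^q y^p)^M\<close>, hence the index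
  \<open>m + 1\<close>; powers of \<open>D\<close> have leading term 1.\<close>

lemma coeffJ_subst_fps:
  assumes W: "lead 1 W q p" and V: "lead 1 V (M * q) (M * p)" and f: "\<And>i. i < m * M \<Longrightarrow> f $ i = 0"
  shows "coeffJ (m + 1) (V * subst_fps f W) = f $ (m * M)"
proof -
  have "lead (1 * (1 * f $ (m * M))) (D ^ ((m + 1) * \<nu> - 1) * (V * subst_fps f W))
      (((m + 1) * \<nu> - 1) * 0 + (M * q + m * M * q)) (((m + 1) * \<nu> - 1) * 0 + (M * p + m * M * p))"
    using lead_power[OF lead_D, of "(m + 1) * \<nu> - 1"]
    by (intro lead_mult V lead_subst_fps[OF W p_pos f]) simp_all
  from lead_nth[OF this, of "(m + 1) * M * q" "(m + 1) * M * p"]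
  show ?thesis by (simp add: coeffJ_def algebra_simps)
qed

text \<open>The power \<open>V\<close> of the resonant monomial in the normal coordinates changes
  along the flow by a multiple of \<open>V * (u - v)(W)\<close>. Taking residues of the parts of
  order 0 and 1 in \<epsilon> isolates the first nonzero coefficient of \<open>u - v\<close>, since
  residues of \<open>L0\<close> vanish.\<close>

lemma saddle_values:
  assumes norm: "is_normalization p q (of_nat p * x_var + pert_P) (- of_nat q * y_var + pert_Q) X Y u v"
  shows saddle_const: "u $ k $ 0 = v $ k $ 0"
    and saddle_lin_eq_0: "(\<And>i. 0 < i \<Longrightarrow> i < m \<Longrightarrow> melnikov i = 0) \<Longrightarrow> k < m * M \<Longrightarrow> u $ k $ 1 = v $ k $ 1"
    and saddle_lin: "(\<And>i. 0 < i \<Longrightarrow> i < m \<Longrightarrow> melnikov i = 0) \<Longrightarrow> 0 < m \<Longrightarrow>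
      of_nat (p * q) * (u $ (m * M) $ 1 - v $ (m * M) $ 1) = melnikov m"
proof -
  note h = norm[unfolded res.is_normalization_iff]
  note supp = res.normalization_supp[OF supp_mod_pert norm]
  define W where "W = X ^ q * Y ^ p"
  define V where "V = W ^ M"
  define W0 where "W0 = const_part2 W"
  define V0 where "V0 = const_part2 V"
  define f where "f = u - v"
  define f0 where "f0 = const_part1 f"
  define f1 where "f1 = Abs_fps (\<lambda>k. f $ k $ 1)"
  have leadW: "lead 1 W q p"
    unfolding W_def by (rule res.lead_monomial_W; use h in \<open>simp add: res.normalized_def\<close>)
  have leadV: "lead 1 V (M * q) (M * p)"
    using lead_power[OF leadW, of M] by (simp add: V_def)
  have const_lead: "lead 1 (const_part2 F) a b" if "lead 1 F a b" for F :: "'a fps fps2" and a b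
    using that by (auto simp: lead_iff)
  have W0: "lead 1 W0 q p" and V0: "lead 1 V0 (M * q) (M * p)"
    using leadW leadV by (simp_all add: W0_def V0_def const_lead)
  have suppW: "supp_mod (int s) (int (p + q)) W"
    using supp_mod_mult[OF supp_mod_power[OF supp(1), of q] supp_mod_power[OF supp(2), of p]]
    by (simp add: W_def add.commute)
  have "supp_mod (int s) (int M * int (p + q)) V"
    unfolding V_def by (intro supp_mod_power suppW)
  moreover have "int M * int (p + q) = int \<nu> * int s" using \<nu>s by (metis of_nat_mult)
  ultimately have V_supp: "supp_mod (int s) (int \<nu> * int s) V" by simp
  have suppV0: "supp_mod (int s) 0 V0"
  proof (rule supp_modI)
    fix i j assume "V0 $ i $ j \<noteq> 0"
    then have "V $ i $ j \<noteq> 0" by (auto simp: V0_def)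
    from supp_modD[OF V_supp this] have "int s dvd (int i + int j - int \<nu> * int s) + int \<nu> * int s"
      by (rule dvd_add) simp
    then show "int s dvd int i + int j - 0" by simp
  qed
  have f_supp: "M dvd k" if "f $ k \<noteq> 0" for k
  proof -
    have "u $ k \<noteq> 0 \<or> v $ k \<noteq> 0" using that by (auto simp: f_def)
    then show ?thesis using supp(3,4)[of k] M_dvd[of k] by blast
  qed
  have f_0: "f $ 0 = 0" using h by (simp add: f_def)
  \<comment> \<open>\<open>X ^ q\<close> has cofactor \<open>p q u(W)\<close> and
    \<open>Y ^ p\<close> has cofactor \<open>- p q v(W)\<close>; they add up in \<open>W\<close>,
    and \<open>V = W ^ M\<close> gains the factor \<open>M\<close>.\<close>
  have lieV: "res.lie V = of_nat (M * p * q) * (V * subst_fps f W)"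
  proof -
    have X: "res.lie X = (of_nat p * subst_fps u W) * X" and Y: "res.lie Y = (- of_nat q * subst_fps v W) * Y"
      using h by (simp_all add: res.defect_def W_def[symmetric] eq_neg_iff_add_eq_0 algebra_simps)
    have "res.lie W = (of_nat (p * q) * subst_fps f W) * W"
      unfolding W_def lie_mult
        derivation_power_eq[OF lie_mult X] derivation_power_eq[OF lie_mult Y] f_def subst_fps_diff
      by (simp add: W_def[symmetric] algebra_simps)
    from derivation_power_eq[OF lie_mult this, of M]
    show ?thesis by (simp add: V_def algebra_simps)
  qed
  have Mpq: "of_nat (M * p * q) \<noteq> (0 :: 'a)" using M_pos p_pos q_pos by simp
  have coeffJ_scale: "coeffJ m (of_nat c * F) = of_nat c * coeffJ m F" for m c F
    by (simp add: coeffJ_def mult.left_commute[of _ "of_nat c"] of_nat_mult_nth2)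
  have const_eq: "L0 V0 = of_nat (M * p * q) * (V0 * subst_fps f0 W0)"
    using arg_cong[OF lieV, of const_part2]
    by (simp only: const_part_lie const_part.map2_mult const_part.map2_of_nat const_part.map2_subst_fps
        V0_def W0_def f0_def)
  have f0: "f $ k $ 0 = 0" for k
  proof (induction k rule: less_induct)
    case (less k)
    show ?case
    proof (cases "k = 0 \<or> \<not> M dvd k")
      case True
      then show ?thesis using f_0 f_supp[of k] by fastforce
    next
      case False
      then obtain m where k: "k = m * M" by (metis dvd_def mult.commute)
      have "0 = coeffJ (m + 1) (L0 V0)" by (simp add: coeffJ_L0)
      also have "\<dots> = of_nat (M * p * q) * f0 $ (m * M)"
        unfolding const_eq coeffJ_scale
        by (subst coeffJ_subst_fps[OF W0 V0]) (use less k in \<open>auto simp: f0_def\<close>)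
      finally show ?thesis using Mpq k by (simp add: f0_def)
    qed
  qed
  then show "u $ k $ 0 = v $ k $ 0" for k by (simp add: f_def)
  have subst0: "const_part2 (subst_fps f W) = 0"
    by (rule fps2_eqI) (simp add: const_part.map2_subst_fps subst_fps_def fps_sum_nth f0)
  \<comment> \<open>\<open>V0\<close> is a first integral of the unperturbed system with the same
    leading term as \<open>Z\<close>, though possibly different from \<open>Z\<close>.\<close>
  have L0V0: "L0 V0 = 0"
    using arg_cong[OF lieV, of const_part2]
    by (simp only: const_part_lie const_part.map2_mult const_part.map2_of_nat subst0 V0_def[symmetric] mult_zero_right)
  have lin_eq: "L0 (lin_part V) + S * wt 0 1 V0 = of_nat (M * p * q) * (V0 * subst_fps f1 W0)"
    using arg_cong[OF lieV, of lin_part]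
    by (simp only: lin_part_lie lin_part_mult[of "of_nat _"] lin_part_mult[of V] lin_part_of_nat subst0
        const_part.map2_of_nat const_part.map2_mult
        lin_part_subst_fps[OF f0] V0_def[symmetric] W0_def[symmetric] f1_def[symmetric]
        mult_zero_right mult_zero_left add_0_right)
  have step: "of_nat (p * q) * f1 $ (m * M) = melnikov m"
    if "\<And>i. 0 < i \<Longrightarrow> i < m \<Longrightarrow> melnikov i = 0" "0 < m" "\<And>i. i < m * M \<Longrightarrow> f1 $ i = 0" for m
  proof -
    \<comment> \<open>The unknown first-order part of \<open>V\<close> enters only through
      \<open>L0\<close>, so the residue removes it.\<close>
    have "of_nat M * melnikov m = coeffJ (m + 1) (L0 (lin_part V) + S * wt 0 1 V0)"
      using coeffJ_first_integral[OF that(1,2) L0V0 suppV0 V0] by (simp add: coeffJ_add coeffJ_L0)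
    also have "\<dots> = of_nat (M * p * q) * f1 $ (m * M)"
      unfolding lin_eq coeffJ_scale by (subst coeffJ_subst_fps[OF W0 V0 that(3)]) auto
    finally show ?thesis using M_pos by simp
  qed
  have f1_0: "f1 $ k = 0" if "\<And>i. 0 < i \<Longrightarrow> i < m \<Longrightarrow> melnikov i = 0" "k < m * M" for k m
    using that(2)
  proof (induction k rule: less_induct)
    case (less k)
    show ?case
    proof (cases "k = 0 \<or> \<not> M dvd k")
      case True
      then show ?thesis using f_0 f_supp[of k] by (fastforce simp: f1_def)
    next
      case False
      then obtain r where k: "k = r * M" by (metis dvd_def mult.commute)
      then have r: "r < m" "0 < r" using False less.prems by auto
      have "of_nat (p * q) * f1 $ (r * M) = melnikov r"
        by (rule step) (use r k less that(1) in auto)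
      then show ?thesis using that(1) r k p_pos q_pos by simp
    qed
  qed
  then show "u $ k $ 1 = v $ k $ 1"
    if "\<And>i. 0 < i \<Longrightarrow> i < m \<Longrightarrow> melnikov i = 0" "k < m * M" for k m
    using that f1_0[OF that] by (simp add: f1_def f_def)
  show "of_nat (p * q) * (u $ (m * M) $ 1 - v $ (m * M) $ 1) = melnikov m"
    if "\<And>i. 0 < i \<Longrightarrow> i < m \<Longrightarrow> melnikov i = 0" "0 < m" for m
    using step[OF that f1_0[OF that(1)]] by (simp add: f1_def f_def)
qed

end

section \<open>A family with two monomials\<close>

definition deg_le :: "nat \<Rightarrow> 'a::comm_ring_1 fps2 \<Rightarrow> bool" where
  "deg_le N F \<longleftrightarrow> (\<forall>i j. N < i + j \<longrightarrow> F $ i $ j = 0)"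

lemma deg_le_nth: "deg_le N F \<Longrightarrow> N < i + j \<Longrightarrow> F $ i $ j = 0"
  by (simp add: deg_le_def)

lemma deg_le_mono: "deg_le N F \<Longrightarrow> N \<le> N' \<Longrightarrow> deg_le N' F"
  by (simp add: deg_le_def)

lemma deg_le_add: "deg_le N F \<Longrightarrow> deg_le N G \<Longrightarrow> deg_le N (F + G)"
  by (simp add: deg_le_def)

lemma deg_le_1: "deg_le 0 1"
  by (simp add: deg_le_def)

lemma deg_le_mult:
  assumes "deg_le a F" "deg_le b G"
  shows "deg_le (a + b) (F * G)"
  unfolding deg_le_def
proof (intro allI impI)
  fix i j assume ij: "a + b < i + j"
  have "F $ s $ t * G $ (i - s) $ (j - t) = 0" if "s \<le> i" "t \<le> j" for s t
  proof (cases "a < s + t")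
    case False
    then have "b < (i - s) + (j - t)" using ij that by linarith
    then show ?thesis using deg_le_nth[OF assms(2)] by simp
  qed (simp add: deg_le_nth[OF assms(1)])
  then show "(F * G) $ i $ j = 0" by (simp add: fps2_mult_nth)
qed

lemma deg_le_power: "deg_le a F \<Longrightarrow> deg_le (k * a) (F ^ k)"
  by (induction k) (simp_all add: deg_le_1 deg_le_mult)

lemma homog_deg_le: "homog s F \<Longrightarrow> deg_le s F"
  by (simp add: homog_def deg_le_def)

lemma homog_minus: "homog s F \<Longrightarrow> homog s (- F)"
  by (simp add: homog_def)

lemma top_degree:
  assumes "homog s C"
  shows "deg_le (k * s) ((1 - C) ^ Suc k - (- C) ^ Suc k)"
proof (induction k)
  case 0
  then show ?case by (simp add: deg_le_1)
next
  case (Suc k)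
  have C: "deg_le s (- C)" using assms by (intro homog_deg_le homog_minus)
  have D: "deg_le s (1 - C)"
    using deg_le_add[OF deg_le_mono[OF deg_le_1, of s] C] by simp
  have "(1 - C) ^ Suc (Suc k) - (- C) ^ Suc (Suc k)
      = (- C) ^ Suc k + (1 - C) * ((1 - C) ^ Suc k - (- C) ^ Suc k)"
    by (simp add: algebra_simps)
  then show ?case
    using deg_le_power[OF C, of "Suc k"] deg_le_mult[OF D Suc] by (simp only: deg_le_add mult_Suc)
qed

lemma minus_one_power_nth: "((- 1) ^ k * F :: 'a::comm_ring_1 fps2) $ i $ j = (- 1) ^ k * F $ i $ j"
  by (induction k) (simp_all add: mult.assoc)

context radial_system
begin

text \<open>Up to the factor \<open>Suc N * s\<close>, \<open>R * D ^ N\<close> is the weight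
  derivative of \<open>D ^ Suc N\<close>. That derivation annihilates the target monomial, so it can
  be moved onto \<open>S\<close> by parts, and for degree reasons only the top part of
  \<open>D ^ Suc N\<close> is seen.\<close>

lemma melnikov_eq:
  assumes m: "0 < m" and N: "m * \<nu> = Suc (Suc N)"
  shows "of_nat (Suc N * s) * melnikov m
    = (- 1) ^ N * (wt (of_nat p) (- of_nat q) S * C ^ Suc N) $ (m * M * q) $ (m * M * p)"
proof -
  let ?i = "m * M * q" and ?j = "m * M * p" and ?\<delta> = "wt (of_nat p) (- of_nat q) :: 'a fps2 \<Rightarrow> 'a fps2"
  have ij: "?i + ?j = Suc (Suc N) * s"
    unfolding N[symmetric] using arg_cong[OF \<nu>s, of "\<lambda>k. m * k"] by (simp add: algebra_simps)
  have D: "deg_le s D"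
    using deg_le_add[OF deg_le_mono[OF deg_le_1, of s] homog_deg_le[OF homog_minus[OF homog_C]]] by simp
  have "deg_le (s + N * s) (S * D ^ N)"
    by (intro deg_le_mult deg_le_power D homog_deg_le homog_S)
  \<comment> \<open>The target monomial has degree \<open>(N + 2) * s\<close>, above that of
    \<open>S * D ^ N\<close>.\<close>
  then have low_part: "(S * D ^ N) $ ?i $ ?j = 0"
    by (rule deg_le_nth) (use ij s_pos in simp)
  have "melnikov m = (S * (of_nat p + R) * D ^ N * (D * E)) $ ?i $ ?j"
    unfolding melnikov_def N by (simp add: mult_ac)
  also have "S * (of_nat p + R) * D ^ N * (D * E) = of_nat p * (S * D ^ N) + S * (R * D ^ N)"
    unfolding D_E by (simp add: algebra_simps)
  finally have mel: "melnikov m = (S * (R * D ^ N)) $ ?i $ ?j"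
    using low_part by (simp add: of_nat_mult_nth2)
  have "?\<delta> D = of_nat s * R * (E * D)"
    by (simp only: wt_diff wt_1 wt_C mult.commute[of E] D_E) simp
  then have "?\<delta> (D ^ Suc N) = of_nat (Suc N) * (of_nat s * R * E) * D ^ Suc N"
    by (intro derivation_power_eq wt_mult) (simp only: mult.assoc)
  also have "\<dots> = of_nat (Suc N * s) * (R * D ^ N) * (D * E)"
    by (simp only: power_Suc of_nat_mult mult_ac)
  finally have \<delta>: "?\<delta> (D ^ Suc N) = of_nat (Suc N * s) * (R * D ^ N)" by (simp only: D_E mult_1_right)
  have "of_nat (Suc N * s) * melnikov m = (S * ?\<delta> (D ^ Suc N)) $ ?i $ ?j"
    unfolding \<delta> mel by (simp only: mult.left_commute[of S "of_nat _"] of_nat_mult_nth2)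
  also have "\<dots> = ?\<delta> (S * D ^ Suc N) $ ?i $ ?j - (?\<delta> S * D ^ Suc N) $ ?i $ ?j"
    by (simp only: wt_mult fps_add_nth add_diff_cancel_left')
  also have "?\<delta> (S * D ^ Suc N) $ ?i $ ?j = 0"
    by (simp only: wt_nth) (simp add: algebra_simps)
  also have "(?\<delta> S * D ^ Suc N) $ ?i $ ?j = (?\<delta> S * (- C) ^ Suc N) $ ?i $ ?j"
  proof -
    have "deg_le (s + N * s) (?\<delta> S * (D ^ Suc N - (- C) ^ Suc N))"
      using homog_S by (intro deg_le_mult top_degree homog_C homog_deg_le) (simp add: homog_def)
    then have "(?\<delta> S * (D ^ Suc N - (- C) ^ Suc N)) $ ?i $ ?j = 0"
      by (rule deg_le_nth) (use ij s_pos in simp)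
    then show ?thesis by (simp only: right_diff_distrib fps_sub_nth right_minus_eq)
  qed
  also have "\<dots> = (- 1) ^ Suc N * (?\<delta> S * C ^ Suc N) $ ?i $ ?j"
    unfolding power_minus[of C "Suc N"] mult.left_commute[of "?\<delta> S"] minus_one_power_nth ..
  finally show ?thesis by simp
qed

text \<open>The case left out by \<open>melnikov_eq\<close>: here the target has degree
  \<open>s\<close>, the order of \<open>S\<close>, so only the constant term \<open>p\<close> of the
  other factors counts.\<close>

lemma melnikov_eq_0:
  assumes "m * \<nu> = 1" and S: "S $ (M * q) $ (M * p) = 0"
  shows "melnikov m = 0"
proof -
  have m: "m = 1" "\<nu> = 1" using assms(1) by simp_all
  have Mq: "M * q + M * p = s" using \<nu>s m by (simp add: algebra_simps)
  have "lead (of_nat p * 1) ((of_nat p + R) * E) (0 + 0) (0 + 0)"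
    using homog_R s_pos by (intro lead_mult lead_E) (simp add: lead_iff homog_def of_nat_eq_monom)
  then have "low 1 ((of_nat p + R) * E - fps2_monom (of_nat p) 0 0)"
    by (simp add: lead_def)
  then have "low (s + 1) (S * ((of_nat p + R) * E - fps2_monom (of_nat p) 0 0))"
    by (rule low_mult[OF homog_low[OF homog_S]])
  from lowD[OF this, of "M * q" "M * p"] have "(S * ((of_nat p + R) * E)) $ (M * q) $ (M * p) = 0"
    using S Mq by (simp add: right_diff_distrib mult.commute[of S "fps2_monom _ _ _"]
        fps2_monom_mult_nth)
  then show ?thesis unfolding melnikov_def assms(1) by (simp add: m(1) mult.assoc)
qed

end


lemma binomial_ratio:
  assumes "0 < i" "i \<le> N"
  shows "i * (N - 1 choose i) = (N - i) * (N - 1 choose (i - 1))"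
proof -
  obtain j k where "i = Suc j" "N = Suc k" using assms by (cases i; cases N) auto
  then show ?thesis
    using binomial_absorption[of j k] binomial_absorb_comp[of k j] by simp
qed

text \<open>
  Writing \<open>z\<^sub>l = x\<^sup>s\<^sup>-\<^sup>l y\<^sup>l\<close>, \<open>C = z\<^sub>e + z\<^sub>e\<^sub>+\<^sub>K\<close>, and \<open>S\<close> is chosen so that its weight derivative is
  \<open>\<tau>\<^sub>1 z\<^sub>e\<^sub>-\<^sub>1 + \<tau>\<^sub>2 z\<^sub>e\<^sub>-\<^sub>1\<^sub>+\<^sub>K\<close>. The hypothesis \<open>p g = 1 + e (p + q)\<close> makes \<open>K\<close> prime to the step of the
  exponents, so that \<open>melnikov m\<close> can only be nonzero for \<open>m \<equiv> -d\<close> modulo \<open>K\<close>; the ratio of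
  \<open>\<tau>\<^sub>1\<close> and \<open>\<tau>\<^sub>2\<close> is the one for which \<open>m = K - d\<close> drops out and \<open>m = 2 K - d\<close> comes first.
\<close>

locale two_term_family =
  fixes p q s d M \<nu> e g K :: nat and ground :: "'a::field_char_0 itself"
  assumes pos: "0 < p" "0 < q" "coprime p q"
    and s_def: "s = M * d" and pq_def: "p + q = \<nu> * d" and coprime_M: "coprime M \<nu>"
    and bezout: "p * g = 1 + e * (p + q)" and e_pos: "0 < e"
    and K_def: "s = K + g" and K_large: "2 * p + 2 * q + 2 \<le> K"
begin

text \<open>The target y-exponent is \<open>m * M * p = m * step + m * \<nu> * e\<close>; the second
  summand is the share coming from the lower monomial of \<open>C\<close>.\<close>

definition step :: nat where "step = M * p - e * \<nu>"
text \<open>The binomial index that belongs to \<open>m = K - d\<close>, by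
  \<open>solution0\<close>; \<open>N0\<close> is the corresponding value of
  \<open>m * \<nu>\<close>.\<close>

definition i0 :: nat where "i0 = step - p"
definition N0 :: nat where "N0 = (K - d) * \<nu>"
definition mono :: "'a \<Rightarrow> nat \<Rightarrow> 'a fps2" where "mono c l = fps2_monom c (s - l) l"
definition weight :: "nat \<Rightarrow> 'a" where "weight l = of_nat (s - l) * of_nat p - of_nat l * of_nat q"
text \<open>With \<open>\<tau>2\<close>, the ratio dictated by \<open>binomial_ratio\<close> so that
  the two contributions at \<open>N0\<close> and \<open>i0\<close> cancel.\<close>

definition \<tau>1 :: 'a where "\<tau>1 = of_nat i0"
definition \<tau>2 :: 'a where "\<tau>2 = - of_nat (N0 - i0)"
definition C :: "'a fps2" where "C = mono 1 (e + K) + mono 1 e"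
definition S :: "'a fps2" where
  "S = mono (\<tau>1 / weight (e - 1)) (e - 1) + mono (\<tau>2 / weight (e - 1 + K)) (e - 1 + K)"

lemma d_pos: "0 < d" and \<nu>_pos: "0 < \<nu>"
  using pos pq_def by (auto intro: Nat.gr0I)

lemma d_le: "d \<le> p + q"
  using \<nu>_pos unfolding pq_def by simp

lemma K_large': "2 * d + 2 \<le> K"
  using d_le K_large by linarith

lemma e_lt: "e < g"
proof -
  have "p * e < p * g" using bezout by (simp add: algebra_simps)
  then show ?thesis by simp
qed

text \<open>Both come from \<open>d * (M * p) = p * s = p * K + p * g\<close> and the Bezout
  relation. The first says that \<open>d\<close> inverts \<open>step\<close> modulo
  \<open>K\<close>.\<close>

lemma d_step: "d * step = p * K + 1" and Mp: "M * p = step + e * \<nu>"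
proof -
  have "d * (M * p) = p * s" by (simp add: s_def)
  also have "\<dots> = p * K + p * g" by (simp only: K_def distrib_left)
  also have "\<dots> = p * K + 1 + d * (e * \<nu>)" by (simp add: bezout pq_def)
  finally have "d * (M * p) = p * K + 1 + d * (e * \<nu>)" .
  moreover from this have "d * (e * \<nu>) < d * (M * p)" by simp
  then have "e * \<nu> < M * p" by simp
  ultimately show "d * step = p * K + 1" "M * p = step + e * \<nu>"
    by (simp_all add: step_def diff_mult_distrib2)
qed

lemma step_gt: "p < step"
proof -
  have "d * p < d * step"
  proof -
    have "p * d \<le> p * K" using K_large' by (intro mult_le_mono2) simp
    then have "d * p < p * K + 1" unfolding mult.commute[of d p] by linarith
    then show ?thesis unfolding d_step .
  qed
  then show ?thesis by simp
qed

lemma step_i0: "step = i0 + p" and i0_pos: "0 < i0"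
  using step_gt by (simp_all add: i0_def)

lemma wt_mono: "l \<le> s \<Longrightarrow> wt (of_nat p) (- of_nat q) (mono c l) = mono (weight l * c) l"
  by (simp add: mono_def wt_monom weight_def)

text \<open>The weights are \<open>p K + 1 + p + q\<close>, which is positive, and
  \<open>1 + p + q - K q\<close>, which is negative for large \<open>K\<close>. Hence the divisions
  defining \<open>S\<close> are legitimate and \<open>S\<close> has no resonant monomial.\<close>

lemma weight_nonzero: "weight (e - 1) \<noteq> 0" "weight (e - 1 + K) \<noteq> 0"
proof -
  have w: "weight l = of_int (int p * int s - int l * int (p + q))" if "l \<le> s" for l
    using that by (simp add: weight_def of_nat_diff algebra_simps)
  have ps: "int p * int s = int p * int K + 1 + int e * int (p + q)"
    using bezout K_def by (simp add: algebra_simps flip: of_nat_mult of_nat_add)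
  have le: "e - 1 \<le> s" "e - 1 + K \<le> s" using e_lt K_def by auto
  have e: "int (e - 1) = int e - 1" using e_pos by simp
  have "int p * int s - int (e - 1) * int (p + q) = int p * int K + 1 + int (p + q)"
    unfolding ps e by (simp add: algebra_simps)
  then have "int p * int s - int (e - 1) * int (p + q) \<noteq> 0" by (simp flip: of_nat_mult of_nat_add)
  then show "weight (e - 1) \<noteq> 0" unfolding w[OF le(1)] by (simp only: of_int_eq_0_iff not_False_eq_True)
  have "int p * int s - int (e - 1 + K) * int (p + q) = 1 + int (p + q) - int K * int q"
    unfolding of_nat_add[of "e - 1"] ps e by (simp add: algebra_simps)
  moreover have "K \<le> K * q" using pos by simp
  then have "1 + (p + q) < K * q" using K_large by linarith
  then have "int (1 + (p + q)) < int (K * q)" by (simp only: of_nat_less_iff)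
  then have "1 + int (p + q) < int K * int q" by simp
  ultimately have "int p * int s - int (e - 1 + K) * int (p + q) \<noteq> 0" by linarith
  then show "weight (e - 1 + K) \<noteq> 0" unfolding w[OF le(2)] by (simp only: of_int_eq_0_iff not_False_eq_True)
qed

lemma homog_mono: "l \<le> s \<Longrightarrow> homog s (mono c l)"
  by (auto simp: homog_def mono_def)

lemma homog_add: "homog s F \<Longrightarrow> homog s G \<Longrightarrow> homog s (F + G)"
  by (simp add: homog_def)

sublocale radial_system p q s d M \<nu> C S
proof
  have "e + K \<le> s" "e \<le> s" "e - 1 \<le> s" "e - 1 + K \<le> s" using e_lt K_def by auto
  then show "homog s C" "homog s S" by (simp_all add: C_def S_def homog_add homog_mono)
  show "0 < s" using K_def K_large by simp
qed (use pos s_def pq_def coprime_M in auto)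

lemma wt_S: "wt (of_nat p) (- of_nat q) S = mono \<tau>1 (e - 1) + mono \<tau>2 (e - 1 + K)"
proof -
  have "e - 1 \<le> s" "e - 1 + K \<le> s" using e_lt K_def by auto
  then show ?thesis using weight_nonzero by (simp add: S_def wt_add wt_mono)
qed

lemma C_power: "C ^ k = (\<Sum>i\<le>k. fps2_monom (of_nat (k choose i)) (k * (s - e) - i * K) (k * e + i * K))"
proof -
  have "C ^ k = (\<Sum>i\<le>k. of_nat (k choose i) * mono 1 (e + K) ^ i * mono 1 e ^ (k - i))"
    unfolding C_def by (rule binomial_ring)
  also have "\<dots> = (\<Sum>i\<le>k. fps2_monom (of_nat (k choose i)) (k * (s - e) - i * K) (k * e + i * K))"
  proof (rule sum.cong)
    fix i assume "i \<in> {..k}"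
    then obtain j where k: "k = i + j" by (metis atMost_iff le_Suc_ex)
    have "K + (s - (e + K)) = s - e" using e_lt K_def by simp
    then have "i * (s - (e + K)) + i * K = i * (s - e)" by (metis add.commute distrib_left)
    then have "i * (s - (e + K)) + j * (s - e) = k * (s - e) - i * K"
      by (simp add: k algebra_simps)
    then show "of_nat (k choose i) * mono 1 (e + K) ^ i * mono 1 e ^ (k - i)
        = fps2_monom (of_nat (k choose i)) (k * (s - e) - i * K) (k * e + i * K)"
      by (simp add: mono_def fps2_monom_power fps2_monom_mult of_nat_eq_monom k algebra_simps)
  qed simp
  finally show ?thesis .
qed

text \<open>Total degrees already match, so only the y-exponent has to be compared; since
  \<open>K > 0\<close>, at most one binomial term fits.\<close>

lemma mono_C_power_nth:
  assumes ij: "i + j = Suc k * s" and l: "l \<le> s"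
  shows "(\<And>r. j \<noteq> l + k * e + r * K) \<Longrightarrow> (mono c l * C ^ k) $ i $ j = 0"
    and "j = l + k * e + r * K \<Longrightarrow> (mono c l * C ^ k) $ i $ j = c * of_nat (k choose r)"
proof -
  have K: "0 < K" using K_large by simp
  have tot: "(s - l + (k * (s - e) - r * K)) + (l + (k * e + r * K)) = Suc k * s" if "r \<le> k" for r
  proof -
    have "r * K \<le> k * (s - e)" using that e_lt K_def by (intro mult_le_mono) auto
    moreover have "k * (s - e) + k * e = k * s" using e_lt K_def by (simp flip: distrib_left)
    ultimately show ?thesis using l by simp
  qed
  have "(mono c l * C ^ k) $ i $ j = (\<Sum>r\<le>k. fps2_monom (c * of_nat (k choose r))
      (s - l + (k * (s - e) - r * K)) (l + (k * e + r * K)) $ i $ j)"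
    unfolding C_power mono_def sum_distrib_left fps2_monom_mult by (simp add: fps_sum_nth)
  also have "\<dots> = (\<Sum>r\<le>k. if j = l + k * e + r * K then c * of_nat (k choose r) else 0)"
  proof (rule sum.cong)
    fix r assume "r \<in> {..k}"
    then have "i = s - l + (k * (s - e) - r * K) \<and> j = l + (k * e + r * K) \<longleftrightarrow> j = l + k * e + r * K"
      using tot[of r] ij by auto
    then show "fps2_monom (c * of_nat (k choose r)) (s - l + (k * (s - e) - r * K)) (l + (k * e + r * K)) $ i $ j
        = (if j = l + k * e + r * K then c * of_nat (k choose r) else 0)"
      by (simp only: fps2_monom_nth)
  qed simp
  finally have *: "(mono c l * C ^ k) $ i $ j
      = (\<Sum>r\<le>k. if j = l + k * e + r * K then c * of_nat (k choose r) else 0)" .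
  show "(mono c l * C ^ k) $ i $ j = 0" if "\<And>r. j \<noteq> l + k * e + r * K"
    unfolding * using that by (intro sum.neutral) auto
  show "(mono c l * C ^ k) $ i $ j = c * of_nat (k choose r)" if "j = l + k * e + r * K"
  proof -
    have "(if j = l + k * e + r' * K then c * of_nat (k choose r') else 0)
        = (if r' = r then c * of_nat (k choose r) else 0)" for r'
      using that K by auto
    then show ?thesis unfolding * by (simp add: binomial_eq_0)
  qed
qed

text \<open>Comparing y-exponents gives \<open>m * step + 1 = i * K\<close>. The second monomial of
  \<open>wt_S\<close> is higher by \<open>K\<close>, which accounts for the index
  \<open>i - 1\<close>.\<close>

lemma melnikov_two_term:
  assumes m: "0 < m" and N: "m * \<nu> = Suc (Suc N)"
  shows "(\<And>i. m * step + 1 \<noteq> i * K) \<Longrightarrow> melnikov m = 0"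
    and "0 < i \<Longrightarrow> m * step + 1 = i * K \<Longrightarrow> melnikov m = 0 \<longleftrightarrow>
      \<tau>1 * of_nat (Suc N choose i) + \<tau>2 * of_nat (Suc N choose (i - 1)) = 0"
proof -
  let ?i = "m * M * q" and ?j = "m * M * p"
  have ij: "?i + ?j = Suc (Suc N) * s"
    unfolding N[symmetric] using arg_cong[OF \<nu>s, of "\<lambda>k. m * k"] by (simp add: algebra_simps)
  have le: "e - 1 \<le> s" "e - 1 + K \<le> s" using e_lt K_def by auto
  have nz: "of_nat (Suc N * s) \<noteq> (0 :: 'a)" "(- 1) ^ N \<noteq> (0 :: 'a)"
    using s_pos unfolding of_nat_eq_0_iff by simp_all
  have mel: "melnikov m = 0 \<longleftrightarrow> (mono \<tau>1 (e - 1) * C ^ Suc N) $ ?i $ ?j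
      + (mono \<tau>2 (e - 1 + K) * C ^ Suc N) $ ?i $ ?j = 0"
    using melnikov_eq[OF m N] nz
    unfolding wt_S distrib_right fps_add_nth by (metis mult_eq_0_iff)
  have "?j = m * step + m * \<nu> * e" using arg_cong[OF Mp, of "\<lambda>k. m * k"] by (simp add: algebra_simps)
  also have "\<dots> = m * step + 1 + (e - 1) + Suc N * e" unfolding N using e_pos by (simp add: algebra_simps)
  finally have j: "?j = m * step + 1 + (e - 1) + Suc N * e" .
  show "melnikov m = 0" if no: "\<And>i. m * step + 1 \<noteq> i * K"
  proof -
    have "?j \<noteq> e - 1 + Suc N * e + r * K" for r using no[of r] unfolding j by linarith
    moreover have "?j \<noteq> e - 1 + K + Suc N * e + r * K" for r
      using no[of "Suc r"] unfolding j by simp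
    ultimately show ?thesis
      using mono_C_power_nth(1)[OF ij le(1)] mono_C_power_nth(1)[OF ij le(2)] mel by simp
  qed
  show "melnikov m = 0 \<longleftrightarrow> \<tau>1 * of_nat (Suc N choose i) + \<tau>2 * of_nat (Suc N choose (i - 1)) = 0"
    if i: "0 < i" "m * step + 1 = i * K"
  proof -
    have 1: "?j = e - 1 + Suc N * e + i * K" using i unfolding j by linarith
    have "i * K = K + (i - 1) * K" using i(1) by (cases i) auto
    then have 2: "?j = e - 1 + K + Suc N * e + (i - 1) * K" using 1 by simp
    show ?thesis
      unfolding mel mono_C_power_nth(2)[OF ij le(1) 1] mono_C_power_nth(2)[OF ij le(2) 2] ..
  qed
qed

text \<open>Multiplying by \<open>d\<close> and using \<open>d_step\<close> shows that
  \<open>K\<close> divides \<open>m + d\<close>, which lies strictly between 0 and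
  \<open>2 * K\<close>.\<close>

lemma resonant_m:
  assumes "m * step + 1 = i * K" "0 < m" "m < 2 * K - d"
  shows "m = K - d"
proof -
  have "d * (m * step + 1) = m * (d * step) + d" by (simp add: algebra_simps)
  also have "\<dots> = K * (m * p) + (m + d)" unfolding d_step by (simp add: algebra_simps)
  finally have "K * (m * p) + (m + d) = K * (d * i)" unfolding assms(1) by (simp only: mult_ac)
  then have "K dvd m + d" by (metis dvd_add_right_iff dvd_triv_left)
  then obtain r where r: "m + d = K * r" by (elim dvdE)
  have "K * r < K * 2" using assms(3) r by linarith
  moreover have "0 < K * r" using assms(2) r by linarith
  ultimately have "r = 1" by simp
  then show ?thesis using r by simp
qed

lemma solution0: "(K - d) * step + 1 = i0 * K"
proof -
  have "(K - d) * step + d * step = K * step" using K_large' by (simp flip: distrib_right)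
  moreover have "K * step = i0 * K + p * K" by (simp add: step_i0 distrib_left mult.commute)
  ultimately show ?thesis using d_step by linarith
qed

lemma solution1: "(2 * K - d) * step + 1 = (i0 + step) * K"
proof -
  have "2 * K - d = (K - d) + K" using K_large' by simp
  then show ?thesis using solution0 by (simp add: algebra_simps)
qed

lemma i0_le: "i0 \<le> N0"
proof -
  have "d * step = d * i0 + d * p" by (simp add: step_i0 algebra_simps)
  then have 1: "d * i0 + d * p = p * K + 1" by (simp add: d_step)
  have 2: "d * N0 + d * (p + q) = K * (p + q)"
    using K_large' by (simp add: N0_def pq_def mult_ac flip: distrib_left distrib_right)
  have "d * q + 1 \<le> K * q"
  proof -
    have "(d + 1) * q \<le> K * q" using K_large' by (intro mult_le_mono1) simp
    then show ?thesis using pos by (simp add: algebra_simps)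
  qed
  then have "d * i0 \<le> d * N0"
    using 1 2[unfolded distrib_left] mult.commute[of p K] by linarith
  then show ?thesis using d_pos by simp
qed

lemma N1_eq: "(2 * K - d) * \<nu> = N0 + K * \<nu>"
proof -
  have "2 * K - d = (K - d) + K" using K_large' by simp
  then show ?thesis by (simp add: N0_def algebra_simps)
qed

lemma step_le: "step \<le> K * \<nu>"
proof -
  have "d * step \<le> d * (K * \<nu>)"
  proof -
    have "K \<le> K * q" using pos by simp
    then have "p * K + 1 \<le> K * (p + q)" using K_large by (simp add: algebra_simps)
    then show ?thesis unfolding d_step pq_def by (simp add: mult_ac)
  qed
  then show ?thesis using d_pos by simp
qed

text \<open>Cancellation at \<open>m = 2 * K - d\<close> would require the index and
  \<open>m * \<nu>\<close> to be in the same ratio as \<open>i0\<close> and \<open>N0\<close>; this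
  determinant measures the failure.\<close>

lemma determinant: "int i0 * int (N0 + K * \<nu>) - int N0 * int (i0 + step) = int \<nu>"
proof -
  have N0: "int N0 = (int K - int d) * int \<nu>" using K_large' by (simp add: N0_def of_nat_diff)
  have st: "int d * int step = int p * int K + 1"
    using d_step by (simp flip: of_nat_mult of_nat_Suc)
  have i0: "int i0 = int step - int p" by (simp add: step_i0)
  have "int i0 * int (N0 + K * \<nu>) - int N0 * int (i0 + step)
      = int i0 * (int K * int \<nu>) - int N0 * int step"
    by (simp add: algebra_simps)
  also have "\<dots> = int \<nu> * (int d * int step - int p * int K)"
    unfolding N0 i0 by (simp add: algebra_simps)
  finally show ?thesis by (simp add: st)
qed

text \<open>If \<open>m * \<nu> = 1\<close>, the absence of resonant monomials in \<open>S\<close>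
  suffices. Otherwise the exponents match only for \<open>m = K - d\<close>, where the choice of
  \<open>\<tau>1\<close> and \<open>\<tau>2\<close> cancels the two binomials.\<close>

lemma melnikov_first:
  assumes "0 < m" "m < 2 * K - d"
  shows "melnikov m = 0"
proof (cases "m * \<nu> = 1")
  case True
  have "S $ (M * q) $ (M * p) = 0"
  proof -
    have "mono c l $ (M * q) $ (M * p) = 0" if "weight l \<noteq> 0" for c l
    proof (rule ccontr)
      assume "mono c l $ (M * q) $ (M * p) \<noteq> 0"
      then have l: "s - l = M * q" "l = M * p" by (auto simp: mono_def split: if_splits)
      have "weight l = of_nat (M * q) * of_nat p - of_nat (M * p) * of_nat q"
        unfolding weight_def l(1) unfolding l(2) ..
      then show False using that by simp
    qed
    then show ?thesis using weight_nonzero by (simp add: S_def)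
  qed
  with True show ?thesis by (rule melnikov_eq_0)
next
  case False
  moreover have "0 < m * \<nu>" using assms \<nu>_pos by simp
  ultimately have "m * \<nu> = Suc (Suc (m * \<nu> - 2))" by linarith
  then obtain N where N: "m * \<nu> = Suc (Suc N)" by blast
  show ?thesis
  proof (cases "\<exists>i. m * step + 1 = i * K")
    case False
    then show ?thesis using melnikov_two_term(1)[OF assms(1) N] by blast
  next
    case True
    then have m: "m = K - d" using resonant_m assms by blast
    then have N0: "N0 = Suc (Suc N)" using N by (simp add: N0_def)
    have "of_nat (i0 * (N0 - 1 choose i0)) = (of_nat ((N0 - i0) * (N0 - 1 choose (i0 - 1))) :: 'a)"
      using binomial_ratio[OF i0_pos i0_le] by simp
    then have "\<tau>1 * of_nat (Suc N choose i0) + \<tau>2 * of_nat (Suc N choose (i0 - 1)) = 0"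
      unfolding N0 by (simp add: \<tau>1_def \<tau>2_def N0)
    then show ?thesis
      using melnikov_two_term(2)[OF assms(1) N i0_pos] solution0 m by simp
  qed
qed

text \<open>After clearing a nonzero binomial, vanishing would mean
  \<open>i0 * N1 = N0 * i1\<close>, against \<open>determinant\<close>.\<close>

lemma melnikov_nonzero: "melnikov (2 * K - d) \<noteq> 0"
proof
  assume mel: "melnikov (2 * K - d) = 0"
  define i1 where "i1 = i0 + step"
  define N1 where "N1 = N0 + K * \<nu>"
  have m: "0 < 2 * K - d" using K_large' by simp
  have i1: "0 < i1" "i1 \<le> N1" using i0_pos i0_le step_le by (simp_all add: i1_def N1_def)
  have "2 * 1 \<le> (2 * K - d) * \<nu>" using K_large' \<nu>_pos by (intro mult_le_mono) auto
  then have "N1 = Suc (Suc (N1 - 2))" unfolding N1_def N1_eq[symmetric] by linarith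
  then obtain N where N: "N1 = Suc (Suc N)" by blast
  have "\<tau>1 * of_nat (Suc N choose i1) + \<tau>2 * of_nat (Suc N choose (i1 - 1)) = 0"
    using melnikov_two_term(2)[OF m _ i1(1), of N] mel N solution1
    unfolding N1_def N1_eq[symmetric] i1_def by simp
  then have "\<tau>1 * (of_nat i1 * of_nat (Suc N choose i1)) + \<tau>2 * of_nat i1 * of_nat (Suc N choose (i1 - 1)) = 0"
    by (metis distrib_left mult.assoc mult.left_commute mult_zero_right)
  moreover have "of_nat i1 * of_nat (Suc N choose i1) = (of_nat (N1 - i1) * of_nat (Suc N choose (i1 - 1)) :: 'a)"
    using binomial_ratio[OF i1] unfolding N by (simp flip: of_nat_mult)
  ultimately have "(\<tau>1 * of_nat (N1 - i1) + \<tau>2 * of_nat i1) * of_nat (Suc N choose (i1 - 1)) = 0"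
    by (simp only: distrib_right mult.assoc)
  moreover have "Suc N choose (i1 - 1) \<noteq> 0" using i1 N by (simp add: binomial_eq_0_iff)
  ultimately have "\<tau>1 * of_nat (N1 - i1) + \<tau>2 * of_nat i1 = 0" by simp
  then have "(of_int (int i0 * int N1 - int N0 * int i1) :: 'a) = 0"
    using i1 i0_le by (simp add: \<tau>1_def \<tau>2_def of_nat_diff algebra_simps)
  then have "int i0 * int N1 - int N0 * int i1 = 0" by (simp only: of_int_eq_0_iff)
  then show False
    using determinant \<nu>_pos unfolding N1_def i1_def by linarith
qed

end

section \<open>The ideals of saddle values\<close>

definition eval_monom :: "(coeff_var \<Rightarrow> 'b::comm_ring_1) \<Rightarrow> (coeff_var \<Rightarrow>\<^sub>0 nat) \<Rightarrow> 'b" where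
  "eval_monom val m = (\<Prod>c\<in>Poly_Mapping.keys m. val c ^ Poly_Mapping.lookup m c)"

definition eval_poly :: "('a::comm_ring_1 \<Rightarrow> 'b::comm_ring_1) \<Rightarrow> (coeff_var \<Rightarrow> 'b) \<Rightarrow> 'a coeff_poly \<Rightarrow> 'b" where
  "eval_poly h val f = (\<Sum>m\<in>Poly_Mapping.keys f. h (Poly_Mapping.lookup f m) * eval_monom val m)"

lemma eval_monom_superset:
  assumes "finite A" "Poly_Mapping.keys m \<subseteq> A"
  shows "eval_monom val m = (\<Prod>c\<in>A. val c ^ Poly_Mapping.lookup m c)"
  unfolding eval_monom_def using assms by (intro prod.mono_neutral_left) (auto simp: in_keys_iff)

lemma eval_monom_add: "eval_monom val (m + m') = eval_monom val m * eval_monom val m'"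
proof -
  let ?A = "Poly_Mapping.keys m \<union> Poly_Mapping.keys m'"
  have "finite ?A" by simp
  moreover have "Poly_Mapping.keys (m + m') \<subseteq> ?A" by (rule keys_add)
  ultimately show ?thesis
    by (simp add: eval_monom_superset[of ?A] lookup_add power_add prod.distrib)
qed

context coeff_hom
begin

lemma eval_poly_superset:
  assumes "finite A" "Poly_Mapping.keys f \<subseteq> A"
  shows "eval_poly h val f = (\<Sum>m\<in>A. h (Poly_Mapping.lookup f m) * eval_monom val m)"
  unfolding eval_poly_def using assms by (intro sum.mono_neutral_left) (auto simp: in_keys_iff zero)

lemma eval_poly_add: "eval_poly h val (f + g) = eval_poly h val f + eval_poly h val g"
proof -
  let ?A = "Poly_Mapping.keys f \<union> Poly_Mapping.keys g"
  have "finite ?A" by simp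
  moreover have "Poly_Mapping.keys (f + g) \<subseteq> ?A" by (rule keys_add)
  ultimately show ?thesis
    by (simp add: eval_poly_superset[of ?A] lookup_add add distrib_right sum.distrib)
qed

lemma eval_poly_0: "eval_poly h val 0 = 0"
  by (simp add: eval_poly_def)

lemma eval_poly_single: "eval_poly h val (Poly_Mapping.single m c) = h c * eval_monom val m"
  by (simp add: eval_poly_superset[of "{m}"])

lemma eval_poly_sum: "eval_poly h val (sum F A) = (\<Sum>x\<in>A. eval_poly h val (F x))"
  by (induction A rule: infinite_finite_induct) (simp_all add: eval_poly_0 eval_poly_add)

lemma eval_poly_mult: "eval_poly h val (f * g) = eval_poly h val f * eval_poly h val g"
proof -
  have expand: "f = (\<Sum>m\<in>Poly_Mapping.keys f. Poly_Mapping.single m (Poly_Mapping.lookup f m))"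
    for f :: "'a coeff_poly"
    by (rule poly_mapping_eqI) (auto simp: lookup_sum lookup_single when_def in_keys_iff sum.delta)
  have "f * g = (\<Sum>m\<in>Poly_Mapping.keys f. \<Sum>m'\<in>Poly_Mapping.keys g.
      Poly_Mapping.single (m + m') (Poly_Mapping.lookup f m * Poly_Mapping.lookup g m'))"
    by (subst expand[of f], subst expand[of g]) (simp only: sum_product mult_single)
  then show ?thesis
    by (simp add: eval_poly_sum eval_poly_single eval_monom_add mult)
       (simp add: eval_poly_def sum_product mult_ac)
qed

lemma coeff_hom_eval_poly: "coeff_hom (eval_poly h val)"
proof
  show "eval_poly h val 1 = 1"
    using eval_poly_single[of val 0 1] by (simp add: one eval_monom_def)
qed (simp_all add: eval_poly_add eval_poly_mult)

lemma eval_poly_indet: "eval_poly h val (indet c) = val c"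
  by (simp add: indet_def eval_poly_single one eval_monom_def)

end

lemma coeff_ring_sel:
  "carrier (coeff_ring n) = {f. \<forall>m \<in> Poly_Mapping.keys f. Poly_Mapping.keys m \<subseteq> coeff_vars n}"
  "x \<otimes>\<^bsub>coeff_ring n\<^esub> y = x * y" "\<one>\<^bsub>coeff_ring n\<^esub> = 1"
  "\<zero>\<^bsub>coeff_ring n\<^esub> = 0" "x \<oplus>\<^bsub>coeff_ring n\<^esub> y = x + y"
  by (simp_all add: coeff_ring_def)

lemma carrier_add: "f \<in> carrier (coeff_ring n) \<Longrightarrow> g \<in> carrier (coeff_ring n) \<Longrightarrow> f + g \<in> carrier (coeff_ring n)"
  using keys_add[of f g] by (auto simp: coeff_ring_sel)

lemma carrier_uminus: "f \<in> carrier (coeff_ring n) \<Longrightarrow> - f \<in> carrier (coeff_ring n)"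
  by (simp add: coeff_ring_sel in_keys_iff)

lemma carrier_mult:
  assumes "f \<in> carrier (coeff_ring n)" "g \<in> carrier (coeff_ring n)"
  shows "f * g \<in> carrier (coeff_ring n)"
  unfolding coeff_ring_sel
proof (intro CollectI ballI)
  fix m assume "m \<in> Poly_Mapping.keys (f * g)"
  then obtain a b where "m = a + b" "a \<in> Poly_Mapping.keys f" "b \<in> Poly_Mapping.keys g"
    using keys_mult[of f g] by auto
  then show "Poly_Mapping.keys m \<subseteq> coeff_vars n"
    using assms keys_add[of a b] by (fastforce simp: coeff_ring_sel)
qed

lemma carrier_0: "0 \<in> carrier (coeff_ring n)"
  by (simp add: coeff_ring_sel)

lemma carrier_single_0: "Poly_Mapping.single 0 c \<in> carrier (coeff_ring n)"
  by (simp add: coeff_ring_sel)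

lemma carrier_1: "1 \<in> carrier (coeff_ring n)"
  by (simp add: coeff_ring_sel)

lemma carrier_sum: "(\<And>x. x \<in> A \<Longrightarrow> F x \<in> carrier (coeff_ring n)) \<Longrightarrow> sum F A \<in> carrier (coeff_ring n)"
  by (induction A rule: infinite_finite_induct) (simp_all add: carrier_0 carrier_add)

lemma carrier_prod: "(\<And>x. x \<in> A \<Longrightarrow> F x \<in> carrier (coeff_ring n)) \<Longrightarrow> prod F A \<in> carrier (coeff_ring n)"
  by (induction A rule: infinite_finite_induct) (simp_all add: carrier_1 carrier_mult)

lemma carrier_power: "f \<in> carrier (coeff_ring n) \<Longrightarrow> f ^ k \<in> carrier (coeff_ring n)"
  by (induction k) (simp_all add: carrier_1 carrier_mult)

lemma ring_coeff_ring: "ring (coeff_ring n :: 'a::comm_ring_1 coeff_poly ring)"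
proof (rule ringI)
  show "abelian_group (coeff_ring n :: 'a coeff_poly ring)"
  proof (rule abelian_groupI)
    fix x :: "'a coeff_poly" assume "x \<in> carrier (coeff_ring n)"
    then show "\<exists>y\<in>carrier (coeff_ring n). y \<oplus>\<^bsub>coeff_ring n\<^esub> x = \<zero>\<^bsub>coeff_ring n\<^esub>"
      by (intro bexI[of _ "- x"]) (simp_all add: carrier_uminus coeff_ring_sel(2-))
  qed (simp_all add: coeff_ring_sel(2-) carrier_add carrier_0 algebra_simps)
  show "monoid (coeff_ring n :: 'a coeff_poly ring)"
    by unfold_locales (simp_all add: coeff_ring_sel(2-) carrier_mult carrier_1 algebra_simps)
qed (simp_all add: coeff_ring_sel(2-) algebra_simps)

text \<open>This is the preimage, within the ring for degree \<open>n\<close>, of the ideal of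
  series divisible by \<epsilon>^2.\<close>

lemma ideal_vanishing:
  fixes \<phi> :: "'a::comm_ring_1 coeff_poly \<Rightarrow> 'a fps"
  assumes "coeff_hom \<phi>"
  shows "ideal {f \<in> carrier (coeff_ring n). \<phi> f $ 0 = 0 \<and> \<phi> f $ 1 = 0} (coeff_ring n)" (is "ideal ?I ?R")
proof (rule idealI)
  interpret coeff_hom \<phi> by fact
  have neg: "\<ominus>\<^bsub>?R\<^esub> x = - x" if "x \<in> carrier ?R" for x
  proof -
    interpret R: ring ?R by (rule ring_coeff_ring)
    have "- x \<oplus>\<^bsub>?R\<^esub> x = \<zero>\<^bsub>?R\<^esub>" by (simp add: coeff_ring_sel(2-))
    then show ?thesis using that carrier_uminus[OF that] by (rule R.minus_equality)
  qed
  show "ring ?R" by (rule ring_coeff_ring)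
  show "subgroup ?I (add_monoid ?R)"
  proof
    fix x assume x: "x \<in> ?I"
    then have "inv\<^bsub>add_monoid ?R\<^esub> x = - x" using neg[of x] by (simp add: a_inv_def)
    then show "inv\<^bsub>add_monoid ?R\<^esub> x \<in> ?I" using x by (simp add: carrier_uminus minus)
  qed (auto simp: coeff_ring_sel(2-) carrier_add carrier_0 add zero)
qed (simp_all add: coeff_ring_sel(2-) carrier_mult coeff_hom.mult[OF assms] fps_mult_nth_1)

section \<open>Saddle values of the generic system and their specialization\<close>

lemma generic_resonant_system:
  fixes p q n :: nat
  assumes "0 < p" "0 < q" "coprime p q" "2 \<le> n"
  shows "resonant_system p q (generic_P n :: 'a::field_char_0 coeff_poly fps2) (generic_Q n)"
proof
  fix z :: int assume z: "z \<noteq> 0"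
  have nat: "of_nat m = Poly_Mapping.single 0 (of_nat m :: 'a)" for m
    by (induction m) (simp_all add: single_add)
  have int: "of_int z = Poly_Mapping.single 0 (of_int z :: 'a)"
    by (cases z) (simp_all only: of_int_minus of_int_of_nat_eq nat single_uminus)
  have "of_int z * Poly_Mapping.single 0 (1 / of_int z) = (1 :: 'a coeff_poly)"
    unfolding int mult_single using z by simp
  then show "\<exists>r :: 'a coeff_poly. of_int z * r = 1" by blast
qed (use assms in \<open>auto simp: low_def generic_P_def generic_Q_def\<close>)

text \<open>Uniqueness of the normalization is what gives the definite description its
  meaning.\<close>

lemma saddle_value_eq:
  fixes X Y :: "'a::field_char_0 coeff_poly fps2"
  assumes "0 < p" "0 < q" "coprime p q" "2 \<le> n"
    and norm: "is_normalization p q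
          (of_nat p * x_var + generic_P n) (- of_nat q * y_var + generic_Q n) X Y u v"
  shows "saddle_value p q n k = u $ k - v $ k"
proof -
  interpret resonant_system p q "generic_P n :: 'a coeff_poly fps2" "generic_Q n"
    using assms by (intro generic_resonant_system)
  show ?thesis
    unfolding saddle_value_def
  proof (rule the_equality)
    show "\<exists>X Y u' v'. is_normalization p q (of_nat p * x_var + generic_P n)
        (- of_nat q * y_var + generic_Q n) X Y u' v' \<and> u $ k - v $ k = u' $ k - v' $ k"
      using norm by (intro exI[of _ X] exI[of _ Y] exI[of _ u] exI[of _ v] conjI refl)
  next
    fix L :: "'a coeff_poly"
    assume "\<exists>X Y u v. is_normalization p q (of_nat p * x_var + generic_P n)
        (- of_nat q * y_var + generic_Q n) X Y u v \<and> L = u $ k - v $ k"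
    then obtain X' Y' :: "'a coeff_poly fps2" and u' v' where norm': "is_normalization p q
        (of_nat p * x_var + generic_P n) (- of_nat q * y_var + generic_Q n) X' Y' u' v'"
        and L: "L = u' $ k - v' $ k" by blast
    show "L = u $ k - v $ k" unfolding L using normalization_unique[OF norm norm'] by simp
  qed
qed

lemma map2_generic:
  fixes val :: "coeff_var \<Rightarrow> 'b::comm_ring_1" and h :: "'a::comm_ring_1 \<Rightarrow> 'b"
  assumes "coeff_hom h"
    and P: "\<And>i j. P $ i $ j = (if i + j = n then val (Coeff_P i j) else 0)"
    and Q: "\<And>i j. Q $ i $ j = (if i + j = n then val (Coeff_Q i j) else 0)"
  shows "coeff_hom.map2 (eval_poly h val) (of_nat p * x_var + generic_P n) = of_nat p * x_var + P"
    and "coeff_hom.map2 (eval_poly h val) (- of_nat q * y_var + generic_Q n) = - of_nat q * y_var + Q"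
proof -
  interpret h: coeff_hom h by fact
  interpret coeff_hom "eval_poly h val" by (rule h.coeff_hom_eval_poly)
  have "map2 (generic_P n) = P" "map2 (generic_Q n) = Q"
    by (rule fps2_eqI; simp add: generic_P_def generic_Q_def P Q h.eval_poly_indet zero)+
  moreover have "map2 x_var = x_var" unfolding x_var_eq_monom by (simp add: map2_monom one)
  moreover have "map2 y_var = y_var" unfolding y_var_eq_monom by (simp add: map2_monom one)
  ultimately show "map2 (of_nat p * x_var + generic_P n) = of_nat p * x_var + P"
    "map2 (- of_nat q * y_var + generic_Q n) = - of_nat q * y_var + Q"
    by (simp_all only: map2_add map2_mult map2_of_nat map2_minus)
qed

text \<open>
  Setting the indeterminates outside \<open>coeff_vars n\<close> to zero fixes the generic system, hence by
  uniqueness of the normalization also its saddle values.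
\<close>

lemma saddle_value_in_carrier:
  assumes pq: "0 < p" "0 < q" "coprime p q" "2 \<le> n"
  shows "(saddle_value p q n k :: 'a::field_char_0 coeff_poly) \<in> carrier (coeff_ring n)"
proof -
  interpret resonant_system p q "generic_P n :: 'a coeff_poly fps2" "generic_Q n"
    using pq by (intro generic_resonant_system)
  obtain X Y :: "'a coeff_poly fps2" and u v where norm: "is_normalization p q
      (of_nat p * x_var + generic_P n) (- of_nat q * y_var + generic_Q n) X Y u v"
    using normalization_exists by blast
  define val :: "coeff_var \<Rightarrow> 'a coeff_poly" where "val c = (if c \<in> coeff_vars n then indet c else 0)" for c
  have h: "coeff_hom (Poly_Mapping.single 0 :: 'a \<Rightarrow> 'a coeff_poly)"
    by unfold_locales (simp_all add: single_add mult_single)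
  then interpret \<theta>: coeff_hom "eval_poly (Poly_Mapping.single 0) val"
    by (rule coeff_hom.coeff_hom_eval_poly)
  have F: "\<theta>.map2 (of_nat p * x_var + generic_P n) = of_nat p * x_var + generic_P n"
    by (rule map2_generic(1)[OF h, where P = "generic_P n" and Q = "generic_Q n" and n = n])
       (auto simp: generic_P_def generic_Q_def val_def coeff_vars_def)
  have G: "\<theta>.map2 (- of_nat q * y_var + generic_Q n) = - of_nat q * y_var + generic_Q n"
    by (rule map2_generic(2)[OF h, where P = "generic_P n" and Q = "generic_Q n" and n = n])
       (auto simp: generic_P_def generic_Q_def val_def coeff_vars_def)
  have "u = \<theta>.map1 u" "v = \<theta>.map1 v"
    using normalization_unique[OF norm \<theta>.is_normalization_map[OF norm, unfolded F G]] by simp_all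
  from this[THEN arg_cong, of "\<lambda>f. f $ k"]
  have "u $ k - v $ k = eval_poly (Poly_Mapping.single 0) val (u $ k - v $ k)"
    by (simp add: \<theta>.diff)
  moreover have "eval_poly (Poly_Mapping.single 0) val f \<in> carrier (coeff_ring n)" for f :: "'a coeff_poly"
  proof -
    have "val c \<in> carrier (coeff_ring n)" for c
      by (simp add: val_def indet_def coeff_ring_sel)
    then show ?thesis
      unfolding eval_poly_def eval_monom_def
      by (intro carrier_sum carrier_mult carrier_single_0 carrier_prod carrier_power)
  qed
  ultimately have "u $ k - v $ k \<in> carrier (coeff_ring n)"
    by (rule ssubst[where P = "\<lambda>f. f \<in> carrier (coeff_ring n)"])
  then show ?thesis unfolding saddle_value_eq[OF pq norm] .
qed

text \<open>If fewer than \<open>k\<close> saddle values generated everything, all of them would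
  specialize to zero modulo \<epsilon>^2, including the \<open>k\<close>-th.\<close>

lemma M_hI_ge:
  fixes \<phi> :: "'a::field_char_0 coeff_poly \<Rightarrow> 'a fps"
  assumes pq: "0 < p" "0 < q" "coprime p q" "2 \<le> n" and \<phi>: "coeff_hom \<phi>"
    and low: "\<And>i. 0 < i \<Longrightarrow> i < k \<Longrightarrow> \<phi> (saddle_value p q n i) $ 0 = 0 \<and> \<phi> (saddle_value p q n i) $ 1 = 0"
    and k: "0 < k" "\<phi> (saddle_value p q n k) $ 1 \<noteq> 0"
  shows "enat k \<le> M_hI TYPE('a) p q n"
  unfolding M_hI_def
proof (rule Inf_greatest)
  fix x assume "x \<in> {enat M |M. (saddle_ideal p q n M :: 'a coeff_poly set) = saddle_ideal_inf p q n}"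
  then obtain M where x: "x = enat M" and
    eq: "(saddle_ideal p q n M :: 'a coeff_poly set) = saddle_ideal_inf p q n" by blast
  have "k \<le> M"
  proof (rule ccontr)
    assume "\<not> k \<le> M"
    let ?I = "{f \<in> carrier (coeff_ring n). \<phi> f $ 0 = 0 \<and> \<phi> f $ 1 = 0}"
    have "saddle_value p q n ` {1..M} \<subseteq> ?I"
      using low \<open>\<not> k \<le> M\<close> saddle_value_in_carrier[OF pq] by auto
    then have "saddle_ideal p q n M \<subseteq> ?I"
      using ideal_vanishing[OF \<phi>, of n] by (auto simp: saddle_ideal_def genideal_def)
    moreover have "saddle_value p q n k \<in> saddle_ideal_inf p q n"
      using k(1) by (auto simp: saddle_ideal_inf_def genideal_def)
    ultimately show False using eq k(2) by auto
  qed
  then show "enat k \<le> x" by (simp add: x)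
qed

lemma (in two_term_family) M_hI_ge_two_term:
  "enat ((2 * K - d) * M) \<le> M_hI TYPE('a) p q (s + 1)"
proof -
  have n: "2 \<le> s + 1" using s_pos by simp
  \<comment> \<open>Each indeterminate is sent to the corresponding coefficient of the perturbed
    radial system, which is homogeneous of degree \<open>s + 1\<close>.\<close>
  define val where "val c = (case c of Coeff_P i j \<Rightarrow> pert_P $ i $ j | Coeff_Q i j \<Rightarrow> pert_Q $ i $ j)" for c
  have h: "coeff_hom (fps_const :: 'a \<Rightarrow> 'a fps)"
    by unfold_locales simp_all
  then interpret \<phi>: coeff_hom "eval_poly (fps_const :: 'a \<Rightarrow> 'a fps) val"
    by (rule coeff_hom.coeff_hom_eval_poly)
  interpret gen: resonant_system p q "generic_P (s + 1) :: 'a coeff_poly fps2" "generic_Q (s + 1)"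
    using pos n by (intro generic_resonant_system)
  obtain X Y :: "'a coeff_poly fps2" and u v where norm: "is_normalization p q
      (of_nat p * x_var + generic_P (s + 1)) (- of_nat q * y_var + generic_Q (s + 1)) X Y u v"
    using gen.normalization_exists by blast
  have P0: "pert_P $ i $ j = 0" and Q0: "pert_Q $ i $ j = 0" if "i + j \<noteq> s + 1" for i j
  proof -
    have F: "(lift2 R + fps2_monom c 0 0 * lift2 S) $ a $ b = 0" if "a + b \<noteq> s" for a b c
      using that homog_R homog_S by (simp add: homog_def fps2_monom_mult_nth)
    have "(fps2_monom 1 1 0 * lift2 R) $ i $ j = 0"
      using that F[of "i - 1" j 0] by (simp add: fps2_monom_mult_nth)
    then show "pert_P $ i $ j = 0" unfolding pert_P_def x_var_eq_monom .
    have "(fps2_monom 1 0 1 * (lift2 R + fps2_monom fps_X 0 0 * lift2 S)) $ i $ j = 0"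
      unfolding fps2_monom_mult_nth[of _ 0 1] using that F[of i "j - 1" fps_X] by simp
    then show "pert_Q $ i $ j = 0" unfolding pert_Q_def y_var_eq_monom .
  qed
  have F: "\<phi>.map2 (of_nat p * x_var + generic_P (s + 1)) = of_nat p * x_var + pert_P"
    by (rule map2_generic(1)[OF h, where P = pert_P and Q = pert_Q and n = "s + 1"])
       (simp_all add: val_def P0 Q0)
  have G: "\<phi>.map2 (- of_nat q * y_var + generic_Q (s + 1)) = - of_nat q * y_var + pert_Q"
    by (rule map2_generic(2)[OF h, where P = pert_P and Q = pert_Q and n = "s + 1"])
       (simp_all add: val_def P0 Q0)
  note norm' = \<phi>.is_normalization_map[OF norm, unfolded F G]
  have L: "eval_poly fps_const val (saddle_value p q (s + 1) k) = \<phi>.map1 u $ k - \<phi>.map1 v $ k" for k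
    unfolding saddle_value_eq[OF pos n norm] by (simp add: \<phi>.diff)
  show ?thesis
  proof (rule M_hI_ge[OF pos n \<phi>.coeff_hom_axioms])
    show "eval_poly fps_const val (saddle_value p q (s + 1) i) $ 0 = 0 \<and>
        eval_poly fps_const val (saddle_value p q (s + 1) i) $ 1 = 0" if "i < (2 * K - d) * M" for i
      unfolding L fps_sub_nth
      using saddle_const[OF norm', of i] saddle_lin_eq_0[OF norm' melnikov_first that] by simp
    show m: "0 < (2 * K - d) * M" using K_large' M_pos by simp
    have "of_nat (p * q) * (eval_poly fps_const val (saddle_value p q (s + 1) ((2 * K - d) * M)) $ 1)
        = melnikov (2 * K - d)"
      unfolding L fps_sub_nth by (rule saddle_lin[OF norm' melnikov_first]) (use K_large' in auto)
    then show "eval_poly fps_const val (saddle_value p q (s + 1) ((2 * K - d) * M)) $ 1 \<noteq> 0"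
      using melnikov_nonzero by auto
  qed
qed

lemma M_hI_asymptotics:
  assumes p: "0 < p" and q: "0 < q" and pq: "coprime p q"
  obtains e where "e \<in> O(\<lambda>n::nat. real n)"
    "\<forall>\<^sub>F n in sequentially. ereal (2 / real (gcd (n - 1) (p + q)) * (real n)\<^sup>2 + e n)
      \<le> ereal_of_enat (M_hI TYPE('a::field_char_0) p q n)"
proof -
  have "coprime p (p + q)" using pq by (simp add: coprime_iff_gcd_eq_1)
  moreover obtain c x y where "c dvd p" "c dvd p + q" "p * x = (p + q) * y + c"
    using bezout_add_strong_nat[of p "p + q"] p by blast
  ultimately have xy: "p * x = (p + q) * y + 1" by (metis coprime_common_divisor nat_dvd_1_iff_1)
  \<comment> \<open>Adding \<open>p + q\<close> to one Bezout coefficient and \<open>p\<close> to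
    the other preserves the relation and makes \<open>e\<close> positive. Both depend only on
    \<open>p\<close> and \<open>q\<close>.\<close>
  define g e where "g = x + (p + q)" "e = y + p"
  have bez: "p * g = 1 + e * (p + q)" "0 < e" using xy p by (simp_all add: g_e_def algebra_simps)
  \<comment> \<open>Bounds \<open>4 + 2 g + d\<close> for every possible gcd
    \<open>d \<le> p + q\<close>, so the error is uniform in \<open>n\<close>.\<close>
  define c where "c = 4 + 2 * g + (p + q)"
  have bound: "ereal (2 / real (gcd (n - 1) (p + q)) * (real n)\<^sup>2 + - (real c * real n))
      \<le> ereal_of_enat (M_hI TYPE('a) p q n)" if n: "g + 2 * p + 2 * q + 3 \<le> n" for n
  proof -
    define s where "s = n - 1"
    define d where "d = gcd s (p + q)"
    define K where "K = s - g"
    have n_eq: "n = s + 1" and sK: "s = K + g" using n by (simp_all add: s_def K_def)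
    have d: "0 < d" using p by (simp add: d_def)
    have gcd_eq: "gcd (n - 1) (p + q) = d" by (simp add: d_def s_def)
    interpret two_term_family p q s d "s div d" "(p + q) div d" e g K "TYPE('a)"
    proof
      show "coprime (s div d) ((p + q) div d)"
        unfolding d_def using p by (intro div_gcd_coprime) auto
      show "s = s div d * d" "p + q = (p + q) div d * d" by (simp_all add: d_def)
    qed (use p q pq bez sK n n_eq in auto)
    have le: "enat ((2 * K - d) * (s div d)) \<le> M_hI TYPE('a) p q n"
      using M_hI_ge_two_term unfolding n_eq .
    have sd: "real (s div d) = real s / real d"
      by (simp add: d_def real_of_nat_div)
    have K: "real (2 * K - d) = 2 * (real n - 1 - real g) - real d"
    proof -
      have "real n = real K + real g + 1" by (simp only: n_eq sK of_nat_add of_nat_1)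
      moreover have "real (2 * K - d) = 2 * real K - real d" using K_large' by (simp add: of_nat_diff)
      ultimately show ?thesis by simp
    qed
    have "2 / real d * (real n)\<^sup>2 - real c * real n \<le> real ((2 * K - d) * (s div d))"
    proof -
      have dn: "1 \<le> real d" "real d \<le> real p + real q" using d d_le by (simp_all flip: of_nat_add)
      have n1: "1 \<le> real n" using n by simp
      \<comment> \<open>The two sides differ by the nonnegative constant
        \<open>2 + 2 g + d\<close>.\<close>
      have "2 * (real n)\<^sup>2 - (4 + 2 * real g + real d) * real n
          \<le> (2 * (real n - 1 - real g) - real d) * (real n - 1)"
        by (simp add: algebra_simps power2_eq_square)
      moreover have "(4 + 2 * real g + real d) * real n \<le> real c * real n * real d"
      proof -
        have "4 + 2 * real g + real d \<le> real c" using dn by (simp add: c_def)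
        also have "\<dots> \<le> real c * real d" using dn by (simp add: mult_le_cancel_left1)
        finally have "(4 + 2 * real g + real d) * real n \<le> (real c * real d) * real n"
          by (rule mult_right_mono) simp
        then show ?thesis by (simp only: mult_ac)
      qed
      ultimately have "2 * (real n)\<^sup>2 - real c * real n * real d
          \<le> (2 * (real n - 1 - real g) - real d) * (real n - 1)" by linarith
      then have "(2 * (real n)\<^sup>2 - real c * real n * real d) / real d
          \<le> (2 * (real n - 1 - real g) - real d) * (real n - 1) / real d"
        by (rule divide_right_mono) simp
      moreover have "(2 * (real n)\<^sup>2 - real c * real n * real d) / real d = 2 / real d * (real n)\<^sup>2 - real c * real n"
        using dn by (simp add: diff_divide_distrib)
      moreover have "real ((2 * K - d) * (s div d)) = (2 * (real n - 1 - real g) - real d) * (real n - 1) / real d"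
      proof -
        have "real s = real n - 1" by (simp add: n_eq)
        then show ?thesis by (simp only: of_nat_mult K sd times_divide_eq_right)
      qed
      ultimately show ?thesis by (simp only:)
    qed
    then have "ereal (2 / real (gcd (n - 1) (p + q)) * (real n)\<^sup>2 + - (real c * real n))
        \<le> ereal_of_enat (enat ((2 * K - d) * (s div d)))"
      unfolding gcd_eq by simp
    also have "\<dots> \<le> ereal_of_enat (M_hI TYPE('a) p q n)"
      using le by (simp only: ereal_of_enat_le_iff)
    finally show ?thesis .
  qed
  show ?thesis
  proof (rule that)
    show "(\<lambda>n. - (real c * real n)) \<in> O(\<lambda>n. real n)" by simp
    show "\<forall>\<^sub>F n in sequentially. ereal (2 / real (gcd (n - 1) (p + q)) * (real n)\<^sup>2 + - (real c * real n))
      \<le> ereal_of_enat (M_hI TYPE('a) p q n)"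
      using bound by (intro eventually_sequentiallyI)
  qed
qed

theorem theorem3:
  fixes p q :: nat
  assumes "0 < p" and "p \<le> q" and "gcd p q = 1"
  shows
    "(\<exists>e \<in> O(\<lambda>n::nat. real n). \<forall>\<^sub>F n in sequentially.
        ereal (3 / (2 * real (gcd (n - 1) (p + q))) * (real n)\<^sup>2 + e n)
          \<le> ereal_of_enat (M_hI TYPE(real) p q n)) \<and>
     (\<exists>e \<in> O(\<lambda>n::nat. real n). \<forall>\<^sub>F n in sequentially.
        ereal (3 / (2 * real (gcd (n - 1) (p + q))) * (real n)\<^sup>2 + e n)
          \<le> ereal_of_enat (M_hI TYPE(complex) p q n)) \<and>
     (p = 1 \<longrightarrow>
        (\<exists>e \<in> O(\<lambda>n::nat. real n). \<forall>\<^sub>F n in sequentially.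
           ereal (2 / real (gcd (n - 1) (1 + q)) * (real n)\<^sup>2 + e n)
             \<le> ereal_of_enat (M_hI TYPE(real) 1 q n)) \<and>
        (\<exists>e \<in> O(\<lambda>n::nat. real n). \<forall>\<^sub>F n in sequentially.
           ereal (2 / real (gcd (n - 1) (1 + q)) * (real n)\<^sup>2 + e n)
             \<le> ereal_of_enat (M_hI TYPE(complex) 1 q n)))"
proof -
  have pq: "0 < p" "0 < q" "coprime p q" using assms by (simp_all add: coprime_iff_gcd_eq_1)
  \<comment> \<open>The constant 2 is available for every coprime pair; since 3/2 \<le> 2, the same
    error function serves the general bound.\<close>
  have weaken: "\<forall>\<^sub>F n in sequentially.
        ereal (3 / (2 * real (gcd (n - 1) (p + q))) * (real n)\<^sup>2 + e n) \<le> F n"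
    if "\<forall>\<^sub>F n in sequentially. ereal (2 / real (gcd (n - 1) (p + q)) * (real n)\<^sup>2 + e n) \<le> F n"
    for e and F :: "nat \<Rightarrow> ereal"
    using that
  proof eventually_elim
    case (elim n)
    have "3 / (2 * real (gcd (n - 1) (p + q))) \<le> 2 / real (gcd (n - 1) (p + q))"
      by (cases "gcd (n - 1) (p + q) = 0") (simp_all add: field_simps)
    then have "ereal (3 / (2 * real (gcd (n - 1) (p + q))) * (real n)\<^sup>2 + e n)
        \<le> ereal (2 / real (gcd (n - 1) (p + q)) * (real n)\<^sup>2 + e n)"
      unfolding ereal_less_eq by (intro add_right_mono mult_right_mono) simp_all
    then show ?case using elim by (rule order.trans)
  qed
  obtain e\<^sub>1 where e\<^sub>1: "e\<^sub>1 \<in> O(\<lambda>n::nat. real n)"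
    "\<forall>\<^sub>F n in sequentially. ereal (2 / real (gcd (n - 1) (p + q)) * (real n)\<^sup>2 + e\<^sub>1 n)
      \<le> ereal_of_enat (M_hI TYPE(real) p q n)"
    using M_hI_asymptotics[OF pq] by blast
  obtain e\<^sub>2 where e\<^sub>2: "e\<^sub>2 \<in> O(\<lambda>n::nat. real n)"
    "\<forall>\<^sub>F n in sequentially. ereal (2 / real (gcd (n - 1) (p + q)) * (real n)\<^sup>2 + e\<^sub>2 n)
      \<le> ereal_of_enat (M_hI TYPE(complex) p q n)"
    using M_hI_asymptotics[OF pq] by blast
  have "\<exists>e \<in> O(\<lambda>n::nat. real n). \<forall>\<^sub>F n in sequentially.
      ereal (3 / (2 * real (gcd (n - 1) (p + q))) * (real n)\<^sup>2 + e n) \<le> ereal_of_enat (M_hI TYPE(real) p q n)"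
    using weaken[OF e\<^sub>1(2)] e\<^sub>1(1) by (rule bexI[of _ e\<^sub>1])
  moreover have "\<exists>e \<in> O(\<lambda>n::nat. real n). \<forall>\<^sub>F n in sequentially.
      ereal (3 / (2 * real (gcd (n - 1) (p + q))) * (real n)\<^sup>2 + e n) \<le> ereal_of_enat (M_hI TYPE(complex) p q n)"
    using weaken[OF e\<^sub>2(2)] e\<^sub>2(1) by (rule bexI[of _ e\<^sub>2])
  moreover have "\<exists>e \<in> O(\<lambda>n::nat. real n). \<forall>\<^sub>F n in sequentially.
      ereal (2 / real (gcd (n - 1) (1 + q)) * (real n)\<^sup>2 + e n) \<le> ereal_of_enat (M_hI TYPE(real) 1 q n)"
    if "p = 1"
    using e\<^sub>1(2,1) unfolding that by (rule bexI[of _ e\<^sub>1])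
  moreover have "\<exists>e \<in> O(\<lambda>n::nat. real n). \<forall>\<^sub>F n in sequentially.
      ereal (2 / real (gcd (n - 1) (1 + q)) * (real n)\<^sup>2 + e n) \<le> ereal_of_enat (M_hI TYPE(complex) 1 q n)"
    if "p = 1"
    using e\<^sub>2(2,1) unfolding that by (rule bexI[of _ e\<^sub>2])
  ultimately show ?thesis by (intro conjI impI)
qed

end
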